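(* Let $1\le p<\infty$, $0<\theta<1$, $n\ge1$ an integer, and assume that $p\theta<n$. Let $q=np/(n-p\theta)$, $\tilde u\in B^\theta_{p,p}(\mathbf R^n)$, $$u(\zeta):=\limsup_{r\to0^+}\frac1{|B(\zeta,r)|}\int_{B(\zeta,r)}\tilde u(x)\,dx,$$ and let $$E=\Bigl\{\zeta\in\mathbf R^n:\limsup_{r\to0^+}\frac{1}{|B(\zeta,r)|}\int_{B(\zeta,r)}|u(x)-u(\zeta)|^q\,dx>0\Bigr\}$$ be the set of non-$L^q$-Lebesgue points for $u$. Then $\operatorname{Cap}_{B^\theta_{p,p}(\mathbf R^n)}(E)=0$.
   Context: $\mathbf R^n$ is equipped with the Euclidean metric and Lebesgue measure $|\cdot|$. $B^\theta_{p,p}(\mathbf R^n)$ consists of $u\in L^p(\mathbf R^n)$ with $$\|u\|_{\theta,p}^p=\int_{\mathbf R^n}\int_{\mathbf R^n}\frac{|u(\zeta)-u(\xi)|^p}{|\zeta-\xi|^{p\theta}}\frac{d\xi\,d\zeta}{|B(\zeta,|\zeta-\xi|)|}<\infty.$$ The Besov capacity of $E\subset\mathbf R^n$ is $\operatorname{Cap}_{B^\theta_{p,p}(\mathbf R^n)}(E)=\inf_u(\|u\|_{\theta,p}^p+\|u\|_{L^p(\mathbf R^n)}^p)$, infimum over $u\in B^\theta_{p,p}(\mathbf R^n)$ with $u\ge1$ a.e. on a neighborhood of $E$. *)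

theory Defs
  imports "HOL-Analysis.Analysis"
begin

definition besov_energy :: "real \<Rightarrow> real \<Rightarrow> ('a::euclidean_space \<Rightarrow> real) \<Rightarrow> ennreal" where
  "besov_energy \<theta> p u =
     (\<integral>\<^sup>+ \<zeta>. (\<integral>\<^sup>+ \<xi>. ennreal (\<bar>u \<zeta> - u \<xi>\<bar> powr p /
        (dist \<zeta> \<xi> powr (p * \<theta>) * measure lebesgue (ball \<zeta> (dist \<zeta> \<xi>)))) \<partial>lebesgue) \<partial>lebesgue)"
  \<comment> \<open>This is the \<open>p\<close>-th power of the Besov seminorm. On the diagonal, a null set, the
      integrand is \<open>0 / 0 = 0\<close>.\<close>

definition Lp_energy :: "real \<Rightarrow> ('a::euclidean_space \<Rightarrow> real) \<Rightarrow> ennreal" where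
  "Lp_energy p u = (\<integral>\<^sup>+ x. ennreal (\<bar>u x\<bar> powr p) \<partial>lebesgue)"

text \<open>Elements of \<open>L\<^sup>p\<close> are finite almost everywhere, so real-valued representatives suffice.\<close>

definition besov_space :: "real \<Rightarrow> real \<Rightarrow> ('a::euclidean_space \<Rightarrow> real) set" where
  "besov_space \<theta> p =
     {u \<in> borel_measurable lebesgue. Lp_energy p u < \<infinity> \<and> besov_energy \<theta> p u < \<infinity>}"

definition besov_capacity :: "real \<Rightarrow> real \<Rightarrow> 'a::euclidean_space set \<Rightarrow> ennreal" where
  "besov_capacity \<theta> p E =
     (INF u \<in> {u \<in> besov_space \<theta> p.
                 \<exists>U. open U \<and> E \<subseteq> U \<and> (AE x in lebesgue. x \<in> U \<longrightarrow> 1 \<le> u x)}.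
        besov_energy \<theta> p u + Lp_energy p u)"

definition ball_average :: "('a::euclidean_space \<Rightarrow> real) \<Rightarrow> 'a \<Rightarrow> real \<Rightarrow> real" where
  "ball_average f \<zeta> r = (LINT x:ball \<zeta> r|lebesgue. f x) / measure lebesgue (ball \<zeta> r)"

definition nn_ball_average :: "('a::euclidean_space \<Rightarrow> ennreal) \<Rightarrow> 'a \<Rightarrow> real \<Rightarrow> ennreal" where
  "nn_ball_average f \<zeta> r = (\<integral>\<^sup>+ x\<in>ball \<zeta> r. f x \<partial>lebesgue) / emeasure lebesgue (ball \<zeta> r)"

text \<open>The library has no real powers on \<^typ>\<open>ennreal\<close>. The value at infinity is the
  right one for positive exponents only.\<close>

definition ennreal_powr :: "ennreal \<Rightarrow> real \<Rightarrow> ennreal" where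
  "ennreal_powr x a = (if x = \<infinity> then \<infinity> else ennreal (enn2real x powr a))"

text \<open>The limsup of averages may be infinite at some points, so the function whose
  Lebesgue points are considered is \<^typ>\<open>ereal\<close>-valued. Points where it is infinite
  are non-Lebesgue points, because \<^typ>\<open>ereal\<close> subtraction obeys the following law,
  also when both arguments are the same infinity.\<close>

lemma ereal_abs_diff_infinite:
  fixes a b :: ereal
  assumes "\<bar>b\<bar> = \<infinity>"
  shows "\<bar>a - b\<bar> = \<infinity>"
  using assms by (cases a; cases b) auto

definition non_Lebesgue_points :: "real \<Rightarrow> ('a::euclidean_space \<Rightarrow> ereal) \<Rightarrow> 'a set" where
  "non_Lebesgue_points q u =
     {\<zeta>. Limsup (at_right 0)
           (nn_ball_average (\<lambda>x. ennreal_powr (e2ennreal \<bar>u x - u \<zeta>\<bar>) q) \<zeta>) > 0}"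

end

theory Submission
  imports Defs
begin

text \<open>
  For dyadic radii \<open>rad j\<close> let \<open>osc p j\<close> be the normalised \<open>p\<close>-th order oscillation of \<open>f\<close> at scale
  \<open>rad j\<close>. The Besov energy of \<open>f\<close> dominates the sum over \<open>j\<close> of the integrals of \<open>osc p j\<close>.
  Differences of averages of \<open>f\<close> over comparable balls are bounded by averages of \<open>osc 1 j\<close>, so the
  averages at \<open>z\<close> converge wherever the potential \<open>pot N z\<close>, a sum over \<open>j \<ge> N\<close> of mollifications
  of \<open>osc 1 j\<close>, is finite. The potential is lower semicontinuous and its truncation at \<open>1\<close> has
  Besov norm bounded by the tail of the convergent series, which makes it a test function showing
  that \<open>pot N = \<infinity>\<close> for all \<open>N\<close> only on a set of capacity zero. The same averages give, by
  Hedberg's interpolation between scales, a fractional Sobolev--Poincare inequality on balls, whose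
  right-hand side is a density of the localised energy. A Vitali covering together with the capacity
  of balls shows that this density tends to zero outside a set of capacity zero. This avoids
  maximal function bounds and hence covers \<open>p = 1\<close>.
\<close>

section \<open>Inequalities for dyadic series\<close>

text \<open>A competitor for the capacity must be at least 1 almost everywhere on an open
  neighbourhood of the exceptional set and must itself have small Besov norm. Hence the potential is
  built from Lipschitz cut-offs rather than sharp ball averages: continuity gives open superlevel
  sets, and the Lipschitz bound at scale r turns the Besov weight into a kernel whose integral is
  bounded uniformly in r. Two exponents occur because averages see first order oscillation while the
  energy controls order p; Jensen's inequality is the bridge. The two kinds of exceptional points
  fit together through scaling: a ball of radius r has capacity at most of order r^(n - p\<theta>),
  which is the threshold in the density condition, and with q = np/(n - p\<theta>) the identity
  (p\<theta> - n) q / p = -n turns a vanishing density into a vanishing mean of |f - L|^q.\<close>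

definition rad :: "nat \<Rightarrow> real" where
  "rad j = (1/2) ^ j"

lemma rad_pos [simp]: "0 < rad j" and rad_nonneg [simp]: "0 \<le> rad j"
  and rad_le_1 [simp]: "rad j \<le> 1" and rad_Suc: "rad (Suc j) = rad j / 2"
  by (simp_all add: rad_def power_le_one)

lemma rad_neq_0 [simp]: "rad j \<noteq> 0"
  using rad_pos[of j] by linarith

lemma rad_mono: "i \<le> j \<Longrightarrow> rad j \<le> rad i"
  unfolding rad_def by (rule power_decreasing) auto

lemma rad_powr: "rad j powr a = (2 powr (-a)) ^ j"
  by (simp add: rad_def powr_realpow [symmetric] powr_powr powr_divide powr_minus_divide mult.commute
      power_divide powr_power)

lemma rad_tendsto_0: "rad \<longlonglongrightarrow> 0"
  unfolding rad_def by (rule LIMSEQ_power_zero) auto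

lemma rad_bracket:
  assumes "0 < r" "r \<le> 1"
  obtains j where "rad (Suc j) < r" "r \<le> rad j"
proof -
  have "\<exists>j. rad j < r"
    using order_tendstoD(2)[OF rad_tendsto_0 assms(1)] by (auto simp: eventually_sequentially)
  define J where "J = (LEAST j. rad j < r)"
  have J: "rad J < r"
    unfolding J_def using \<open>\<exists>j. rad j < r\<close> by (rule LeastI_ex)
  have "J \<noteq> 0"
    using J assms by (intro notI) (simp add: rad_def)
  then obtain j where j: "J = Suc j"
    by (cases J) auto
  then have "\<not> rad j < r"
    using not_less_Least[of j "\<lambda>j. rad j < r"] by (auto simp: J_def)
  with J j that show ?thesis by (auto simp: not_less)
qed

lemma suminf_geometric_ennreal:
  assumes "0 \<le> x" "x < 1" "0 \<le> c"
  shows "(\<Sum>i. ennreal (c * x ^ i)) = ennreal (c / (1 - x))"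
  using sums_mult[OF geometric_sums, of x c] assms
  by (intro suminf_ennreal_eq) auto

lemma suminf_le_initial_segment:
  fixes f :: "nat \<Rightarrow> ennreal"
  shows "suminf f \<le> (\<Sum>i. f (i + J)) + sum f {..<J}"
proof (rule suminf_le_const)
  fix n
  have "sum f {..<n} \<le> sum f {..<n + J}"
    by (intro sum_mono2) auto
  also have "\<dots> = (\<Sum>i<n. f (i + J)) + sum f {..<J}"
    by (induction n) (auto simp: add_ac)
  also have "\<dots> \<le> (\<Sum>i. f (i + J)) + sum f {..<J}"
    by (intro add_right_mono sum_le_suminf) auto
  finally show "sum f {..<n} \<le> (\<Sum>i. f (i + J)) + sum f {..<J}" .
qed simp

text \<open>The two terms agree where the radius is \<open>t\<close>, with common value
  \<open>V\<close>; away from the crossing the smaller one decays geometrically, by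
  \<open>2 powr -\<alpha>\<close> per step to finer scales and by \<open>2 powr -\<beta>\<close> per
  step to coarser ones. Used for the Besov weight, for differences of the potential and for
  Hedberg's interpolation.\<close>

lemma suminf_min_geometric:
  fixes \<alpha> \<beta> a b :: real
  assumes "0 < \<alpha>" "0 < \<beta>" "0 \<le> a" "0 \<le> b"
  shows "(\<Sum>j. ennreal (min (a * rad j powr \<alpha>) (b * rad j powr - \<beta>)))
    \<le> ennreal ((1 / (1 - 2 powr -\<alpha>) + 1 / (1 - 2 powr -\<beta>)) *
         (a powr (\<beta> / (\<alpha> + \<beta>)) * b powr (\<alpha> / (\<alpha> + \<beta>))))"
proof (cases "a = 0 \<or> b = 0")
  case True
  then have "min (a * rad j powr \<alpha>) (b * rad j powr - \<beta>) = 0" for j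
    using assms by (auto simp: min_absorb1 min_absorb2)
  then show ?thesis by simp
next
  case False
  then have ab: "0 < a" "0 < b" using assms by auto
  define t where "t = (b / a) powr (1 / (\<alpha> + \<beta>))"
  define V where "V = a powr (\<beta> / (\<alpha> + \<beta>)) * b powr (\<alpha> / (\<alpha> + \<beta>))"
  \<comment> \<open>First scale at or below the crossing. If \<open>t\<close> is at least 1, then
    \<open>J = 0\<close> and the head is empty.\<close>
  define J where "J = (LEAST j. rad j \<le> t)"
  have t: "0 < t" using ab by (simp add: t_def)
  have V: "0 \<le> V" by (simp add: V_def)
  have s1: "1 - \<alpha> / (\<alpha> + \<beta>) = \<beta> / (\<alpha> + \<beta>)" "1 - \<beta> / (\<alpha> + \<beta>) = \<alpha> / (\<alpha> + \<beta>)"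
    using assms by (auto simp: field_simps)
  have at: "a * t powr \<alpha> = V"
  proof -
    have "a * t powr \<alpha> = a powr 1 * (b powr (\<alpha> / (\<alpha> + \<beta>)) / a powr (\<alpha> / (\<alpha> + \<beta>)))"
      using ab by (simp add: t_def powr_powr powr_divide)
    also have "\<dots> = a powr (1 - \<alpha> / (\<alpha> + \<beta>)) * b powr (\<alpha> / (\<alpha> + \<beta>))"
      by (simp add: powr_diff)
    finally show ?thesis by (simp add: V_def s1)
  qed
  have bt: "b * t powr - \<beta> = V"
  proof -
    have "b * t powr - \<beta> = b powr 1 * (a powr (\<beta> / (\<alpha> + \<beta>)) / b powr (\<beta> / (\<alpha> + \<beta>)))"
      using ab by (simp add: t_def powr_powr powr_divide powr_minus divide_simps)
    also have "\<dots> = a powr (\<beta> / (\<alpha> + \<beta>)) * b powr (1 - \<beta> / (\<alpha> + \<beta>))"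
      by (simp add: powr_diff)
    finally show ?thesis by (simp add: V_def s1)
  qed
  have "\<exists>j. rad j \<le> t"
    using order_tendstoD(2)[OF rad_tendsto_0 t] by (auto simp: eventually_sequentially intro: less_imp_le)
  then have J: "rad J \<le> t"
    unfolding J_def by (rule LeastI_ex)
  have J': "t < rad j" if "j < J" for j
    using not_less_Least[of j "\<lambda>j. rad j \<le> t"] that by (auto simp: J_def)
  have less1: "2 powr -\<alpha> < 1" "2 powr -\<beta> < 1"
    using powr_less_one[of 2 "-\<alpha>"] powr_less_one[of 2 "-\<beta>"] assms by auto
  let ?h = "\<lambda>j. ennreal (min (a * rad j powr \<alpha>) (b * rad j powr - \<beta>))"
  have tail: "?h (i + J) \<le> ennreal (V * (2 powr -\<alpha>) ^ i)" for i
  proof -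
    have "a * rad (i + J) powr \<alpha> = a * rad J powr \<alpha> * (2 powr -\<alpha>) ^ i"
      by (simp add: rad_powr power_add mult_ac)
    also have "\<dots> \<le> a * t powr \<alpha> * (2 powr -\<alpha>) ^ i"
      using J ab assms by (intro mult_right_mono mult_left_mono powr_mono2) auto
    finally show ?thesis by (simp add: at min.coboundedI1 ennreal_leI)
  qed
  \<comment> \<open>Counting down from \<open>J - 1\<close>: there the radius still exceeds
    \<open>t\<close>, and each further step doubles it.\<close>
  have head: "?h (J - Suc i) \<le> ennreal (V * (2 powr -\<beta>) ^ i)" if "i < J" for i
  proof -
    have "rad (J - Suc i) * (1/2) ^ i = rad (J - 1)"
      using that by (simp add: rad_def power_add [symmetric])
    then have "rad (J - Suc i) = rad (J - 1) * 2 ^ i"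
      by (simp add: field_simps power_divide)
    moreover have "t < rad (J - 1)"
      using that by (intro J') auto
    ultimately have "t * 2 ^ i \<le> rad (J - Suc i)"
      by (simp add: less_imp_le)
    then have "rad (J - Suc i) powr - \<beta> \<le> (t * 2 ^ i) powr - \<beta>"
      using t assms by (intro powr_mono2') auto
    also have "\<dots> = t powr -\<beta> * (2 powr -\<beta>) ^ i"
      using t by (simp add: powr_mult powr_power powr_realpow [symmetric] powr_powr mult.commute)
    finally have "b * rad (J - Suc i) powr - \<beta> \<le> b * t powr -\<beta> * (2 powr -\<beta>) ^ i"
      using ab by simp
    then show ?thesis by (simp add: bt min.coboundedI2 ennreal_leI)
  qed
  have "sum ?h {..<J} = (\<Sum>i<J. ?h (J - Suc i))"
    by (rule sum.nat_diff_reindex [symmetric])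
  also have "\<dots> \<le> (\<Sum>i<J. ennreal (V * (2 powr -\<beta>) ^ i))"
    by (intro sum_mono head) auto
  also have "\<dots> \<le> (\<Sum>i. ennreal (V * (2 powr -\<beta>) ^ i))"
    by (intro sum_le_suminf) auto
  also have "\<dots> = ennreal (V / (1 - 2 powr -\<beta>))"
    using less1 V by (intro suminf_geometric_ennreal) auto
  finally have head_le: "sum ?h {..<J} \<le> ennreal (V / (1 - 2 powr -\<beta>))" .
  have "(\<Sum>i. ?h (i + J)) \<le> (\<Sum>i. ennreal (V * (2 powr -\<alpha>) ^ i))"
    by (intro suminf_le tail) auto
  also have "\<dots> = ennreal (V / (1 - 2 powr -\<alpha>))"
    using less1 V by (intro suminf_geometric_ennreal) auto
  finally have "(\<Sum>i. ?h (i + J)) + sum ?h {..<J}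
      \<le> ennreal (V / (1 - 2 powr -\<alpha>)) + ennreal (V / (1 - 2 powr -\<beta>))"
    using head_le by (rule add_mono)
  then have "suminf ?h \<le> ennreal (V / (1 - 2 powr -\<alpha>)) + ennreal (V / (1 - 2 powr -\<beta>))"
    using suminf_le_initial_segment[of ?h J] by (rule order_trans [rotated])
  also have "\<dots> = ennreal ((1 / (1 - 2 powr -\<alpha>) + 1 / (1 - 2 powr -\<beta>)) * V)"
    using less1 V by (simp add: ennreal_plus [symmetric] algebra_simps del: ennreal_plus)
  finally show ?thesis by (simp add: V_def)
qed

text \<open>The convex function x^p lies above its tangent at \<open>s\<close>. Being linear in
  \<open>a\<close>, the bound can be integrated, and optimising over \<open>s\<close> afterwards
  recovers Jensen's inequality.\<close>

lemma young_tangent: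
  fixes a s p :: real
  assumes "1 \<le> p" "0 \<le> a" "0 < s"
  shows "p * s powr (p - 1) * a \<le> a powr p + (p - 1) * s powr p"
proof (cases "p = 1")
  case True
  with assms show ?thesis by simp
next
  case False
  with assms have p: "1 < p" by simp
  define q where "q = p / (p - 1)"
  have "1 / p + 1 / q = 1" "1 < q"
    using p by (auto simp: q_def field_simps)
  then have "a * s powr (p - 1) \<le> a powr p / p + (s powr (p - 1)) powr q / q"
    using Youngs_inequality[of p q a "s powr (p - 1)"] p assms by auto
  also have "(s powr (p - 1)) powr q = s powr p"
    using p by (simp add: powr_powr q_def)
  finally have "a * s powr (p - 1) \<le> a powr p / p + s powr p * (p - 1) / p"
    by (simp add: q_def)
  then have "p * (a * s powr (p - 1)) \<le> p * (a powr p / p + s powr p * (p - 1) / p)"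
    using p by (intro mult_left_mono) auto
  also have "\<dots> = a powr p + (p - 1) * s powr p"
    using p by (simp add: field_simps)
  finally show ?thesis by (simp add: mult_ac)
qed

lemma powr_sum_le:
  fixes a b p :: real
  assumes "0 \<le> a" "0 \<le> b" "0 \<le> p"
  shows "(a + b) powr p \<le> 2 powr p * (a powr p + b powr p)"
proof -
  have "(a + b) powr p \<le> (2 * max a b) powr p"
    using assms by (intro powr_mono2) auto
  also have "\<dots> = 2 powr p * max a b powr p"
    using assms by (simp add: powr_mult)
  also have "max a b powr p \<le> a powr p + b powr p"
    by (auto simp: max_def)
  finally show ?thesis by (simp add: mult_left_mono)
qed

text \<open>Jensen's inequality \<open>T\<^sup>p \<le> m\<^sup>p\<^sup>-\<^sup>1 J\<close> in a form dual to Young's inequality, which keeps powers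
  away from \<^typ>\<open>ennreal\<close>.\<close>

lemma powr_le_of_tangents:
  fixes T m p :: real and J :: ennreal
  assumes "1 \<le> p" "0 \<le> T" "0 < m"
    and young: "\<And>s. 0 < s \<Longrightarrow> ennreal (p * s powr (p - 1) * T) \<le> J + ennreal ((p - 1) * s powr p * m)"
  shows "ennreal (T powr p) \<le> ennreal (m powr (p - 1)) * J"
proof (cases "T = 0 \<or> J = \<infinity>")
  case True
  then show ?thesis using assms by (auto simp: ennreal_mult_top)
next
  case False
  then obtain c where J: "J = ennreal c" and c: "0 \<le> c" by (cases J) auto
  have T: "0 < T" using False assms by auto
  \<comment> \<open>The optimal tangent point is the mean.\<close>
  define s where "s = T / m"
  have s: "0 < s" using T assms by (simp add: s_def)
  have "p * s powr (p - 1) * T \<le> c + (p - 1) * s powr p * m"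
    using young[OF s] c assms unfolding J
    by (subst (asm) ennreal_plus [symmetric]) (auto simp del: ennreal_plus)
  moreover have "s powr p * m = s powr (p - 1) * T"
  proof -
    have "s powr p = s powr (p - 1) * s"
      using s by (simp add: powr_mult_base powr_add [symmetric] mult.commute)
    then show ?thesis using assms by (simp add: s_def)
  qed
  ultimately have "p * s powr (p - 1) * T \<le> c + (p - 1) * (s powr (p - 1) * T)"
    by (simp add: mult.assoc)
  then have "s powr (p - 1) * T \<le> c"
    by (simp add: algebra_simps)
  then have "m powr (p - 1) * (s powr (p - 1) * T) \<le> m powr (p - 1) * c"
    by (simp add: mult_left_mono)
  also have "m powr (p - 1) * (s powr (p - 1) * T) = T powr (p - 1) * T"
    using assms T s by (simp add: s_def powr_divide)
  also have "\<dots> = T powr p"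
    using T by (simp add: powr_mult_base mult.commute)
  finally show ?thesis
    using c by (simp add: J ennreal_mult [symmetric] ennreal_leI)
qed

section \<open>Besov capacity\<close>

lemma besov_energy_cong_AE:
  assumes "AE x in lebesgue. u x = v x"
  shows "besov_energy \<theta> p u = besov_energy \<theta> p v"
  unfolding besov_energy_def
proof (rule nn_integral_cong_AE, use assms in eventually_elim)
  fix x assume "u x = v x"
  with assms show "(\<integral>\<^sup>+y. ennreal (\<bar>u x - u y\<bar> powr p / (dist x y powr (p * \<theta>) *
      measure lebesgue (ball x (dist x y)))) \<partial>lebesgue) =
    (\<integral>\<^sup>+y. ennreal (\<bar>v x - v y\<bar> powr p / (dist x y powr (p * \<theta>) *
      measure lebesgue (ball x (dist x y)))) \<partial>lebesgue)"
    by (intro nn_integral_cong_AE) (use assms in eventually_elim, simp)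
qed

lemma Lp_energy_cong_AE:
  assumes "AE x in lebesgue. u x = v x"
  shows "Lp_energy p u = Lp_energy p v"
  unfolding Lp_energy_def
  using assms by (auto intro!: nn_integral_cong_AE elim!: eventually_mono)

lemma besov_energy_lborel:
  fixes u :: "'a::euclidean_space \<Rightarrow> real"
  shows "besov_energy \<theta> p u =
    (\<integral>\<^sup>+x. \<integral>\<^sup>+y. ennreal (\<bar>u x - u y\<bar> powr p /
       (dist x y powr (p * \<theta>) * (unit_ball_vol DIM('a) * dist x y ^ DIM('a)))) \<partial>lborel \<partial>lborel)"
  by (simp add: besov_energy_def nn_integral_completion content_ball)

lemma Lp_energy_lborel: "Lp_energy p u = (\<integral>\<^sup>+x. ennreal (\<bar>u x\<bar> powr p) \<partial>lborel)"
  by (simp add: Lp_energy_def nn_integral_completion)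

text \<open>Energies and averages are computed over \<open>lborel\<close>, where Tonelli's theorem
  applies to Borel functions of two variables.\<close>

lemma borel_representative:
  fixes u :: "'a::euclidean_space \<Rightarrow> real"
  assumes "u \<in> borel_measurable lebesgue"
  obtains v where "v \<in> borel_measurable borel" "AE x in lebesgue. u x = v x"
proof -
  obtain v where "v \<in> borel_measurable lborel" "AE x in lborel. u x = v x"
    using completion_ex_borel_measurable_real[OF assms] by auto
  with that show ?thesis by (auto intro: AE_completion)
qed

text \<open>If the right-hand side is infinite there is nothing to prove, so membership of
  \<open>v\<close> in \<open>besov_space\<close> never has to be checked separately.\<close>

lemma besov_capacity_le:
  assumes "v \<in> borel_measurable borel" "open U" "A \<subseteq> U" "AE x in lebesgue. x \<in> U \<longrightarrow> 1 \<le> v x"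
  shows "besov_capacity \<theta> p A \<le> besov_energy \<theta> p v + Lp_energy p v"
proof (cases "besov_energy \<theta> p v + Lp_energy p v = \<infinity>")
  case False
  then have "besov_energy \<theta> p v < \<infinity>" "Lp_energy p v < \<infinity>"
    by (auto simp: less_top)
  moreover have "v \<in> borel_measurable lebesgue"
    using assms by (auto intro: measurable_completion)
  ultimately show ?thesis
    unfolding besov_capacity_def using assms by (intro INF_lower) (auto simp: besov_space_def)
qed auto

lemma besov_capacity_mono: "A \<subseteq> B \<Longrightarrow> besov_capacity \<theta> p A \<le> besov_capacity \<theta> p B"
  unfolding besov_capacity_def by (intro INF_superset_mono) auto

lemma abs_diff_clamp_le:
  fixes a b :: real
  shows "\<bar>max 0 (min 1 a) - max 0 (min 1 b)\<bar> \<le> \<bar>a - b\<bar>"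
  by (auto simp: max_def min_def)

text \<open>Truncation to \<open>[0, 1]\<close> makes the supremum of an arbitrary sequence of competitors finite.\<close>

lemma besov_capacity_competitor:
  fixes A :: "'a::euclidean_space set"
  assumes "besov_capacity \<theta> p A < c" "0 \<le> p"
  obtains v U where "v \<in> borel_measurable borel" "open U" "A \<subseteq> U"
    "AE x in lebesgue. x \<in> U \<longrightarrow> v x = 1" "\<And>x. 0 \<le> v x" "\<And>x. v x \<le> 1"
    "besov_energy \<theta> p v + Lp_energy p v < c"
proof -
  obtain u U where u: "u \<in> besov_space \<theta> p" and U: "open U" "A \<subseteq> U"
    and ge: "AE x in lebesgue. x \<in> U \<longrightarrow> 1 \<le> u x"
    and less: "besov_energy \<theta> p u + Lp_energy p u < c"
    using assms(1) unfolding besov_capacity_def INF_less_iff by auto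
  obtain w where w: "w \<in> borel_measurable borel" "AE x in lebesgue. u x = w x"
    using borel_representative u by (auto simp: besov_space_def)
  let ?v = "\<lambda>x. max 0 (min 1 (w x))"
  have "besov_energy \<theta> p ?v \<le> besov_energy \<theta> p w"
    unfolding besov_energy_def
    by (intro nn_integral_mono ennreal_leI divide_right_mono powr_mono2 abs_diff_clamp_le assms) auto
  moreover have "Lp_energy p ?v \<le> Lp_energy p w"
    unfolding Lp_energy_def
    using abs_diff_clamp_le[of _ 0] by (intro nn_integral_mono ennreal_leI powr_mono2 assms) auto
  ultimately have "besov_energy \<theta> p ?v + Lp_energy p ?v \<le> besov_energy \<theta> p w + Lp_energy p w"
    by (rule add_mono)
  also have "\<dots> = besov_energy \<theta> p u + Lp_energy p u"
    using w besov_energy_cong_AE[of u w] Lp_energy_cong_AE[of u w] by simp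
  finally have "besov_energy \<theta> p ?v + Lp_energy p ?v < c"
    using less by simp
  moreover have "AE x in lebesgue. x \<in> U \<longrightarrow> ?v x = 1"
    using ge w(2) by eventually_elim (auto simp: min_def)
  moreover have "?v \<in> borel_measurable borel"
    using w by measurable
  ultimately show ?thesis using U that[of ?v U] by auto
qed

text \<open>A difference of suprema is at most the supremum of the differences, and the p-th power
  of a supremum is at most the sum of the p-th powers. The factor \<open>k\<close> will be the Besov
  weight at a pair of points, whose value on the diagonal is 0.\<close>

lemma abs_diff_SUP_powr_le:
  fixes a b :: "nat \<Rightarrow> real"
  assumes a: "\<And>i. 0 \<le> a i" "\<And>i. a i \<le> 1" and b: "\<And>i. 0 \<le> b i" "\<And>i. b i \<le> 1"
    and p: "0 < p" and k: "0 \<le> k"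
  shows "ennreal (\<bar>(SUP i. a i) - (SUP i. b i)\<bar> powr p * k) \<le> (\<Sum>i. ennreal (\<bar>a i - b i\<bar> powr p * k))"
proof (cases "(\<Sum>i. ennreal (\<bar>a i - b i\<bar> powr p * k)) = \<infinity> \<or> k = 0")
  case False
  then have k: "0 < k" using k by auto
  obtain S where S: "(\<Sum>i. ennreal (\<bar>a i - b i\<bar> powr p * k)) = ennreal S" "0 \<le> S"
    using False by (cases "\<Sum>i. ennreal (\<bar>a i - b i\<bar> powr p * k)") auto
  have bdd: "bdd_above (range a)" "bdd_above (range b)"
    using a b by (auto intro!: bdd_aboveI[of _ 1])
  \<comment> \<open>All differences obey one common bound, so the suprema differ by no more.\<close>
  have le: "\<bar>a i - b i\<bar> \<le> (S / k) powr (1 / p)" for i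
  proof -
    have "sum (\<lambda>i. ennreal (\<bar>a i - b i\<bar> powr p * k)) {i} \<le> (\<Sum>i. ennreal (\<bar>a i - b i\<bar> powr p * k))"
      by (intro sum_le_suminf) auto
    then have "\<bar>a i - b i\<bar> powr p \<le> S / k"
      using S k by (simp add: field_simps)
    then have "(\<bar>a i - b i\<bar> powr p) powr (1 / p) \<le> (S / k) powr (1 / p)"
      using p by (intro powr_mono2) auto
    then show ?thesis using p by (simp add: powr_powr)
  qed
  have "(SUP i. a i) \<le> (SUP i. b i) + (S / k) powr (1 / p)"
  proof (rule cSUP_least)
    fix i show "a i \<le> (SUP i. b i) + (S / k) powr (1 / p)"
      using le[of i] cSUP_upper[OF UNIV_I bdd(2), of i] by linarith
  qed simp
  moreover have "(SUP i. b i) \<le> (SUP i. a i) + (S / k) powr (1 / p)"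
  proof (rule cSUP_least)
    fix i show "b i \<le> (SUP i. a i) + (S / k) powr (1 / p)"
      using le[of i] cSUP_upper[OF UNIV_I bdd(1), of i] by linarith
  qed simp
  ultimately have "\<bar>(SUP i. a i) - (SUP i. b i)\<bar> powr p \<le> ((S / k) powr (1 / p)) powr p"
    using p by (intro powr_mono2) auto
  also have "\<dots> = S / k"
    using p S k by (simp add: powr_powr)
  finally show ?thesis using S k by (simp add: field_simps ennreal_leI)
qed auto

lemma besov_energy_SUP_le:
  fixes v :: "nat \<Rightarrow> 'a::euclidean_space \<Rightarrow> real"
  assumes "\<And>i. v i \<in> borel_measurable borel"
    and "\<And>i x. 0 \<le> v i x" "\<And>i x. v i x \<le> 1" "0 < p"
  shows "besov_energy \<theta> p (\<lambda>x. SUP i. v i x) \<le> (\<Sum>i. besov_energy \<theta> p (v i))"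
proof -
  have "besov_energy \<theta> p (\<lambda>x. SUP i. v i x) \<le>
      (\<integral>\<^sup>+x. \<integral>\<^sup>+y. (\<Sum>i. ennreal (\<bar>v i x - v i y\<bar> powr p /
       (dist x y powr (p * \<theta>) * (unit_ball_vol DIM('a) * dist x y ^ DIM('a))))) \<partial>lborel \<partial>lborel)"
    unfolding besov_energy_lborel divide_inverse
    by (intro nn_integral_mono abs_diff_SUP_powr_le assms) auto
  also have "\<dots> = (\<Sum>i. besov_energy \<theta> p (v i))"
    unfolding besov_energy_lborel
    using assms by (simp add: nn_integral_suminf)
  finally show ?thesis .
qed

lemma Lp_energy_SUP_le:
  fixes v :: "nat \<Rightarrow> 'a::euclidean_space \<Rightarrow> real"
  assumes "\<And>i. v i \<in> borel_measurable borel"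
    and "\<And>i x. 0 \<le> v i x" "\<And>i x. v i x \<le> 1" "0 < p"
  shows "Lp_energy p (\<lambda>x. SUP i. v i x) \<le> (\<Sum>i. Lp_energy p (v i))"
proof -
  have "Lp_energy p (\<lambda>x. SUP i. v i x) \<le> (\<integral>\<^sup>+x. (\<Sum>i. ennreal (\<bar>v i x\<bar> powr p)) \<partial>lborel)"
    unfolding Lp_energy_lborel
  proof (rule nn_integral_mono)
    fix x
    show "ennreal (\<bar>SUP i. v i x\<bar> powr p) \<le> (\<Sum>i. ennreal (\<bar>v i x\<bar> powr p))"
      using abs_diff_SUP_powr_le[of "\<lambda>i. v i x" "\<lambda>_. 0" p 1, OF assms(2,3) _ _ \<open>0 < p\<close>]
      by (simp only: cSUP_const UNIV_not_empty diff_0_right mult_1_right zero_le_one order_refl not_False_eq_True)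
  qed
  also have "\<dots> = (\<Sum>i. Lp_energy p (v i))"
    unfolding Lp_energy_lborel using assms by (simp add: nn_integral_suminf)
  finally show ?thesis .
qed

text \<open>The pointwise supremum of near-optimal competitors is a competitor for the union, and
  its energy is at most the sum of theirs because the estimate for suprema holds pair by pair. The
  errors \<open>e / 2 * (1/2) ^ i\<close> add up to \<open>e\<close>.\<close>

theorem besov_capacity_UN_le:
  fixes A :: "nat \<Rightarrow> 'a::euclidean_space set"
  assumes p: "0 < p"
  shows "besov_capacity \<theta> p (\<Union>i. A i) \<le> (\<Sum>i. besov_capacity \<theta> p (A i))"
proof (rule ennreal_le_epsilon)
  fix e :: real assume fin: "(\<Sum>i. besov_capacity \<theta> p (A i)) < top" and e: "0 < e"
  have "besov_capacity \<theta> p (A i) < top" for i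
    using ennreal_suminf_lessD[OF fin] .
  then have less: "besov_capacity \<theta> p (A i) < besov_capacity \<theta> p (A i) + ennreal (e / 2 * (1/2) ^ i)" for i
  proof -
    obtain c where "besov_capacity \<theta> p (A i) = ennreal c" "0 \<le> c"
      using \<open>besov_capacity \<theta> p (A i) < top\<close> by (cases "besov_capacity \<theta> p (A i)") auto
    then show "besov_capacity \<theta> p (A i) < besov_capacity \<theta> p (A i) + ennreal (e / 2 * (1/2) ^ i)"
      using e by (auto simp: ennreal_plus [symmetric] simp del: ennreal_plus intro!: ennreal_lessI add_nonneg_pos)
  qed
  have "\<exists>v U. v \<in> borel_measurable borel \<and> open U \<and> A i \<subseteq> U \<and>
    (AE x in lebesgue. x \<in> U \<longrightarrow> v x = 1) \<and> (\<forall>x. 0 \<le> v x \<and> v x \<le> 1) \<and>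
    besov_energy \<theta> p v + Lp_energy p v \<le> besov_capacity \<theta> p (A i) + ennreal (e / 2 * (1/2) ^ i)" for i
  proof -
    have "0 \<le> p" using p by simp
    then obtain v U where "v \<in> borel_measurable borel" "open U" "A i \<subseteq> U"
      "AE x in lebesgue. x \<in> U \<longrightarrow> v x = 1" "\<And>x. 0 \<le> v x" "\<And>x. v x \<le> 1"
      "besov_energy \<theta> p v + Lp_energy p v < besov_capacity \<theta> p (A i) + ennreal (e / 2 * (1/2) ^ i)"
      by (rule besov_capacity_competitor[OF less[of i]]) (rule that)
    then show ?thesis
      by (intro exI[of _ v] exI[of _ U]) (simp add: less_imp_le)
  qed
  then have "\<forall>i. \<exists>v U. v \<in> borel_measurable borel \<and> open U \<and> A i \<subseteq> U \<and>
    (AE x in lebesgue. x \<in> U \<longrightarrow> v x = 1) \<and> (\<forall>x. 0 \<le> v x \<and> v x \<le> 1) \<and>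
    besov_energy \<theta> p v + Lp_energy p v \<le> besov_capacity \<theta> p (A i) + ennreal (e / 2 * (1/2) ^ i)"
    by (rule allI)
  then obtain v U where vU: "\<And>i. v i \<in> borel_measurable borel \<and> open (U i) \<and> A i \<subseteq> U i \<and>
    (AE x in lebesgue. x \<in> U i \<longrightarrow> v i x = 1) \<and> (\<forall>x. 0 \<le> v i x \<and> v i x \<le> 1) \<and>
    besov_energy \<theta> p (v i) + Lp_energy p (v i) \<le> besov_capacity \<theta> p (A i) + ennreal (e / 2 * (1/2) ^ i)"
    unfolding choice_iff by auto
  then have v: "\<And>i. v i \<in> borel_measurable borel" "\<And>i x. 0 \<le> v i x" "\<And>i x. v i x \<le> 1"
    and U: "\<And>i. open (U i)" "\<And>i. A i \<subseteq> U i"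
    and eq: "\<And>i. AE x in lebesgue. x \<in> U i \<longrightarrow> v i x = 1"
    and le: "\<And>i. besov_energy \<theta> p (v i) + Lp_energy p (v i) \<le> besov_capacity \<theta> p (A i) + ennreal (e / 2 * (1/2) ^ i)"
    by blast+
  let ?v = "\<lambda>x. SUP i. v i x"
  have bdd: "bdd_above (range (\<lambda>i. v i x))" for x
    using v by (intro bdd_aboveI[of _ 1]) auto
  have "AE x in lebesgue. \<forall>i. x \<in> U i \<longrightarrow> v i x = 1"
    using eq by (simp add: AE_all_countable)
  then have "AE x in lebesgue. x \<in> (\<Union>i. U i) \<longrightarrow> 1 \<le> ?v x"
  proof eventually_elim
    case (elim x)
    show ?case
    proof
      assume "x \<in> (\<Union>i. U i)"
      then obtain i where "v i x = 1" using elim by auto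
      then show "1 \<le> ?v x" using cSUP_upper[OF UNIV_I bdd, of i x] by simp
    qed
  qed
  moreover have "?v \<in> borel_measurable borel"
    using v bdd by (intro borel_measurable_cSUP) auto
  ultimately have "besov_capacity \<theta> p (\<Union>i. A i) \<le> besov_energy \<theta> p ?v + Lp_energy p ?v"
    using U by (intro besov_capacity_le[where U = "\<Union>i. U i"]) auto
  also have "\<dots> \<le> (\<Sum>i. besov_energy \<theta> p (v i)) + (\<Sum>i. Lp_energy p (v i))"
    by (intro add_mono besov_energy_SUP_le Lp_energy_SUP_le v p)
  also have "\<dots> = (\<Sum>i. besov_energy \<theta> p (v i) + Lp_energy p (v i))"
    by (rule suminf_add) auto
  also have "\<dots> \<le> (\<Sum>i. besov_capacity \<theta> p (A i) + ennreal (e / 2 * (1/2) ^ i))"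
    by (intro suminf_le le) auto
  also have "\<dots> = (\<Sum>i. besov_capacity \<theta> p (A i)) + (\<Sum>i. ennreal (e / 2 * (1/2) ^ i))"
    by (rule suminf_add [symmetric]) auto
  also have "(\<Sum>i. ennreal (e / 2 * (1/2) ^ i)) = ennreal e"
    using e by (subst suminf_geometric_ennreal) auto
  finally show "besov_capacity \<theta> p (\<Union>i. A i) \<le> (\<Sum>i. besov_capacity \<theta> p (A i)) + ennreal e" .
qed

lemma besov_capacity_empty:
  assumes "0 < p"
  shows "besov_capacity \<theta> p ({}::'a::euclidean_space set) = 0"
proof -
  have "besov_capacity \<theta> p ({}::'a set) \<le> besov_energy \<theta> p (\<lambda>_::'a. 0) + Lp_energy p (\<lambda>_::'a. 0)"
    by (rule besov_capacity_le[where U = "{}"]) auto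
  then show ?thesis
    using assms by (simp add: besov_energy_def Lp_energy_def)
qed

text \<open>Up to a constant and the factor \<open>r powr - (p * \<theta>)\<close>, this bounds the
  Besov integrand of a difference of size \<open>min 1 (norm h / r)\<close>. It is integrable near 0
  because \<theta> < 1 and at infinity because 0 < \<theta>, and by dilation its integral does not
  depend on \<open>r\<close>.\<close>

definition besov_kernel :: "real \<Rightarrow> real \<Rightarrow> 'a::euclidean_space \<Rightarrow> real" where
  "besov_kernel \<theta> r h = min 1 (norm h / r) / ((norm h / r) powr \<theta> * norm h ^ DIM('a))"

lemma besov_kernel_nonneg [simp]: "0 < r \<Longrightarrow> 0 \<le> besov_kernel \<theta> r h"
  by (simp add: besov_kernel_def)

lemma besov_kernel_measurable [measurable]: "besov_kernel \<theta> r \<in> borel_measurable borel"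
  unfolding besov_kernel_def by measurable

lemma besov_kernel_minus [simp]: "besov_kernel \<theta> r (x - y) = besov_kernel \<theta> r (y - x)"
  by (simp add: besov_kernel_def norm_minus_commute)

text \<open>Two geometric series over dyadic shells, one outside and one inside the ball of radius
  \<open>r\<close>; \<open>2 ^ DIM('a)\<close> is the volume ratio of consecutive dyadic
  balls.\<close>

definition besov_kernel_const :: "'a::euclidean_space itself \<Rightarrow> real \<Rightarrow> real" where
  "besov_kernel_const _ \<theta> = unit_ball_vol DIM('a) * 2 ^ DIM('a) *
     (1 / (1 - 2 powr -\<theta>) + 1 / (1 - 2 powr -(1 - \<theta>)))"

lemma besov_kernel_const_nonneg:
  "0 < \<theta> \<Longrightarrow> \<theta> < 1 \<Longrightarrow> 0 \<le> besov_kernel_const TYPE('a::euclidean_space) \<theta>"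
  using powr_less_one[of 2 "-\<theta>"] powr_less_one[of 2 "-(1 - \<theta>)"]
  by (auto simp: besov_kernel_const_def intro!: mult_nonneg_nonneg add_nonneg_nonneg)

lemma suminf_rad_powr:
  assumes "0 < a" "0 \<le> c"
  shows "(\<Sum>i. ennreal (c * rad i powr a)) = ennreal (c / (1 - 2 powr -a))"
  using assms powr_less_one[of 2 "-a"] unfolding rad_powr by (intro suminf_geometric_ennreal) auto

text \<open>The bound on a dyadic shell is multiplied by the volume of a whole ball containing the
  shell. This costs only \<open>2 ^ n\<close> and leaves one term of a geometric series per
  shell.\<close>

lemma nn_integral_besov_kernel_le:
  assumes "0 < r" "0 < \<theta>" "\<theta> < 1"
  shows "(\<integral>\<^sup>+h. ennreal (besov_kernel \<theta> r (h::'a::euclidean_space)) \<partial>lborel) \<le>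
    ennreal (besov_kernel_const TYPE('a) \<theta>)"
proof -
  define n where "n = DIM('a)"
  define \<omega> where "\<omega> = unit_ball_vol n"
  have \<omega>: "0 < \<omega>" by (simp add: \<omega>_def)
  \<comment> \<open>\<open>outer i\<close> serves the shell
    \<open>1 / rad i <= norm h / r <= 2 / rad i\<close>, and \<open>inside i\<close> the shell
    \<open>rad i / 2 < norm h / r <= rad i\<close>.\<close>
  define outer where "outer = (\<lambda>i (h::'a). ennreal (rad i powr \<theta> / (r / rad i) ^ n) * indicator (cball 0 (2 * r / rad i)) h)"
  define inside where "inside = (\<lambda>i (h::'a). ennreal (rad i powr (1 - \<theta>) / (rad i * r / 2) ^ n) * indicator (cball 0 (rad i * r)) h)"
  have meas [measurable]: "outer i \<in> borel_measurable lborel" "inside i \<in> borel_measurable lborel" for i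
    unfolding outer_def inside_def
    by (intro borel_measurable_times_ennreal borel_measurable_const borel_measurable_indicator; simp)+
  have le: "ennreal (besov_kernel \<theta> r h) \<le> (\<Sum>i. outer i h) + (\<Sum>i. inside i h)" for h :: 'a
  proof (cases "h = 0")
    case False
    define s where "s = norm h / r"
    have s: "0 < s" "norm h = s * r" using False assms by (auto simp: s_def)
    have Q: "besov_kernel \<theta> r h = min 1 s / (s powr \<theta> * (s * r) ^ n)"
      using assms s(1) by (simp add: besov_kernel_def s n_def)
    show ?thesis
    proof (cases "1 \<le> s")
      case True
      obtain i where i: "rad (Suc i) < 1 / s" "1 / s \<le> rad i"
        using rad_bracket[of "1 / s"] True by auto
      have r1: "1 / rad i \<le> s" "s \<le> 2 / rad i"
        using i s rad_pos[of i] by (simp_all add: rad_Suc field_simps)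
      have "(1 / rad i) powr \<theta> * (r / rad i) ^ n \<le> s powr \<theta> * (s * r) ^ n"
        using r1 assms mult_right_mono[OF r1(1), of r] by (intro mult_mono powr_mono2 power_mono) auto
      then have "1 / (s powr \<theta> * (s * r) ^ n) \<le> 1 / ((1 / rad i) powr \<theta> * (r / rad i) ^ n)"
        using assms s(1) rad_pos[of i] by (intro divide_left_mono mult_pos_pos) (auto simp del: rad_pos)
      also have "\<dots> = rad i powr \<theta> / (r / rad i) ^ n"
        by (simp add: powr_divide)
      finally have "besov_kernel \<theta> r h \<le> rad i powr \<theta> / (r / rad i) ^ n"
        using True by (simp add: Q)
      moreover have "h \<in> cball 0 (2 * r / rad i)"
        using mult_right_mono[OF r1(2), of r] assms by (simp add: s)
      ultimately have "ennreal (besov_kernel \<theta> r h) \<le> sum (\<lambda>i. outer i h) {i}"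
        by (simp add: outer_def inside_def ennreal_leI)
      also have "\<dots> \<le> (\<Sum>i. outer i h)"
        by (intro sum_le_suminf) auto
      finally show ?thesis by (simp add: add_increasing2)
    next
      case False
      obtain i where i: "rad (Suc i) < s" "s \<le> rad i"
        using rad_bracket[of s] False s by auto
      have "min 1 s / s powr \<theta> = s powr (1 - \<theta>)"
        using s False by (simp add: powr_diff)
      also have "\<dots> \<le> rad i powr (1 - \<theta>)"
        using i s assms by (intro powr_mono2) auto
      finally have "min 1 s / s powr \<theta> / (s * r) ^ n \<le> rad i powr (1 - \<theta>) / (rad i * r / 2) ^ n"
        using i s assms mult_right_mono[of "rad (Suc i)" s r]
        by (intro frac_le power_mono) (auto simp: rad_Suc)
      then have "besov_kernel \<theta> r h \<le> rad i powr (1 - \<theta>) / (rad i * r / 2) ^ n"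
        by (simp add: Q)
      moreover have "h \<in> cball 0 (rad i * r)"
        using mult_right_mono[OF i(2), of r] assms by (simp add: s)
      ultimately have "ennreal (besov_kernel \<theta> r h) \<le> sum (\<lambda>i. inside i h) {i}"
        by (simp add: outer_def inside_def ennreal_leI)
      also have "\<dots> \<le> (\<Sum>i. inside i h)"
        by (intro sum_le_suminf) auto
      finally show ?thesis by (simp add: add_increasing)
    qed
  qed (simp add: besov_kernel_def)
  have int_o: "(\<integral>\<^sup>+h. (\<Sum>i. outer i h) \<partial>lborel) = ennreal (\<omega> * 2 ^ n / (1 - 2 powr -\<theta>))"
  proof -
    have "(\<integral>\<^sup>+h. (\<Sum>i. outer i h) \<partial>lborel) = (\<Sum>i. \<integral>\<^sup>+h. outer i h \<partial>lborel)"
      by (rule nn_integral_suminf) (rule meas)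
    also have "\<dots> = (\<Sum>i. ennreal (\<omega> * 2 ^ n * rad i powr \<theta>))"
      using assms \<omega>
      by (intro suminf_cong) (simp add: outer_def inside_def nn_integral_cmult_indicator emeasure_cball ennreal_mult [symmetric]
          n_def [symmetric] \<omega>_def [symmetric], simp add: power_mult_distrib power_divide field_simps)
    also have "\<dots> = ennreal (\<omega> * 2 ^ n / (1 - 2 powr -\<theta>))"
      using assms \<omega> by (intro suminf_rad_powr) auto
    finally show ?thesis .
  qed
  have int_i: "(\<integral>\<^sup>+h. (\<Sum>i. inside i h) \<partial>lborel) = ennreal (\<omega> * 2 ^ n / (1 - 2 powr -(1 - \<theta>)))"
  proof -
    have "(\<integral>\<^sup>+h. (\<Sum>i. inside i h) \<partial>lborel) = (\<Sum>i. \<integral>\<^sup>+h. inside i h \<partial>lborel)"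
      by (rule nn_integral_suminf) (rule meas)
    also have "\<dots> = (\<Sum>i. ennreal (\<omega> * 2 ^ n * rad i powr (1 - \<theta>)))"
      using assms \<omega>
      by (intro suminf_cong) (simp add: outer_def inside_def nn_integral_cmult_indicator emeasure_cball ennreal_mult [symmetric]
          n_def [symmetric] \<omega>_def [symmetric], simp add: power_mult_distrib power_divide field_simps)
    also have "\<dots> = ennreal (\<omega> * 2 ^ n / (1 - 2 powr -(1 - \<theta>)))"
      using assms \<omega> by (intro suminf_rad_powr) auto
    finally show ?thesis .
  qed
  have "(\<integral>\<^sup>+h. ennreal (besov_kernel \<theta> r (h::'a)) \<partial>lborel) \<le> (\<integral>\<^sup>+h. (\<Sum>i. outer i h) + (\<Sum>i. inside i h) \<partial>lborel)"
    by (intro nn_integral_mono le)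
  also have "\<dots> = (\<integral>\<^sup>+h. (\<Sum>i. outer i h) \<partial>lborel) + (\<integral>\<^sup>+h. (\<Sum>i. inside i h) \<partial>lborel)"
    by (rule nn_integral_add) measurable
  also have "\<dots> = ennreal (\<omega> * 2 ^ n / (1 - 2 powr -\<theta>)) + ennreal (\<omega> * 2 ^ n / (1 - 2 powr -(1 - \<theta>)))"
    by (simp only: int_o int_i)
  also have "\<dots> = ennreal (besov_kernel_const TYPE('a) \<theta>)"
    using assms \<omega> powr_less_one[of 2 "-\<theta>"] powr_less_one[of 2 "-(1 - \<theta>)"]
    by (subst ennreal_plus [symmetric])
      (auto simp: besov_kernel_const_def n_def \<omega>_def algebra_simps intro!: divide_nonneg_nonneg)
  finally show ?thesis .
qed

lemma nn_integral_lborel_diff: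
  fixes g :: "'a::euclidean_space \<Rightarrow> ennreal"
  assumes "g \<in> borel_measurable borel"
  shows "(\<integral>\<^sup>+y. g (y - x) \<partial>lborel) = (\<integral>\<^sup>+y. g y \<partial>lborel)"
proof -
  have "(\<integral>\<^sup>+y. g (y - x) \<partial>lborel) = (\<integral>\<^sup>+y. g (y - x) \<partial>distr lborel borel ((+) x))"
    by (simp add: lborel_distr_plus)
  also have "\<dots> = (\<integral>\<^sup>+y. g y \<partial>lborel)"
    using assms by (subst nn_integral_distr) auto
  finally show ?thesis .
qed

text \<open>By translation invariance and Tonelli each half is at most the kernel bound times the
  integral of \<open>B\<close>. The symmetric form \<open>B x + B y\<close> arises because a
  difference of cut-offs vanishes unless one of the two points lies in the support.\<close>

lemma nn_integral_besov_kernel_add_le: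
  fixes B :: "'a::euclidean_space \<Rightarrow> ennreal"
  assumes [measurable]: "B \<in> borel_measurable borel" and "0 < r" "0 < \<theta>" "\<theta> < 1"
  shows "(\<integral>\<^sup>+x. \<integral>\<^sup>+y. ennreal (besov_kernel \<theta> r (x - y)) * (B x + B y) \<partial>lborel \<partial>lborel)
    \<le> ennreal (2 * besov_kernel_const TYPE('a) \<theta>) * (\<integral>\<^sup>+x. B x \<partial>lborel)"
proof -
  have *: "(\<integral>\<^sup>+x. \<integral>\<^sup>+y. ennreal (besov_kernel \<theta> r (y - x)) * B x \<partial>lborel \<partial>lborel)
    \<le> ennreal (besov_kernel_const TYPE('a) \<theta>) * (\<integral>\<^sup>+x. B x \<partial>lborel)"
    using assms
    by (simp add: nn_integral_multc nn_integral_lborel_diff[where g = "\<lambda>h. ennreal (besov_kernel \<theta> r h)"]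
        nn_integral_cmult [symmetric] nn_integral_mono mult_right_mono nn_integral_besov_kernel_le
        del: besov_kernel_minus)
  have "(\<integral>\<^sup>+x. \<integral>\<^sup>+y. ennreal (besov_kernel \<theta> r (x - y)) * (B x + B y) \<partial>lborel \<partial>lborel)
    = (\<integral>\<^sup>+x. \<integral>\<^sup>+y. ennreal (besov_kernel \<theta> r (y - x)) * B x \<partial>lborel \<partial>lborel)
    + (\<integral>\<^sup>+x. \<integral>\<^sup>+y. ennreal (besov_kernel \<theta> r (x - y)) * B y \<partial>lborel \<partial>lborel)"
    by (simp add: distrib_left nn_integral_add del: besov_kernel_minus) (simp cong: nn_integral_cong)
  also have "(\<integral>\<^sup>+x. \<integral>\<^sup>+y. ennreal (besov_kernel \<theta> r (x - y)) * B y \<partial>lborel \<partial>lborel)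
     = (\<integral>\<^sup>+x. \<integral>\<^sup>+y. ennreal (besov_kernel \<theta> r (y - x)) * B x \<partial>lborel \<partial>lborel)"
    by (subst lborel_pair.Fubini') simp_all
  also have "(\<integral>\<^sup>+x. \<integral>\<^sup>+y. ennreal (besov_kernel \<theta> r (y - x)) * B x \<partial>lborel \<partial>lborel) + \<dots>
    \<le> ennreal (besov_kernel_const TYPE('a) \<theta>) * (\<integral>\<^sup>+x. B x \<partial>lborel)
     + ennreal (besov_kernel_const TYPE('a) \<theta>) * (\<integral>\<^sup>+x. B x \<partial>lborel)"
    by (intro add_mono *)
  also have "\<dots> = ennreal (2 * besov_kernel_const TYPE('a) \<theta>) * (\<integral>\<^sup>+x. B x \<partial>lborel)"
    using besov_kernel_const_nonneg[where 'a = 'a, OF assms(3,4)]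
    by (simp only: mult_2 ennreal_plus distrib_right)
  finally show ?thesis .
qed

section \<open>Lipschitz cut-offs and the capacity of balls\<close>

definition hat :: "'a::euclidean_space \<Rightarrow> real" where
  "hat x = max 0 (2 - norm x)"

lemma hat_nonneg [simp]: "0 \<le> hat x" and hat_le_2: "hat x \<le> 2"
  by (auto simp: hat_def)

lemma hat_measurable [measurable]: "hat \<in> borel_measurable borel"
  unfolding hat_def by measurable

lemma hat_scaled:
  assumes "0 < r"
  shows "hat ((x - y) /\<^sub>R r) = max 0 (2 - dist x y / r)"
proof -
  have "norm ((x - y) /\<^sub>R r) = dist x y / r"
    using assms by (simp only: norm_scaleR dist_norm) (simp add: divide_inverse_commute)
  then show ?thesis by (simp only: hat_def)
qed

lemma hat_ge_1: "0 < r \<Longrightarrow> x \<in> ball y r \<Longrightarrow> 1 \<le> hat ((x - y) /\<^sub>R r)"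
  by (simp add: hat_scaled dist_commute le_max_iff_disj)

lemma hat_eq_0: "0 < r \<Longrightarrow> x \<notin> ball y (2 * r) \<Longrightarrow> hat ((x - y) /\<^sub>R r) = 0"
  by (simp add: hat_scaled dist_commute pos_le_divide_eq)

text \<open>\<open>hat\<close> is 1-Lipschitz with values in [0, 2], whence the minimum; the
  difference vanishes when both points lie outside the support, whence the indicators.\<close>

lemma hat_diff_le:
  fixes x y z :: "'a::euclidean_space"
  assumes r: "0 < r"
  shows "\<bar>hat ((x - z) /\<^sub>R r) - hat ((y - z) /\<^sub>R r)\<bar>
    \<le> 2 * min 1 (norm (x - y) / r) * (indicator (ball z (2 * r)) x + indicator (ball z (2 * r)) y)"
proof (cases "x \<in> ball z (2 * r) \<or> y \<in> ball z (2 * r)")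
  case True
  have "\<bar>hat ((x - z) /\<^sub>R r) - hat ((y - z) /\<^sub>R r)\<bar> \<le> \<bar>norm ((x - z) /\<^sub>R r) - norm ((y - z) /\<^sub>R r)\<bar>"
    unfolding hat_def by linarith
  also have "\<dots> \<le> norm ((x - z) /\<^sub>R r - (y - z) /\<^sub>R r)"
    by (rule norm_triangle_ineq3)
  also have "\<dots> = norm (x - y) / r"
  proof -
    have "(x - z) /\<^sub>R r - (y - z) /\<^sub>R r = (x - y) /\<^sub>R r"
      by (simp only: scaleR_diff_right [symmetric]) simp
    then show ?thesis using r by (simp only: norm_scaleR) (simp add: divide_inverse_commute)
  qed
  finally have "\<bar>hat ((x - z) /\<^sub>R r) - hat ((y - z) /\<^sub>R r)\<bar> \<le> norm (x - y) / r" .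
  moreover have "\<bar>hat ((x - z) /\<^sub>R r) - hat ((y - z) /\<^sub>R r)\<bar> \<le> 2"
    using hat_le_2[of "(x - z) /\<^sub>R r"] hat_le_2[of "(y - z) /\<^sub>R r"]
      hat_nonneg[of "(x - z) /\<^sub>R r"] hat_nonneg[of "(y - z) /\<^sub>R r"] by linarith
  moreover have "0 \<le> norm (x - y) / r"
    using r by simp
  ultimately have "\<bar>hat ((x - z) /\<^sub>R r) - hat ((y - z) /\<^sub>R r)\<bar> \<le> 2 * min 1 (norm (x - y) / r) * 1"
    by (simp add: min_def)
  also have "\<dots> \<le> 2 * min 1 (norm (x - y) / r) * (indicator (ball z (2 * r)) x + indicator (ball z (2 * r)) y)"
    using True r by (intro mult_left_mono) (auto simp: indicator_def)
  finally show ?thesis .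
qed (use r in \<open>simp add: hat_eq_0\<close>)

text \<open>With s = |x - y| / r, the quotient \<open>min 1 s / s powr \<theta>\<close> is at most
  1, so its p-th power is at most the quotient itself. This brings every \<open>p\<close> to the
  same kernel.\<close>

lemma besov_integrand_le_kernel:
  fixes x y :: "'a::euclidean_space"
  assumes "1 \<le> p" "0 < \<theta>" "\<theta> < 1" "0 < r" "0 \<le> c"
    and t: "t \<le> c * min 1 (norm (x - y) / r) powr p"
  shows "t / (dist x y powr (p * \<theta>) * (unit_ball_vol DIM('a) * dist x y ^ DIM('a)))
    \<le> c / unit_ball_vol DIM('a) * r powr - (p * \<theta>) * besov_kernel \<theta> r (x - y)"
proof (cases "x = y")
  case False
  define d where "d = norm (x - y)"
  define s where "s = d / r"
  have d: "0 < d" and s: "0 < s" using False assms by (auto simp: d_def s_def)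
  have "min 1 s / s powr \<theta> \<le> 1"
  proof (cases "s \<le> 1")
    case True
    then have "s powr 1 \<le> s powr \<theta>" using s assms by (intro powr_mono') auto
    then show ?thesis using s True by (simp add: field_simps)
  next
    case False
    then show ?thesis using assms by (simp add: ge_one_powr_ge_zero)
  qed
  then have "(min 1 s / s powr \<theta>) powr p \<le> (min 1 s / s powr \<theta>) powr 1"
    using s assms by (intro powr_mono') auto
  then have le: "min 1 s powr p / s powr (p * \<theta>) \<le> min 1 s / s powr \<theta>"
    using s by (simp add: powr_divide powr_powr mult.commute)
  have dp: "d powr (p * \<theta>) = s powr (p * \<theta>) * r powr (p * \<theta>)"
    using s d assms by (simp add: s_def powr_divide)
  have "t / (d powr (p * \<theta>) * (unit_ball_vol DIM('a) * d ^ DIM('a)))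
     \<le> c * min 1 s powr p / (d powr (p * \<theta>) * (unit_ball_vol DIM('a) * d ^ DIM('a)))"
    using t d by (intro divide_right_mono) (auto simp: d_def s_def)
  also have "\<dots> = c / unit_ball_vol DIM('a) * r powr - (p * \<theta>) * (min 1 s powr p / s powr (p * \<theta>)) / d ^ DIM('a)"
    unfolding dp powr_minus using assms d s by (simp add: field_simps)
  also have "\<dots> \<le> c / unit_ball_vol DIM('a) * r powr - (p * \<theta>) * (min 1 s / s powr \<theta>) / d ^ DIM('a)"
    using assms d by (intro divide_right_mono mult_left_mono le) auto
  also have "\<dots> = c / unit_ball_vol DIM('a) * r powr - (p * \<theta>) * besov_kernel \<theta> r (x - y)"
    by (simp add: besov_kernel_def d_def s_def)
  finally show ?thesis by (simp add: d_def dist_norm)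
qed (simp add: besov_kernel_def)

lemma pred_ball_measurable [measurable]: "Measurable.pred borel (\<lambda>x::'a::euclidean_space. x \<in> ball z r)"
  unfolding mem_ball by measurable

text \<open>The test function is the cut-off at scale 2r: it is at least 1 on the open ball of
  radius 2r, a neighbourhood of the closed ball, and vanishes outside radius 4r. Its energy scales
  like r^(n - p\<theta>), which for r <= 1 also dominates the L^p part, of order r^n.\<close>

lemma besov_capacity_cball_le:
  assumes "1 \<le> p" "0 < \<theta>" "\<theta> < 1"
  obtains C where "0 < C" "\<And>(z::'a::euclidean_space) r. 0 < r \<Longrightarrow> r \<le> 1 \<Longrightarrow>
    besov_capacity \<theta> p (cball z r) \<le> ennreal (C * r powr (real DIM('a) - p * \<theta>))"
proof
  define n where "n = DIM('a)"
  define \<omega> where "\<omega> = unit_ball_vol n"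
  define K where "K = besov_kernel_const TYPE('a) \<theta>"
  \<comment> \<open>\<open>4 powr p\<close> is \<open>2 powr p\<close> from
    \<open>hat_diff_le\<close> times \<open>2 powr p\<close> from the sum of the two indicators;
    \<open>4 ^ n\<close> comes from the support radius 4r.\<close>
  define C where "C = 4 powr p / \<omega> * (2 * K) * (\<omega> * 4 ^ n) + 2 powr p * \<omega> * 4 ^ n"
  have \<omega>: "0 < \<omega>" by (simp add: \<omega>_def)
  have K: "0 \<le> K" unfolding K_def by (rule besov_kernel_const_nonneg) (use assms in auto)
  show "0 < C"
    using \<omega> K by (auto simp: C_def intro!: add_nonneg_pos)
  fix z :: 'a and r :: real
  assume r: "0 < r" "r \<le> 1"
  let ?v = "\<lambda>x. hat ((x - z) /\<^sub>R (2 * r))"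
  let ?B = "\<lambda>x. indicator (ball z (4 * r)) x"
  have vol: "(\<integral>\<^sup>+x. indicator (ball z (4 * r)) x \<partial>lborel) = ennreal (\<omega> * (4 * r) ^ n)"
    using r by (simp add: emeasure_ball n_def \<omega>_def)
  have "besov_energy \<theta> p ?v \<le> (\<integral>\<^sup>+x. \<integral>\<^sup>+y. ennreal (4 powr p / \<omega> * (2 * r) powr - (p * \<theta>)) *
      (ennreal (besov_kernel \<theta> (2 * r) (x - y)) * (?B x + ?B y)) \<partial>lborel \<partial>lborel)"
    unfolding besov_energy_lborel
  proof (intro nn_integral_mono)
    fix x y :: 'a
    let ?m = "min 1 (norm (x - y) / (2 * r))"
    let ?b = "?B x + ?B y :: real"
    \<comment> \<open>\<open>?b\<close> takes only the values 0, 1 and 2, so its p-th power has a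
      linear bound; the kernel estimate wants the indicators to the first power.\<close>
    have b: "0 \<le> ?b" "?b powr p \<le> 2 powr p * ?b" 
      using assms by (auto simp: indicator_def ge_one_powr_ge_zero)
    have "\<bar>?v x - ?v y\<bar> powr p \<le> (2 * ?m * ?b) powr p"
      using hat_diff_le[of "2 * r" x z y] r assms by (intro powr_mono2) auto
    also have "\<dots> = 2 powr p * ?m powr p * ?b powr p"
      using r b by (simp add: powr_mult)
    also have "\<dots> \<le> 2 powr p * ?m powr p * (2 powr p * ?b)"
      using b by (intro mult_left_mono) auto
    also have "\<dots> = (4 powr p * ?b) * ?m powr p"
      by (simp add: powr_mult [symmetric])
    finally have "\<bar>?v x - ?v y\<bar> powr p / (dist x y powr (p * \<theta>) * (unit_ball_vol DIM('a) * dist x y ^ DIM('a)))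
      \<le> 4 powr p * ?b / unit_ball_vol DIM('a) * (2 * r) powr - (p * \<theta>) * besov_kernel \<theta> (2 * r) (x - y)"
      using r b assms by (intro besov_integrand_le_kernel) auto
    also have "\<dots> = 4 powr p / \<omega> * (2 * r) powr - (p * \<theta>) * (besov_kernel \<theta> (2 * r) (x - y) * ?b)"
      by (simp add: \<omega>_def n_def)
    finally show "ennreal (\<bar>?v x - ?v y\<bar> powr p / (dist x y powr (p * \<theta>) * (unit_ball_vol DIM('a) * dist x y ^ DIM('a))))
      \<le> ennreal (4 powr p / \<omega> * (2 * r) powr - (p * \<theta>)) *
        (ennreal (besov_kernel \<theta> (2 * r) (x - y)) * (?B x + ?B y))"
      using \<omega> r by (simp add: ennreal_indicator [symmetric] ennreal_mult [symmetric] ennreal_plus [symmetric]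
          ennreal_leI del: ennreal_plus ennreal_indicator)
  qed
  also have "\<dots> = (\<integral>\<^sup>+x. ennreal (4 powr p / \<omega> * (2 * r) powr - (p * \<theta>)) *
      (\<integral>\<^sup>+y. ennreal (besov_kernel \<theta> (2 * r) (x - y)) * (?B x + ?B y) \<partial>lborel) \<partial>lborel)"
    by (intro nn_integral_cong nn_integral_cmult) measurable
  also have "\<dots> = ennreal (4 powr p / \<omega> * (2 * r) powr - (p * \<theta>)) *
      (\<integral>\<^sup>+x. \<integral>\<^sup>+y. ennreal (besov_kernel \<theta> (2 * r) (x - y)) * (?B x + ?B y) \<partial>lborel \<partial>lborel)"
    by (rule nn_integral_cmult) measurable
  also have "\<dots> \<le> ennreal (4 powr p / \<omega> * (2 * r) powr - (p * \<theta>)) *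
      (ennreal (2 * K) * (\<integral>\<^sup>+x. ?B x \<partial>lborel))"
    unfolding K_def using r assms
    by (intro mult_left_mono nn_integral_besov_kernel_add_le) auto
  also have "\<dots> = ennreal (4 powr p / \<omega> * (2 * r) powr - (p * \<theta>) * (2 * K * (\<omega> * (4 * r) ^ n)))"
    using K \<omega> r by (simp add: vol ennreal_mult [symmetric] del: nn_integral_indicator)
  also have "\<dots> \<le> ennreal (4 powr p / \<omega> * (2 * K) * (\<omega> * 4 ^ n) * r powr (n - p * \<theta>))"
  proof (rule ennreal_leI)
    have "(2 * r) powr - (p * \<theta>) * r ^ n \<le> r powr - (p * \<theta>) * r ^ n"
      using r assms by (intro mult_right_mono powr_mono2') auto
    also have "\<dots> = r powr (n - p * \<theta>)"
      using r by (simp add: powr_realpow [symmetric] powr_add [symmetric])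
    finally have "4 powr p / \<omega> * (2 * K) * (\<omega> * 4 ^ n) * ((2 * r) powr - (p * \<theta>) * r ^ n)
      \<le> 4 powr p / \<omega> * (2 * K) * (\<omega> * 4 ^ n) * r powr (n - p * \<theta>)"
      using K \<omega> by (intro mult_left_mono) auto
    then show "4 powr p / \<omega> * (2 * r) powr - (p * \<theta>) * (2 * K * (\<omega> * (4 * r) ^ n))
      \<le> 4 powr p / \<omega> * (2 * K) * (\<omega> * 4 ^ n) * r powr (n - p * \<theta>)"
      by (simp only: power_mult_distrib mult_ac)
  qed
  finally have energy: "besov_energy \<theta> p ?v \<le> ennreal (4 powr p / \<omega> * (2 * K) * (\<omega> * 4 ^ n) * r powr (n - p * \<theta>))" .
  have "Lp_energy p ?v \<le> (\<integral>\<^sup>+x. ennreal (2 powr p) * ?B x \<partial>lborel)"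
    unfolding Lp_energy_lborel
  proof (rule nn_integral_mono)
    fix x
    show "ennreal (\<bar>?v x\<bar> powr p) \<le> ennreal (2 powr p) * ?B x"
      using hat_eq_0[of "2 * r" x z] hat_le_2[of "(x - z) /\<^sub>R (2 * r)"] r assms
      by (cases "x \<in> ball z (4 * r)") (auto intro!: ennreal_leI powr_mono2)
  qed
  also have "\<dots> = ennreal (2 powr p * \<omega> * 4 ^ n * r ^ n)"
    using \<omega> r
    by (simp add: nn_integral_cmult_indicator emeasure_ball ennreal_mult [symmetric]
        \<omega>_def [symmetric] n_def [symmetric] power_mult_distrib mult_ac)
  also have "\<dots> \<le> ennreal (2 powr p * \<omega> * 4 ^ n * r powr (n - p * \<theta>))"
  proof (intro ennreal_leI mult_left_mono)
    have "r powr n \<le> r powr (n - p * \<theta>)"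
      using r assms by (intro powr_mono') auto
    then show "r ^ n \<le> r powr (n - p * \<theta>)"
      using r by (simp add: powr_realpow)
  qed (use \<omega> in auto)
  finally have "Lp_energy p ?v \<le> ennreal (2 powr p * \<omega> * 4 ^ n * r powr (n - p * \<theta>))" .
  with energy have "besov_energy \<theta> p ?v + Lp_energy p ?v \<le>
    ennreal (4 powr p / \<omega> * (2 * K) * (\<omega> * 4 ^ n) * r powr (n - p * \<theta>)) +
    ennreal (2 powr p * \<omega> * 4 ^ n * r powr (n - p * \<theta>))"
    by (rule add_mono)
  also have "\<dots> = ennreal (C * r powr (n - p * \<theta>))"
    using \<omega> K by (subst ennreal_plus [symmetric]) (auto simp: C_def algebra_simps)
  finally have "besov_energy \<theta> p ?v + Lp_energy p ?v \<le> ennreal (C * r powr (n - p * \<theta>))" .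
  moreover have "besov_capacity \<theta> p (cball z r) \<le> besov_energy \<theta> p ?v + Lp_energy p ?v"
    using r hat_ge_1[of "2 * r" _ z]
    by (intro besov_capacity_le[where U = "ball z (2 * r)"]) auto
  ultimately show "besov_capacity \<theta> p (cball z r) \<le> ennreal (C * r powr (real DIM('a) - p * \<theta>))"
    unfolding n_def by (rule order_trans [rotated])
qed

section \<open>Oscillation across scales\<close>

text \<open>The indicator of a ball as a function of both points, symmetric and jointly measurable,
  as interchanging integrals requires.\<close>

definition near :: "real \<Rightarrow> 'a::euclidean_space \<Rightarrow> 'a \<Rightarrow> ennreal" where
  "near r x y = (if dist x y < r then 1 else 0)"

lemma near_measurable [measurable (raw)]:
  fixes g h :: "'b \<Rightarrow> 'a::euclidean_space"
  assumes [measurable]: "g \<in> borel_measurable M" "h \<in> borel_measurable M"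
  shows "(\<lambda>w. near r (g w) (h w)) \<in> borel_measurable M"
  unfolding near_def by measurable

lemma near_commute: "near r x y = near r y x"
  by (simp add: near_def dist_commute)

lemma nn_integral_near:
  assumes "0 \<le> r"
  shows "(\<integral>\<^sup>+y. near r (x::'a::euclidean_space) y \<partial>lborel) = ennreal (unit_ball_vol DIM('a) * r ^ DIM('a))"
proof -
  have "near r x y = indicator (ball x r) y" for y
    by (simp add: near_def indicator_def)
  then show ?thesis using assms by (simp add: emeasure_ball)
qed

text \<open>Dominated convergence for the counting measure.\<close>

lemma tendsto_suminf_tail:
  fixes a :: "nat \<Rightarrow> ennreal"
  assumes "(\<Sum>j. a j) < \<infinity>"
  shows "(\<lambda>N. \<Sum>j. if N \<le> j then a j else 0) \<longlonglongrightarrow> 0"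
proof -
  have "(\<lambda>N. \<integral>\<^sup>+j. (if N \<le> j then a j else 0) \<partial>count_space UNIV) \<longlonglongrightarrow> (\<integral>\<^sup>+j. 0 \<partial>count_space (UNIV::nat set))"
  proof (rule nn_integral_dominated_convergence)
    show "(\<integral>\<^sup>+j. a j \<partial>count_space UNIV) < \<infinity>"
      using assms by (simp add: nn_integral_count_space_nat)
    show "AE j in count_space UNIV. (\<lambda>N. if N \<le> j then a j else 0) \<longlonglongrightarrow> 0"
    proof (rule AE_I2)
      fix j
      have "eventually (\<lambda>N. (if N \<le> j then a j else 0) = 0) sequentially"
        using eventually_gt_at_top[of j] by eventually_elim auto
      then show "(\<lambda>N. if N \<le> j then a j else 0) \<longlonglongrightarrow> 0"
        by (rule tendsto_eventually)
    qed
  qed auto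
  then show ?thesis by (simp add: nn_integral_count_space_nat)
qed

text \<open>Truncation at 1 is 1-Lipschitz. The hypotheses are additive because both arguments may
  be infinite, where a difference carries no information.\<close>

lemma ennreal_abs_diff_min_le:
  fixes a b r :: ennreal
  assumes "a \<le> b + r" "b \<le> a + r"
  shows "ennreal \<bar>enn2real (min 1 a) - enn2real (min 1 b)\<bar> \<le> r"
proof (cases r)
  case (real r')
  have fin: "min 1 a < top" "min 1 b < top"
    by (auto simp: min_less_iff_disj)
  have *: "enn2real (min 1 a) \<le> enn2real (min 1 b) + r'" if le: "a \<le> b + ennreal r'" "min 1 a < top" "min 1 b < top"
    for a b :: ennreal
  proof -
    have "min 1 a \<le> min 1 b + ennreal r'"
      using le(1) by (auto simp: min_def add_increasing2)
    also have "\<dots> = ennreal (enn2real (min 1 b) + r')"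
      using that real by (simp add: ennreal_plus)
    finally have "enn2real (min 1 a) \<le> enn2real (ennreal (enn2real (min 1 b) + r'))"
      by (rule enn2real_mono) simp
    then show ?thesis using real by (simp del: ennreal_plus)
  qed
  have "\<bar>enn2real (min 1 a) - enn2real (min 1 b)\<bar> \<le> r'"
    using *[of a b] *[of b a] assms fin real by (simp add: abs_le_iff)
  then show ?thesis using real by (simp add: ennreal_leI)
qed simp

lemma ennreal_mult3:
  "0 \<le> a \<Longrightarrow> 0 \<le> b \<Longrightarrow> 0 \<le> c \<Longrightarrow> ennreal a * (ennreal b * ennreal c) = ennreal (a * (b * c))"
  by (simp add: ennreal_mult)

locale besov_function =
  fixes p \<theta> :: real and f :: "'a::euclidean_space \<Rightarrow> real"
  assumes p_ge_1: "1 \<le> p" and \<theta>_pos: "0 < \<theta>" and \<theta>_less_1: "\<theta> < 1"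
    and p\<theta>_less: "p * \<theta> < real DIM('a)"
    and f_measurable [measurable]: "f \<in> borel_measurable borel"
    and besov_energy_finite: "besov_energy \<theta> p f < \<infinity>"
    and Lp_energy_finite: "Lp_energy p f < \<infinity>"
begin

text \<open>The radius \<open>2 * rad j\<close> admits all pairs of points of a ball of radius
  \<open>rad j\<close>. Exponent 1 serves the averages, exponent \<open>p\<close> the
  energy.\<close>

definition osc :: "real \<Rightarrow> nat \<Rightarrow> 'a \<Rightarrow> ennreal" where
  "osc a j y = (\<integral>\<^sup>+z. ennreal ((\<bar>f y - f z\<bar> / rad j powr \<theta>) powr a / rad j ^ DIM('a)) * near (2 * rad j) y z \<partial>lborel)"

definition osc_energy :: "nat \<Rightarrow> ennreal" where
  "osc_energy j = (\<integral>\<^sup>+y. osc p j y \<partial>lborel)"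

text \<open>Weighting \<open>osc 1 j\<close> by \<open>wt j\<close> and integrating over a ball of
  radius \<open>rad j\<close> gives, up to a constant, a mean of |f y - f z|: the numerator undoes
  the normalisation inside \<open>osc\<close>, the denominator averages over y.\<close>

definition wt :: "nat \<Rightarrow> real" where
  "wt j = rad j powr \<theta> / rad j ^ DIM('a)"

lemma wt_nonneg [simp]: "0 \<le> wt j"
  by (simp add: wt_def)

lemma osc_measurable [measurable]: "osc a j \<in> borel_measurable borel"
  unfolding osc_def by measurable

text \<open>The tangent inequality integrated over the ball of radius \<open>2 * rad j\<close>,
  whose volume divided by \<open>rad j ^ DIM('a)\<close> is the constant in the last term.\<close>

lemma osc_young:
  assumes "0 < s"
  shows "ennreal (p * s powr (p - 1)) * osc 1 j y \<le> osc p j y + ennreal ((p - 1) * s powr p * (2 ^ DIM('a) * unit_ball_vol DIM('a)))"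
proof -
  have "ennreal (p * s powr (p - 1)) * osc 1 j y =
    (\<integral>\<^sup>+z. ennreal (p * s powr (p - 1)) *
       (ennreal ((\<bar>f y - f z\<bar> / rad j powr \<theta>) powr 1 / rad j ^ DIM('a)) * near (2 * rad j) y z) \<partial>lborel)"
    unfolding osc_def by (rule nn_integral_cmult [symmetric]) measurable
  also have "\<dots> \<le> (\<integral>\<^sup>+z. ennreal ((\<bar>f y - f z\<bar> / rad j powr \<theta>) powr p / rad j ^ DIM('a)) * near (2 * rad j) y z +
      ennreal ((p - 1) * s powr p / rad j ^ DIM('a)) * near (2 * rad j) y z \<partial>lborel)"
  proof (intro nn_integral_mono)
    fix z
    let ?t = "\<bar>f y - f z\<bar> / rad j powr \<theta>"
    have "p * s powr (p - 1) * ?t / rad j ^ DIM('a) \<le> (?t powr p + (p - 1) * s powr p) / rad j ^ DIM('a)"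
      using young_tangent[OF p_ge_1 _ assms, of ?t] by (intro divide_right_mono) auto
    then have "ennreal (p * s powr (p - 1) * (?t / rad j ^ DIM('a)))
      \<le> ennreal (?t powr p / rad j ^ DIM('a) + (p - 1) * s powr p / rad j ^ DIM('a))"
      by (intro ennreal_leI) (simp add: add_divide_distrib)
    moreover have "ennreal (p * s powr (p - 1) * (?t / rad j ^ DIM('a))) =
        ennreal (p * s powr (p - 1)) * ennreal (?t / rad j ^ DIM('a))"
      using p_ge_1 by (intro ennreal_mult) auto
    moreover have "ennreal (?t powr p / rad j ^ DIM('a) + (p - 1) * s powr p / rad j ^ DIM('a)) =
        ennreal (?t powr p / rad j ^ DIM('a)) + ennreal ((p - 1) * s powr p / rad j ^ DIM('a))"
      using p_ge_1 by (intro ennreal_plus) auto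
    ultimately have "ennreal (p * s powr (p - 1)) * ennreal (?t / rad j ^ DIM('a)) \<le>
        ennreal (?t powr p / rad j ^ DIM('a)) + ennreal ((p - 1) * s powr p / rad j ^ DIM('a))"
      by (simp only:)
    then show "ennreal (p * s powr (p - 1)) * (ennreal (?t powr 1 / rad j ^ DIM('a)) * near (2 * rad j) y z)
      \<le> ennreal (?t powr p / rad j ^ DIM('a)) * near (2 * rad j) y z +
         ennreal ((p - 1) * s powr p / rad j ^ DIM('a)) * near (2 * rad j) y z"
      by (simp add: near_def)
  qed
  also have "\<dots> = osc p j y + (\<integral>\<^sup>+z. ennreal ((p - 1) * s powr p / rad j ^ DIM('a)) * near (2 * rad j) y z \<partial>lborel)"
    unfolding osc_def by (rule nn_integral_add) measurable
  also have "(\<integral>\<^sup>+z. ennreal ((p - 1) * s powr p / rad j ^ DIM('a)) * near (2 * rad j) y z \<partial>lborel)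
     = ennreal ((p - 1) * s powr p / rad j ^ DIM('a)) * ennreal (unit_ball_vol DIM('a) * (2 * rad j) ^ DIM('a))"
    by (subst nn_integral_cmult) (auto simp: nn_integral_near)
  also have "\<dots> = ennreal ((p - 1) * s powr p * (2 ^ DIM('a) * unit_ball_vol DIM('a)))"
  proof -
    have "(p - 1) * s powr p / rad j ^ DIM('a) * (unit_ball_vol DIM('a) * (2 * rad j) ^ DIM('a)) =
      (p - 1) * s powr p * (2 ^ DIM('a) * unit_ball_vol DIM('a))"
      by (simp add: power_mult_distrib)
    then show ?thesis
      using p_ge_1 by (subst ennreal_mult [symmetric]) auto
  qed
  finally show ?thesis .
qed

text \<open>A single application of Jensen's inequality over all scales \<open>j\<close> and points \<open>y\<close> passes from
  first order oscillations to \<open>p\<close>-th order ones.\<close>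

lemma jensen_scales:
  fixes K :: "nat \<Rightarrow> 'a \<Rightarrow> ennreal"
  assumes [measurable]: "\<And>j. K j \<in> borel_measurable borel" and "0 \<le> T" "0 < m"
    and T: "ennreal T \<le> (\<Sum>j. \<integral>\<^sup>+y. ennreal (wt j) * (osc 1 j y * K j y) \<partial>lborel)"
    and m: "(\<Sum>j. \<integral>\<^sup>+y. ennreal (wt j) * K j y \<partial>lborel) \<le> ennreal m"
  shows "ennreal (T powr p) \<le> ennreal ((2 ^ DIM('a) * unit_ball_vol DIM('a) * m) powr (p - 1)) *
    (\<Sum>j. \<integral>\<^sup>+y. ennreal (wt j) * (osc p j y * K j y) \<partial>lborel)"
proof (rule powr_le_of_tangents[OF p_ge_1 \<open>0 \<le> T\<close>])
  \<comment> \<open>A bound for the total mass in Jensen's inequality: at most \<open>m\<close> over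
    the pairs (j, y), times the normalised volume of the inner ball in \<open>osc\<close>.\<close>
  show "0 < 2 ^ DIM('a) * unit_ball_vol DIM('a) * m" using \<open>0 < m\<close> by simp
  fix s :: real assume s: "0 < s"
  let ?a = "ennreal (p * s powr (p - 1))" and ?b = "ennreal ((p - 1) * s powr p * (2 ^ DIM('a) * unit_ball_vol DIM('a)))"
  have "ennreal (p * s powr (p - 1) * T) = ?a * ennreal T"
    using p_ge_1 \<open>0 \<le> T\<close> by (simp add: ennreal_mult)
  also have "\<dots> \<le> ?a * (\<Sum>j. \<integral>\<^sup>+y. ennreal (wt j) * (osc 1 j y * K j y) \<partial>lborel)"
    by (intro mult_left_mono T) auto
  also have "\<dots> = (\<Sum>j. \<integral>\<^sup>+y. ?a * (ennreal (wt j) * (osc 1 j y * K j y)) \<partial>lborel)"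
    unfolding ennreal_suminf_cmult [symmetric]
    by (intro suminf_cong nn_integral_cmult [symmetric]) measurable
  also have "\<dots> \<le> (\<Sum>j. \<integral>\<^sup>+y. ennreal (wt j) * (osc p j y * K j y) + ?b * (ennreal (wt j) * K j y) \<partial>lborel)"
  proof (intro suminf_le nn_integral_mono)
    fix j y
    have "?a * (ennreal (wt j) * (osc 1 j y * K j y)) = (?a * osc 1 j y) * (ennreal (wt j) * K j y)"
      by (simp add: mult_ac)
    also have "\<dots> \<le> (osc p j y + ?b) * (ennreal (wt j) * K j y)"
      by (intro mult_right_mono osc_young s) auto
    also have "\<dots> = ennreal (wt j) * (osc p j y * K j y) + ?b * (ennreal (wt j) * K j y)"
      by (subst distrib_right) (simp only: mult_ac)
    finally show "?a * (ennreal (wt j) * (osc 1 j y * K j y)) \<le>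
      ennreal (wt j) * (osc p j y * K j y) + ?b * (ennreal (wt j) * K j y)" .
  qed auto
  also have "\<dots> = (\<Sum>j. (\<integral>\<^sup>+y. ennreal (wt j) * (osc p j y * K j y) \<partial>lborel) +
      ?b * (\<integral>\<^sup>+y. ennreal (wt j) * K j y \<partial>lborel))"
    by (intro suminf_cong) (simp add: nn_integral_add nn_integral_cmult)
  also have "\<dots> = (\<Sum>j. \<integral>\<^sup>+y. ennreal (wt j) * (osc p j y * K j y) \<partial>lborel) +
      ?b * (\<Sum>j. \<integral>\<^sup>+y. ennreal (wt j) * K j y \<partial>lborel)"
    by (subst suminf_add [symmetric]) auto
  also have "\<dots> \<le> (\<Sum>j. \<integral>\<^sup>+y. ennreal (wt j) * (osc p j y * K j y) \<partial>lborel) + ?b * ennreal m"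
    by (intro add_left_mono mult_left_mono m) auto
  also have "?b * ennreal m = ennreal ((p - 1) * s powr p * (2 ^ DIM('a) * unit_ball_vol DIM('a) * m))"
    using p_ge_1 \<open>0 < m\<close> by (subst ennreal_mult [symmetric]) (auto simp: mult_ac)
  finally show "ennreal (p * s powr (p - 1) * T) \<le> (\<Sum>j. \<integral>\<^sup>+y. ennreal (wt j) * (osc p j y * K j y) \<partial>lborel) +
    ennreal ((p - 1) * s powr p * (2 ^ DIM('a) * unit_ball_vol DIM('a) * m))" .
qed

text \<open>For fixed x and y only the scales with \<open>2 * rad j > dist x y\<close> contribute,
  and among them the smallest dominates the sum of \<open>rad j powr - c\<close>, c = p\<theta> + n.
  The result is a multiple of the Besov weight.\<close>

lemma suminf_osc_energy_finite: "(\<Sum>j. osc_energy j) < \<infinity>"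
proof -
  define c where "c = p * \<theta> + DIM('a)"
  define G where "G = (1 / (1 - 2 powr -(1::real)) + 1 / (1 - 2 powr -c)) * 2 powr c"
  have c: "0 < c" using p_ge_1 \<theta>_pos by (auto simp: c_def intro!: add_pos_pos)
  have G: "0 \<le> G"
    using c powr_less_one[of 2 "-c"] by (auto simp: G_def intro!: mult_nonneg_nonneg add_nonneg_nonneg)
  have sum_near: "(\<Sum>j. ennreal (rad j powr - c) * near (2 * rad j) x y) \<le> ennreal (G * dist x y powr - c)"
    if "x \<noteq> y" for x y :: 'a
  proof -
    define \<rho> where "\<rho> = dist x y"
    have \<rho>: "0 < \<rho>" using that by (simp add: \<rho>_def)
    \<comment> \<open>The cut-off is replaced by the factor (2 rad j / \<rho>)^(1 + c), which is at
      least 1 where \<open>near\<close> is 1. The summand 1 in the exponent is an arbitrary positive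
      choice that makes \<open>suminf_min_geometric\<close> applicable.\<close>
    have "(\<Sum>j. ennreal (rad j powr - c) * near (2 * rad j) x y)
        \<le> (\<Sum>j. ennreal (min ((2 / \<rho>) powr (1 + c) * rad j powr 1) (1 * rad j powr - c)))"
    proof (intro suminf_le)
      fix j
      show "ennreal (rad j powr - c) * near (2 * rad j) x y \<le> ennreal (min ((2 / \<rho>) powr (1 + c) * rad j powr 1) (1 * rad j powr - c))"
      proof (cases "\<rho> < 2 * rad j")
        case True
        have "1 = (2 / \<rho>) powr (1 + c) * (\<rho> / 2) powr (1 + c)"
          using \<rho> by (simp add: powr_mult [symmetric])
        also have "\<dots> \<le> (2 / \<rho>) powr (1 + c) * rad j powr (1 + c)"
          using True \<rho> c by (intro mult_left_mono powr_mono2) auto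
        finally have "1 * rad j powr - c \<le> ((2 / \<rho>) powr (1 + c) * rad j powr (1 + c)) * rad j powr - c"
          by (intro mult_right_mono) auto
        also have "\<dots> = (2 / \<rho>) powr (1 + c) * rad j powr 1"
          unfolding mult.assoc powr_add [symmetric] by simp
        finally show ?thesis using True by (simp add: near_def \<rho>_def min_absorb2)
      qed (simp add: near_def \<rho>_def)
    qed auto
    also have "\<dots> \<le> ennreal ((1 / (1 - 2 powr -(1::real)) + 1 / (1 - 2 powr -c)) *
       (((2 / \<rho>) powr (1 + c)) powr (c / (1 + c)) * 1 powr (1 / (1 + c))))"
      using c by (intro suminf_min_geometric) auto
    also have "((2 / \<rho>) powr (1 + c)) powr (c / (1 + c)) = (2 / \<rho>) powr c"
      using c by (simp add: powr_powr)
    also have "\<dots> = 2 powr c * \<rho> powr - c"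
      using \<rho> by (simp add: powr_divide powr_minus_divide)
    finally show ?thesis by (simp add: G_def \<rho>_def mult_ac)
  qed
  have "(\<Sum>j. osc_energy j) = (\<integral>\<^sup>+x. \<integral>\<^sup>+y. (\<Sum>j. ennreal ((\<bar>f x - f y\<bar> / rad j powr \<theta>) powr p / rad j ^ DIM('a)) * near (2 * rad j) x y)
      \<partial>lborel \<partial>lborel)"
    unfolding osc_energy_def osc_def by (simp add: nn_integral_suminf)
  also have "\<dots> \<le> (\<integral>\<^sup>+x. \<integral>\<^sup>+y. ennreal (unit_ball_vol DIM('a) * G) * ennreal (\<bar>f x - f y\<bar> powr p /
       (dist x y powr (p * \<theta>) * (unit_ball_vol DIM('a) * dist x y ^ DIM('a)))) \<partial>lborel \<partial>lborel)"
  proof (intro nn_integral_mono)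
    fix x y
    let ?D = "\<bar>f x - f y\<bar> powr p"
    have "(\<Sum>j. ennreal ((\<bar>f x - f y\<bar> / rad j powr \<theta>) powr p / rad j ^ DIM('a)) * near (2 * rad j) x y)
      = (\<Sum>j. ennreal ?D * (ennreal (rad j powr - c) * near (2 * rad j) x y))"
    proof (intro suminf_cong)
      fix j
      have "(\<bar>f x - f y\<bar> / rad j powr \<theta>) powr p / rad j ^ DIM('a) = ?D * rad j powr - c"
      proof -
        have "rad j powr - c = 1 / (rad j powr (\<theta> * p) * rad j ^ DIM('a))"
          unfolding powr_minus_divide by (simp add: c_def powr_add powr_realpow mult.commute)
        then show ?thesis by (simp add: powr_divide powr_powr)
      qed
      then show "ennreal ((\<bar>f x - f y\<bar> / rad j powr \<theta>) powr p / rad j ^ DIM('a)) * near (2 * rad j) x y =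
        ennreal ?D * (ennreal (rad j powr - c) * near (2 * rad j) x y)"
        by (simp add: ennreal_mult mult.assoc)
    qed
    also have "\<dots> = ennreal ?D * (\<Sum>j. ennreal (rad j powr - c) * near (2 * rad j) x y)"
      by (rule ennreal_suminf_cmult)
    also have "\<dots> \<le> ennreal ?D * ennreal (G * dist x y powr - c)"
      using sum_near[of x y] by (cases "x = y") (auto intro!: mult_left_mono)
    also have "\<dots> = ennreal (unit_ball_vol DIM('a) * G) * ennreal (?D / (dist x y powr (p * \<theta>) * (unit_ball_vol DIM('a) * dist x y ^ DIM('a))))"
    proof (cases "x = y")
      case False
      have "?D * (G * dist x y powr - c) = unit_ball_vol DIM('a) * G * (?D / (dist x y powr (p * \<theta>) * (unit_ball_vol DIM('a) * dist x y ^ DIM('a))))"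
      proof -
        have "dist x y powr - c = 1 / (dist x y powr (p * \<theta>) * dist x y ^ DIM('a))"
          unfolding powr_minus_divide using False by (simp add: c_def powr_add powr_realpow)
        moreover have "unit_ball_vol (real DIM('a)) \<noteq> 0"
          using unit_ball_vol_pos[of "real DIM('a)"] by linarith
        ultimately show ?thesis using False by simp
      qed
      then show ?thesis
        using G by (simp add: ennreal_mult [symmetric])
    qed simp
    finally show "(\<Sum>j. ennreal ((\<bar>f x - f y\<bar> / rad j powr \<theta>) powr p / rad j ^ DIM('a)) * near (2 * rad j) x y)
      \<le> ennreal (unit_ball_vol DIM('a) * G) * ennreal (?D / (dist x y powr (p * \<theta>) * (unit_ball_vol DIM('a) * dist x y ^ DIM('a))))" .
  qed
  also have "\<dots> = ennreal (unit_ball_vol DIM('a) * G) * besov_energy \<theta> p f"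
    unfolding besov_energy_lborel by (simp add: nn_integral_cmult)
  also have "\<dots> < \<infinity>"
    using besov_energy_finite by (simp add: ennreal_mult_less_top)
  finally show ?thesis .
qed

section \<open>Potentials of the oscillation\<close>

text \<open>The restriction to \<open>N <= j\<close> sits inside the kernel, so that kernels of the
  same shape fit \<open>jensen_scales\<close>. Discarding coarse scales is what makes the norm of
  the truncated potential small.\<close>

definition pot :: "nat \<Rightarrow> 'a \<Rightarrow> ennreal" where
  "pot N x = (\<Sum>j. \<integral>\<^sup>+y. ennreal (wt j) *
     (osc 1 j y * (if N \<le> j then ennreal (hat ((x - y) /\<^sub>R rad j)) else 0)) \<partial>lborel)"

definition osc_near :: "real \<Rightarrow> nat \<Rightarrow> 'a \<Rightarrow> ennreal" where
  "osc_near r j x = (\<integral>\<^sup>+y. osc p j y * near r x y \<partial>lborel)"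

definition tail :: "nat \<Rightarrow> ennreal" where
  "tail N = (\<Sum>j. if N \<le> j then osc_energy j else 0)"

lemma tail_tendsto_0: "tail \<longlonglongrightarrow> 0"
  unfolding tail_def using suminf_osc_energy_finite by (rule tendsto_suminf_tail)

lemma osc_near_measurable [measurable]: "osc_near r j \<in> borel_measurable borel"
  unfolding osc_near_def by measurable

lemma pot_measurable [measurable]: "pot N \<in> borel_measurable borel"
  unfolding pot_def by measurable

lemma nn_integral_osc_near:
  assumes "0 \<le> r"
  shows "(\<integral>\<^sup>+x. osc_near r j x \<partial>lborel) = ennreal (unit_ball_vol DIM('a) * r ^ DIM('a)) * osc_energy j"
proof -
  have "(\<integral>\<^sup>+x. osc_near r j x \<partial>lborel) = (\<integral>\<^sup>+y. \<integral>\<^sup>+x. osc p j y * near r x y \<partial>lborel \<partial>lborel)"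
    unfolding osc_near_def by (rule lborel_pair.Fubini') measurable
  also have "\<dots> = (\<integral>\<^sup>+y. osc p j y * ennreal (unit_ball_vol DIM('a) * r ^ DIM('a)) \<partial>lborel)"
    using assms by (intro nn_integral_cong, subst near_commute) (simp add: nn_integral_cmult nn_integral_near)
  also have "\<dots> = osc_energy j * ennreal (unit_ball_vol DIM('a) * r ^ DIM('a))"
    unfolding osc_energy_def by (rule nn_integral_multc) measurable
  finally show ?thesis by (simp add: mult.commute)
qed

text \<open>Fatou's lemma for the integral over y, and again for the sum over j as an integral for
  counting measure, makes \<open>pot N\<close> lower semicontinuous. The open set is the
  neighbourhood required by the capacity.\<close>

lemma open_pot_greater: "open {x. 1 < pot N x}"
proof -
  define g where "g = (\<lambda>x j. \<integral>\<^sup>+y. ennreal (wt j) *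
     (osc 1 j y * (if N \<le> j then ennreal (hat ((x - y) /\<^sub>R rad j)) else 0)) \<partial>lborel)"
  have pot_eq: "pot N x = (\<integral>\<^sup>+j. g x j \<partial>count_space UNIV)" for x
    by (simp add: pot_def g_def nn_integral_count_space_nat)
  have g_le: "g x j \<le> liminf (\<lambda>k. g (X k) j)" if X: "X \<longlonglongrightarrow> x" for X x j
  proof -
    have "g x j \<le> (\<integral>\<^sup>+y. liminf (\<lambda>k. ennreal (wt j) *
        (osc 1 j y * (if N \<le> j then ennreal (hat ((X k - y) /\<^sub>R rad j)) else 0))) \<partial>lborel)"
      unfolding g_def
    proof (rule nn_integral_mono)
      fix y
      let ?h = "\<lambda>x. ennreal (wt j) * (osc 1 j y * (if N \<le> j then ennreal (hat ((x - y) /\<^sub>R rad j)) else 0))"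
      show "?h x \<le> liminf (\<lambda>k. ?h (X k))"
      \<comment> \<open>Where \<open>hat\<close> vanishes the value is 0 and the claim is trivial.
        Elsewhere multiplication is continuous even if \<open>osc 1 j y\<close> is infinite; the
        split avoids the product of 0 and infinity.\<close>
      proof (cases "hat ((x - y) /\<^sub>R rad j) = 0 \<or> \<not> N \<le> j")
        case False
        have "(\<lambda>k. ennreal (hat ((X k - y) /\<^sub>R rad j))) \<longlonglongrightarrow> ennreal (hat ((x - y) /\<^sub>R rad j))"
          unfolding hat_def by (intro tendsto_ennrealI tendsto_intros X)
        moreover have "ennreal (hat ((x - y) /\<^sub>R rad j)) \<noteq> 0"
          using False hat_nonneg[of "(x - y) /\<^sub>R rad j"] by (simp add: ennreal_eq_0_iff del: hat_nonneg)
        moreover have "ennreal (wt j) \<noteq> 0"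
          by (simp add: wt_def ennreal_eq_0_iff not_le divide_pos_pos)
        ultimately have "(\<lambda>k. ennreal (wt j) * (osc 1 j y * ennreal (hat ((X k - y) /\<^sub>R rad j))))
            \<longlonglongrightarrow> ennreal (wt j) * (osc 1 j y * ennreal (hat ((x - y) /\<^sub>R rad j)))"
          by (intro tendsto_mult_ennreal tendsto_const) auto
        then have "liminf (\<lambda>k. ?h (X k)) = ?h x"
          using False by (intro lim_imp_Liminf) auto
        then show ?thesis by simp
      qed auto
    qed
    also have "\<dots> \<le> liminf (\<lambda>k. g (X k) j)"
      unfolding g_def by (rule nn_integral_liminf) measurable
    finally show ?thesis .
  qed
  have "closed {x. pot N x \<le> 1}"
    unfolding closed_sequential_limits
  proof (intro allI impI, elim conjE)
    fix X x assume mem: "\<forall>k. X k \<in> {x. pot N x \<le> 1}" and X: "X \<longlonglongrightarrow> x"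
    have "pot N x \<le> (\<integral>\<^sup>+j. liminf (\<lambda>k. g (X k) j) \<partial>count_space UNIV)"
      unfolding pot_eq by (intro nn_integral_mono g_le X)
    also have "\<dots> \<le> liminf (\<lambda>k. pot N (X k))"
      unfolding pot_eq by (rule nn_integral_liminf) auto
    also have "\<dots> \<le> 1"
      using mem by (intro Liminf_le) (auto intro!: always_eventually)
    finally show "x \<in> {x. pot N x \<le> 1}" by simp
  qed
  then have "open (- {x. pot N x \<le> 1})" by (rule open_Compl)
  moreover have "- {x. pot N x \<le> 1} = {x. 1 < pot N x}" by auto
  ultimately show ?thesis by simp
qed

section \<open>The Besov norm of the truncated potential\<close>

definition trunc_pot :: "nat \<Rightarrow> 'a \<Rightarrow> real" where
  "trunc_pot N x = enn2real (min 1 (pot N x))"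

lemma trunc_pot_measurable [measurable]: "trunc_pot N \<in> borel_measurable borel"
  unfolding trunc_pot_def by measurable

text \<open>\<open>hat_diff_le\<close> inserted into the potential. The bound has the form that
  \<open>jensen_scales\<close> expects, with the Lipschitz factor of each scale as part of the
  kernel.\<close>

lemma pot_diff_le:
  fixes N :: nat and x x' :: 'a
  defines "K \<equiv> \<lambda>j y. if N \<le> j then ennreal (2 * min 1 (norm (x - x') / rad j)) * (near (2 * rad j) x y + near (2 * rad j) x' y) else 0"
  shows "ennreal \<bar>trunc_pot N x - trunc_pot N x'\<bar> \<le> (\<Sum>j. \<integral>\<^sup>+y. ennreal (wt j) * (osc 1 j y * K j y) \<partial>lborel)"
proof -
  define R where "R = (\<Sum>j. \<integral>\<^sup>+y. ennreal (wt j) * (osc 1 j y * K j y) \<partial>lborel)"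
  have [measurable]: "K j \<in> borel_measurable borel" for j
    unfolding K_def by measurable
  have hat_le: "ennreal (hat ((a - y) /\<^sub>R rad j)) \<le> ennreal (hat ((b - y) /\<^sub>R rad j)) + K j y"
    if ab: "a = x \<and> b = x' \<or> a = x' \<and> b = x" and "N \<le> j" for a b y j
  proof -
    have near_eq: "ennreal (indicator (ball y (2 * rad j)) u) = near (2 * rad j) u y" for u
      by (simp add: near_def indicator_def dist_commute)
    have "hat ((a - y) /\<^sub>R rad j) \<le> hat ((b - y) /\<^sub>R rad j) +
       2 * min 1 (norm (x - x') / rad j) * (indicator (ball y (2 * rad j)) x + indicator (ball y (2 * rad j)) x')"
      using hat_diff_le[of "rad j" x y x'] ab by auto
    then have "ennreal (hat ((a - y) /\<^sub>R rad j)) \<le> ennreal (hat ((b - y) /\<^sub>R rad j) +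
       2 * min 1 (norm (x - x') / rad j) * (indicator (ball y (2 * rad j)) x + indicator (ball y (2 * rad j)) x'))"
      by (rule ennreal_leI)
    also have "\<dots> = ennreal (hat ((b - y) /\<^sub>R rad j)) + ennreal (2 * min 1 (norm (x - x') / rad j) *
       (indicator (ball y (2 * rad j)) x + indicator (ball y (2 * rad j)) x'))"
      by (intro ennreal_plus) auto
    also have "ennreal (2 * min 1 (norm (x - x') / rad j) *
       (indicator (ball y (2 * rad j)) x + indicator (ball y (2 * rad j)) x')) =
       ennreal (2 * min 1 (norm (x - x') / rad j)) *
       ennreal (indicator (ball y (2 * rad j)) x + indicator (ball y (2 * rad j)) x')"
      by (intro ennreal_mult) auto
    also have "ennreal (indicator (ball y (2 * rad j)) x + indicator (ball y (2 * rad j)) x') =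
       near (2 * rad j) x y + near (2 * rad j) x' y"
      unfolding near_eq [symmetric] by (intro ennreal_plus) auto
    finally show ?thesis
      using that by (simp add: K_def)
  qed
  have pot_le: "pot N a \<le> pot N b + R" if ab: "a = x \<and> b = x' \<or> a = x' \<and> b = x" for a b
  proof -
    have "pot N a \<le> (\<Sum>j. \<integral>\<^sup>+y. ennreal (wt j) * (osc 1 j y * (if N \<le> j then ennreal (hat ((b - y) /\<^sub>R rad j)) else 0))
        + ennreal (wt j) * (osc 1 j y * K j y) \<partial>lborel)"
      unfolding pot_def
    proof (intro suminf_le nn_integral_mono)
      fix j y
      show "ennreal (wt j) * (osc 1 j y * (if N \<le> j then ennreal (hat ((a - y) /\<^sub>R rad j)) else 0)) \<le>
        ennreal (wt j) * (osc 1 j y * (if N \<le> j then ennreal (hat ((b - y) /\<^sub>R rad j)) else 0))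
        + ennreal (wt j) * (osc 1 j y * K j y)"
        using hat_le[OF ab, of j y]
        by (cases "N \<le> j") (auto simp: distrib_left [symmetric] intro!: mult_left_mono)
    qed auto
    also have "\<dots> = (\<Sum>j. (\<integral>\<^sup>+y. ennreal (wt j) * (osc 1 j y * (if N \<le> j then ennreal (hat ((b - y) /\<^sub>R rad j)) else 0)) \<partial>lborel)
        + (\<integral>\<^sup>+y. ennreal (wt j) * (osc 1 j y * K j y) \<partial>lborel))"
      by (intro suminf_cong nn_integral_add) measurable
    also have "\<dots> = pot N b + R"
      unfolding pot_def R_def by (rule suminf_add [symmetric]) auto
    finally show ?thesis .
  qed
  show ?thesis
    unfolding trunc_pot_def R_def [symmetric] by (intro ennreal_abs_diff_min_le pot_le) auto
qed

text \<open>Let \<rho> be the distance of the two points. The kernel has mass of order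
  \<rho>^\<theta>, so Jensen yields a factor \<rho>^(\<theta>(p - 1)). Against the
  \<rho>^(p\<theta>) of the Besov weight this leaves \<rho>^\<theta> in the denominator, which
  together with the Lipschitz factor \<open>min 1 (\<rho> / rad j)\<close> forms
  \<open>besov_kernel\<close> at scale \<open>rad j\<close>.\<close>

lemma trunc_pot_diff_powr_le:
  obtains C where "0 \<le> C" "\<And>N x x'. ennreal (\<bar>trunc_pot N x - trunc_pot N x'\<bar> powr p /
       (dist x x' powr (p * \<theta>) * (unit_ball_vol DIM('a) * dist x x' ^ DIM('a))))
    \<le> (\<Sum>j. if N \<le> j then ennreal (C / rad j ^ DIM('a)) * (ennreal (besov_kernel \<theta> (rad j) (x - x')) *
        (osc_near (2 * rad j) j x + osc_near (2 * rad j) j x')) else 0)"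
proof
  define \<omega> where "\<omega> = unit_ball_vol (real DIM('a))"
  have \<omega>: "0 < \<omega>" by (simp add: \<omega>_def)
  define G where "G = 1 / (1 - 2 powr -\<theta>) + 1 / (1 - 2 powr -(1 - \<theta>))"
  have G: "0 < G"
    using \<theta>_pos \<theta>_less_1 powr_less_one[of 2 "-\<theta>"] powr_less_one[of 2 "-(1 - \<theta>)"]
    by (auto simp: G_def intro!: add_pos_pos)
  \<comment> \<open>The 4 is 2 from \<open>hat_diff_le\<close> times 2 for the two balls of radius
    \<open>2 * rad j\<close>; \<open>G\<close> is the constant of
    \<open>suminf_min_geometric\<close> for the exponents \<theta> and 1 - \<theta>.\<close>
  define M where "M = 4 * \<omega> * 2 ^ DIM('a) * G"
  have M: "0 < M" using \<omega> G by (simp add: M_def)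
  define C where "C = (2 ^ DIM('a) * \<omega> * M) powr (p - 1) * 2 / \<omega>"
  show "0 \<le> C" using \<omega> by (simp add: C_def)
  fix N and x x' :: 'a
  show "ennreal (\<bar>trunc_pot N x - trunc_pot N x'\<bar> powr p /
       (dist x x' powr (p * \<theta>) * (unit_ball_vol DIM('a) * dist x x' ^ DIM('a))))
    \<le> (\<Sum>j. if N \<le> j then ennreal (C / rad j ^ DIM('a)) * (ennreal (besov_kernel \<theta> (rad j) (x - x')) *
        (osc_near (2 * rad j) j x + osc_near (2 * rad j) j x')) else 0)"
  proof (cases "x = x'")
    case False
    define \<rho> where "\<rho> = norm (x - x')"
    have \<rho>: "0 < \<rho>" using False by (simp add: \<rho>_def)
    define K where "K = (\<lambda>j y. if N \<le> j then ennreal (2 * min 1 (\<rho> / rad j)) * (near (2 * rad j) x y + near (2 * rad j) x' y) else 0)"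
    have [measurable]: "K j \<in> borel_measurable borel" for j
      unfolding K_def by measurable
    have "(\<Sum>j. \<integral>\<^sup>+y. ennreal (wt j) * K j y \<partial>lborel) \<le>
      (\<Sum>j. ennreal (4 * \<omega> * 2 ^ DIM('a)) * ennreal (min (1 * rad j powr \<theta>) (\<rho> * rad j powr - (1 - \<theta>))))"
    proof (intro suminf_le)
      fix j
      let ?m = "min 1 (\<rho> / rad j)"
      have "(\<integral>\<^sup>+y. ennreal (wt j) * K j y \<partial>lborel) \<le>
        (\<integral>\<^sup>+y. ennreal (wt j) * (ennreal (2 * ?m) * (near (2 * rad j) x y + near (2 * rad j) x' y)) \<partial>lborel)"
        by (intro nn_integral_mono mult_left_mono) (auto simp: K_def)
      also have "\<dots> = ennreal (wt j) * (ennreal (2 * ?m) * (ennreal (\<omega> * (2 * rad j) ^ DIM('a)) + ennreal (\<omega> * (2 * rad j) ^ DIM('a))))"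
        by (simp add: nn_integral_cmult nn_integral_add nn_integral_near \<omega>_def)
      also have "\<dots> = ennreal (wt j * (2 * ?m * (\<omega> * (2 * rad j) ^ DIM('a) + \<omega> * (2 * rad j) ^ DIM('a))))"
        using \<omega> \<rho> by (subst ennreal_plus [symmetric], simp, simp, subst ennreal_mult [symmetric], simp, simp,
            subst ennreal_mult [symmetric]) auto
      also have "wt j * (2 * ?m * (\<omega> * (2 * rad j) ^ DIM('a) + \<omega> * (2 * rad j) ^ DIM('a))) = 4 * \<omega> * 2 ^ DIM('a) * (rad j powr \<theta> * ?m)"
        by (simp add: wt_def power_mult_distrib)
      also have "rad j powr \<theta> * ?m = min (1 * rad j powr \<theta>) (\<rho> * rad j powr - (1 - \<theta>))"
      proof -
        have "rad j powr - (1 - \<theta>) = rad j powr \<theta> / rad j"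
          by (simp add: powr_diff)
        then show ?thesis by (simp add: min_mult_distrib_left mult.commute)
      qed
      also have "ennreal (4 * \<omega> * 2 ^ DIM('a) * min (1 * rad j powr \<theta>) (\<rho> * rad j powr - (1 - \<theta>))) =
        ennreal (4 * \<omega> * 2 ^ DIM('a)) * ennreal (min (1 * rad j powr \<theta>) (\<rho> * rad j powr - (1 - \<theta>)))"
        using \<omega> \<rho> by (intro ennreal_mult) auto
      finally show "(\<integral>\<^sup>+y. ennreal (wt j) * K j y \<partial>lborel) \<le>
        ennreal (4 * \<omega> * 2 ^ DIM('a)) * ennreal (min (1 * rad j powr \<theta>) (\<rho> * rad j powr - (1 - \<theta>)))" .
    qed auto
    also have "\<dots> = ennreal (4 * \<omega> * 2 ^ DIM('a)) * (\<Sum>j. ennreal (min (1 * rad j powr \<theta>) (\<rho> * rad j powr - (1 - \<theta>))))"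
      by (rule ennreal_suminf_cmult)
    also have "\<dots> \<le> ennreal (4 * \<omega> * 2 ^ DIM('a)) * ennreal (G * \<rho> powr \<theta>)"
    proof (rule mult_left_mono)
      have "(\<Sum>j. ennreal (min (1 * rad j powr \<theta>) (\<rho> * rad j powr - (1 - \<theta>))))
        \<le> ennreal (G * (1 powr ((1 - \<theta>) / (\<theta> + (1 - \<theta>))) * \<rho> powr (\<theta> / (\<theta> + (1 - \<theta>)))))"
        unfolding G_def using \<theta>_pos \<theta>_less_1 \<rho> by (intro suminf_min_geometric) auto
      also have "G * (1 powr ((1 - \<theta>) / (\<theta> + (1 - \<theta>))) * \<rho> powr (\<theta> / (\<theta> + (1 - \<theta>)))) = G * \<rho> powr \<theta>"
        by simp
      finally show "(\<Sum>j. ennreal (min (1 * rad j powr \<theta>) (\<rho> * rad j powr - (1 - \<theta>)))) \<le> ennreal (G * \<rho> powr \<theta>)" .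
    qed simp
    also have "\<dots> = ennreal (M * \<rho> powr \<theta>)"
      using G \<omega> by (subst ennreal_mult [symmetric]) (auto simp: M_def mult_ac)
    finally have mass: "(\<Sum>j. \<integral>\<^sup>+y. ennreal (wt j) * K j y \<partial>lborel) \<le> ennreal (M * \<rho> powr \<theta>)" .
    define T where "T = \<bar>trunc_pot N x - trunc_pot N x'\<bar>"
    define D where "D = \<rho> powr (p * \<theta>) * (\<omega> * \<rho> ^ DIM('a))"
    have D: "0 < D" using \<rho> \<omega> by (simp add: D_def)
    let ?A = "(2 ^ DIM('a) * \<omega> * (M * \<rho> powr \<theta>)) powr (p - 1)"
    have "ennreal (T powr p) \<le> ennreal ?A * (\<Sum>j. \<integral>\<^sup>+y. ennreal (wt j) * (osc p j y * K j y) \<partial>lborel)"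
      unfolding \<omega>_def
    proof (rule jensen_scales)
      show "ennreal T \<le> (\<Sum>j. \<integral>\<^sup>+y. ennreal (wt j) * (osc 1 j y * K j y) \<partial>lborel)"
        unfolding T_def K_def \<rho>_def by (rule pot_diff_le)
    qed (use M \<rho> mass in \<open>auto simp: T_def\<close>)
    then have "ennreal (1 / D) * ennreal (T powr p) \<le>
       ennreal (1 / D) * (ennreal ?A * (\<Sum>j. \<integral>\<^sup>+y. ennreal (wt j) * (osc p j y * K j y) \<partial>lborel))"
      by (rule mult_left_mono) simp
    also have "\<dots> = (\<Sum>j. ennreal (1 / D) * (ennreal ?A * (\<integral>\<^sup>+y. ennreal (wt j) * (osc p j y * K j y) \<partial>lborel)))"
      by (simp only: ennreal_suminf_cmult)
    also have "\<dots> = (\<Sum>j. if N \<le> j then ennreal (C / rad j ^ DIM('a)) * (ennreal (besov_kernel \<theta> (rad j) (x - x')) *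
        (osc_near (2 * rad j) j x + osc_near (2 * rad j) j x')) else 0)"
    proof (intro suminf_cong)
      fix j
      show "ennreal (1 / D) * (ennreal ?A * (\<integral>\<^sup>+y. ennreal (wt j) * (osc p j y * K j y) \<partial>lborel)) =
        (if N \<le> j then ennreal (C / rad j ^ DIM('a)) * (ennreal (besov_kernel \<theta> (rad j) (x - x')) *
        (osc_near (2 * rad j) j x + osc_near (2 * rad j) j x')) else 0)"
      proof (cases "N \<le> j")
        case True
        let ?m = "min 1 (\<rho> / rad j)"
        let ?I = "osc_near (2 * rad j) j x + osc_near (2 * rad j) j x'"
        have "(\<integral>\<^sup>+y. ennreal (wt j) * (osc p j y * K j y) \<partial>lborel) =
          (\<integral>\<^sup>+y. ennreal (wt j) * (ennreal (2 * ?m) * (osc p j y * near (2 * rad j) x y + osc p j y * near (2 * rad j) x' y)) \<partial>lborel)"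
          using True by (intro nn_integral_cong) (simp add: K_def distrib_left mult_ac)
        also have "\<dots> = ennreal (wt j) * (ennreal (2 * ?m) * ?I)"
          unfolding osc_near_def by (simp add: nn_integral_cmult nn_integral_add)
        finally have "ennreal (1 / D) * (ennreal ?A * (\<integral>\<^sup>+y. ennreal (wt j) * (osc p j y * K j y) \<partial>lborel)) =
          (ennreal (1 / D) * (ennreal ?A * (ennreal (wt j) * ennreal (2 * ?m)))) * ?I"
          by (simp only: mult.assoc)
        also have "ennreal (1 / D) * (ennreal ?A * (ennreal (wt j) * ennreal (2 * ?m))) = ennreal (1 / D * (?A * (wt j * (2 * ?m))))"
          using D \<rho> by (subst ennreal_mult3, simp, simp, simp, subst ennreal_mult [symmetric]) auto
        also have "1 / D * (?A * (wt j * (2 * ?m))) = C / rad j ^ DIM('a) * besov_kernel \<theta> (rad j) (x - x')"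
        proof -
          have A: "?A = (2 ^ DIM('a) * \<omega> * M) powr (p - 1) * \<rho> powr (\<theta> * (p - 1))"
            using M \<omega> \<rho> by (simp add: powr_mult powr_powr mult.assoc [symmetric])
          have D': "\<rho> powr (p * \<theta>) = \<rho> powr (\<theta> * (p - 1)) * \<rho> powr \<theta>"
            by (simp add: powr_add [symmetric] algebra_simps)
          have k: "besov_kernel \<theta> (rad j) (x - x') = ?m * rad j powr \<theta> / (\<rho> powr \<theta> * \<rho> ^ DIM('a))"
            using \<rho> by (simp add: besov_kernel_def \<rho>_def powr_divide)
          have eq: "1 / (a * b * (w * e)) * (c * a * (t / r * (2 * m))) = c * 2 / w / r * (m * t / (b * e))"
            if "a \<noteq> 0" for a b c e m r t w :: real
            using that by (simp add: field_simps)
          show ?thesis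
            unfolding A D_def D' k C_def wt_def using \<rho> by (intro eq) simp
        qed
        also have "ennreal (C / rad j ^ DIM('a) * besov_kernel \<theta> (rad j) (x - x')) =
          ennreal (C / rad j ^ DIM('a)) * ennreal (besov_kernel \<theta> (rad j) (x - x'))"
          using \<open>0 \<le> C\<close> by (intro ennreal_mult) auto
        finally show ?thesis using True by (simp add: mult.assoc)
      qed (simp add: K_def)
    qed
    also have "ennreal (1 / D) * ennreal (T powr p) = ennreal (T powr p / D)"
      using D by (simp add: ennreal_mult [symmetric])
    finally show ?thesis
      by (simp only: T_def D_def \<omega>_def \<rho>_def dist_norm)
  qed simp
qed

text \<open>At each scale, integrating the kernel leaves the integral of \<open>osc_near\<close>,
  which is \<open>osc_energy j\<close> times a ball volume. That volume cancels the power of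
  \<open>rad j\<close> in the denominator, so the constant is the same for all scales.\<close>

lemma besov_energy_trunc_pot_le:
  obtains C where "0 \<le> C" "\<And>N. besov_energy \<theta> p (trunc_pot N) \<le> ennreal C * tail N"
proof -
  obtain C where C: "0 \<le> C" and le: "\<And>N x x'. ennreal (\<bar>trunc_pot N x - trunc_pot N x'\<bar> powr p /
       (dist x x' powr (p * \<theta>) * (unit_ball_vol DIM('a) * dist x x' ^ DIM('a))))
    \<le> (\<Sum>j. if N \<le> j then ennreal (C / rad j ^ DIM('a)) * (ennreal (besov_kernel \<theta> (rad j) (x - x')) *
        (osc_near (2 * rad j) j x + osc_near (2 * rad j) j x')) else 0)"
    by (rule trunc_pot_diff_powr_le) (rule that)
  define k where "k = besov_kernel_const TYPE('a) \<theta>"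
  have k: "0 \<le> k" unfolding k_def using \<theta>_pos \<theta>_less_1 by (rule besov_kernel_const_nonneg)
  define C' where "C' = C * (2 * k) * (unit_ball_vol DIM('a) * 2 ^ DIM('a))"
  show ?thesis
  proof
    show "0 \<le> C'" using C k by (simp add: C'_def)
    fix N
    have "besov_energy \<theta> p (trunc_pot N) \<le> (\<integral>\<^sup>+x. \<integral>\<^sup>+x'. (\<Sum>j. if N \<le> j then
        ennreal (C / rad j ^ DIM('a)) * (ennreal (besov_kernel \<theta> (rad j) (x - x')) *
        (osc_near (2 * rad j) j x + osc_near (2 * rad j) j x')) else 0) \<partial>lborel \<partial>lborel)"
      unfolding besov_energy_lborel by (intro nn_integral_mono le)
    also have "\<dots> = (\<integral>\<^sup>+x. (\<Sum>j. \<integral>\<^sup>+x'. (if N \<le> j then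
        ennreal (C / rad j ^ DIM('a)) * (ennreal (besov_kernel \<theta> (rad j) (x - x')) *
        (osc_near (2 * rad j) j x + osc_near (2 * rad j) j x')) else 0) \<partial>lborel) \<partial>lborel)"
      by (intro nn_integral_cong nn_integral_suminf) measurable
    also have "\<dots> = (\<Sum>j. \<integral>\<^sup>+x. \<integral>\<^sup>+x'. (if N \<le> j then
        ennreal (C / rad j ^ DIM('a)) * (ennreal (besov_kernel \<theta> (rad j) (x - x')) *
        (osc_near (2 * rad j) j x + osc_near (2 * rad j) j x')) else 0) \<partial>lborel \<partial>lborel)"
      by (rule nn_integral_suminf) measurable
    also have "\<dots> \<le> (\<Sum>j. ennreal C' * (if N \<le> j then osc_energy j else 0))"
    proof (intro suminf_le)
      fix j
      show "(\<integral>\<^sup>+x. \<integral>\<^sup>+x'. (if N \<le> j then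
        ennreal (C / rad j ^ DIM('a)) * (ennreal (besov_kernel \<theta> (rad j) (x - x')) *
        (osc_near (2 * rad j) j x + osc_near (2 * rad j) j x')) else 0) \<partial>lborel \<partial>lborel)
        \<le> ennreal C' * (if N \<le> j then osc_energy j else 0)"
      proof (cases "N \<le> j")
        case True
        have "(\<integral>\<^sup>+x. \<integral>\<^sup>+x'. ennreal (C / rad j ^ DIM('a)) * (ennreal (besov_kernel \<theta> (rad j) (x - x')) *
            (osc_near (2 * rad j) j x + osc_near (2 * rad j) j x')) \<partial>lborel \<partial>lborel) =
          (\<integral>\<^sup>+x. ennreal (C / rad j ^ DIM('a)) * (\<integral>\<^sup>+x'. ennreal (besov_kernel \<theta> (rad j) (x - x')) *
            (osc_near (2 * rad j) j x + osc_near (2 * rad j) j x') \<partial>lborel) \<partial>lborel)"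
          by (intro nn_integral_cong nn_integral_cmult) measurable
        also have "\<dots> = ennreal (C / rad j ^ DIM('a)) * (\<integral>\<^sup>+x. \<integral>\<^sup>+x'. ennreal (besov_kernel \<theta> (rad j) (x - x')) *
            (osc_near (2 * rad j) j x + osc_near (2 * rad j) j x') \<partial>lborel \<partial>lborel)"
          by (rule nn_integral_cmult) measurable
        also have "\<dots> \<le> ennreal (C / rad j ^ DIM('a)) * (ennreal (2 * k) * (\<integral>\<^sup>+x. osc_near (2 * rad j) j x \<partial>lborel))"
          unfolding k_def using \<theta>_pos \<theta>_less_1
          by (intro mult_left_mono nn_integral_besov_kernel_add_le) auto
        also have "\<dots> = (ennreal (C / rad j ^ DIM('a)) * (ennreal (2 * k) *
            ennreal (unit_ball_vol DIM('a) * (2 * rad j) ^ DIM('a)))) * osc_energy j"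
          by (subst nn_integral_osc_near) (simp_all only: mult.assoc, simp)
        also have "ennreal (C / rad j ^ DIM('a)) * (ennreal (2 * k) *
            ennreal (unit_ball_vol DIM('a) * (2 * rad j) ^ DIM('a))) =
          ennreal (C / rad j ^ DIM('a) * (2 * k * (unit_ball_vol DIM('a) * (2 * rad j) ^ DIM('a))))"
          using C k by (intro ennreal_mult3) auto
        also have "C / rad j ^ DIM('a) * (2 * k * (unit_ball_vol DIM('a) * (2 * rad j) ^ DIM('a))) = C'"
          by (simp add: C'_def power_mult_distrib)
        finally show ?thesis using True by simp
      qed simp
    qed auto
    also have "\<dots> = ennreal C' * tail N"
      unfolding tail_def by (rule ennreal_suminf_cmult)
    finally show "besov_energy \<theta> p (trunc_pot N) \<le> ennreal C' * tail N" .
  qed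
qed

text \<open>The Jensen argument with \<open>hat\<close> itself in place of its differences: the
  kernel mass is bounded by a convergent series in \<open>rad j powr \<theta>\<close>, and the extra
  factor \<open>rad j powr \<theta>\<close> left at scale j is at most 1.\<close>

lemma Lp_energy_trunc_pot_le:
  obtains C where "0 \<le> C" "\<And>N. Lp_energy p (trunc_pot N) \<le> ennreal C * tail N"
proof -
  define \<omega> where "\<omega> = unit_ball_vol (real DIM('a))"
  have \<omega>: "0 < \<omega>" by (simp add: \<omega>_def)
  have less1: "2 powr -\<theta> < 1" using powr_less_one[of 2 "-\<theta>"] \<theta>_pos by simp
  define M where "M = 2 * \<omega> * 2 ^ DIM('a) / (1 - 2 powr -\<theta>)"
  have M: "0 < M" using \<omega> less1 by (simp add: M_def)
  define A where "A = (2 ^ DIM('a) * \<omega> * M) powr (p - 1)"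
  define C where "C = A * (2 * \<omega> * 2 ^ DIM('a))"
  have A: "0 \<le> A" by (simp add: A_def)
  show ?thesis
  proof
    show "0 \<le> C" using \<omega> A by (simp add: C_def)
    fix N
    let ?K = "\<lambda>(x::'a) j y. if N \<le> j then ennreal 2 * near (2 * rad j) x y else 0"
    have hat_le: "ennreal (hat ((x - y) /\<^sub>R rad j)) \<le> ennreal 2 * near (2 * rad j) x y" for x y :: 'a and j
      using hat_eq_0[of "rad j" x y] hat_le_2[of "(x - y) /\<^sub>R rad j"]
      by (auto simp: near_def dist_commute ennreal_leI simp del: ennreal_numeral)
    have mass: "(\<Sum>j. \<integral>\<^sup>+y. ennreal (wt j) * ?K x j y \<partial>lborel) \<le> ennreal M" for x
    proof -
      have "(\<Sum>j. \<integral>\<^sup>+y. ennreal (wt j) * ?K x j y \<partial>lborel) \<le> (\<Sum>j. ennreal (2 * \<omega> * 2 ^ DIM('a) * rad j powr \<theta>))"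
      proof (intro suminf_le)
        fix j
        have "(\<integral>\<^sup>+y. ennreal (wt j) * ?K x j y \<partial>lborel) \<le> (\<integral>\<^sup>+y. ennreal (wt j) * (ennreal 2 * near (2 * rad j) x y) \<partial>lborel)"
          by (intro nn_integral_mono mult_left_mono) auto
        also have "\<dots> = ennreal (wt j) * (ennreal 2 * ennreal (\<omega> * (2 * rad j) ^ DIM('a)))"
          by (simp add: nn_integral_cmult nn_integral_near \<omega>_def del: ennreal_numeral)
        also have "\<dots> = ennreal (wt j * (2 * (\<omega> * (2 * rad j) ^ DIM('a))))"
          using \<omega> by (subst ennreal_mult [symmetric], simp, simp, subst ennreal_mult [symmetric]) auto
        also have "wt j * (2 * (\<omega> * (2 * rad j) ^ DIM('a))) = 2 * \<omega> * 2 ^ DIM('a) * rad j powr \<theta>"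
          by (simp add: wt_def power_mult_distrib)
        finally show "(\<integral>\<^sup>+y. ennreal (wt j) * ?K x j y \<partial>lborel) \<le> ennreal (2 * \<omega> * 2 ^ DIM('a) * rad j powr \<theta>)" .
      qed auto
      also have "\<dots> = ennreal M"
        unfolding M_def using \<theta>_pos \<omega> by (intro suminf_rad_powr) auto
      finally show ?thesis .
    qed
    have "Lp_energy p (trunc_pot N) \<le> (\<integral>\<^sup>+x. ennreal A * (\<Sum>j. \<integral>\<^sup>+y. ennreal (wt j) * (osc p j y * ?K x j y) \<partial>lborel) \<partial>lborel)"
      unfolding Lp_energy_lborel
    proof (rule nn_integral_mono)
      fix x
      show "ennreal (\<bar>trunc_pot N x\<bar> powr p) \<le> ennreal A * (\<Sum>j. \<integral>\<^sup>+y. ennreal (wt j) * (osc p j y * ?K x j y) \<partial>lborel)"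
        unfolding A_def \<omega>_def
      proof (rule jensen_scales)
        have "ennreal \<bar>trunc_pot N x\<bar> = min 1 (pot N x)"
          by (simp add: trunc_pot_def min_less_iff_disj)
        also have "\<dots> \<le> pot N x" by simp
        also have "\<dots> \<le> (\<Sum>j. \<integral>\<^sup>+y. ennreal (wt j) * (osc 1 j y * ?K x j y) \<partial>lborel)"
          unfolding pot_def by (intro suminf_le nn_integral_mono mult_left_mono) (auto intro: hat_le simp del: ennreal_numeral)
        finally show "ennreal \<bar>trunc_pot N x\<bar> \<le> (\<Sum>j. \<integral>\<^sup>+y. ennreal (wt j) * (osc 1 j y * ?K x j y) \<partial>lborel)" .
      qed (use M mass in auto)
    qed
    also have "\<dots> = (\<Sum>j. \<integral>\<^sup>+x. ennreal A * (\<integral>\<^sup>+y. ennreal (wt j) * (osc p j y * ?K x j y) \<partial>lborel) \<partial>lborel)"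
      unfolding ennreal_suminf_cmult [symmetric] by (rule nn_integral_suminf) measurable
    also have "\<dots> \<le> (\<Sum>j. ennreal C * (if N \<le> j then osc_energy j else 0))"
    proof (intro suminf_le)
      fix j
      show "(\<integral>\<^sup>+x. ennreal A * (\<integral>\<^sup>+y. ennreal (wt j) * (osc p j y * ?K x j y) \<partial>lborel) \<partial>lborel)
        \<le> ennreal C * (if N \<le> j then osc_energy j else 0)"
      proof (cases "N \<le> j")
        case True
        have "(\<integral>\<^sup>+y. ennreal (wt j) * (osc p j y * ?K x j y) \<partial>lborel) = ennreal (wt j) * (ennreal 2 * osc_near (2 * rad j) j x)" for x
        proof -
          have "(\<integral>\<^sup>+y. ennreal (wt j) * (osc p j y * ?K x j y) \<partial>lborel) =
            (\<integral>\<^sup>+y. ennreal (wt j) * (ennreal 2 * (osc p j y * near (2 * rad j) x y)) \<partial>lborel)"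
            using True by (intro nn_integral_cong) (simp add: mult_ac)
          then show ?thesis unfolding osc_near_def by (simp add: nn_integral_cmult del: ennreal_numeral)
        qed
        then have "(\<integral>\<^sup>+x. ennreal A * (\<integral>\<^sup>+y. ennreal (wt j) * (osc p j y * ?K x j y) \<partial>lborel) \<partial>lborel) =
          ennreal A * (ennreal (wt j) * (ennreal 2 * (\<integral>\<^sup>+x. osc_near (2 * rad j) j x \<partial>lborel)))"
          by (simp only:) (simp add: nn_integral_cmult del: ennreal_numeral)
        also have "\<dots> = ennreal A * (ennreal (wt j) * (ennreal 2 * (ennreal (\<omega> * (2 * rad j) ^ DIM('a)) * osc_energy j)))"
          by (simp add: nn_integral_osc_near \<omega>_def del: ennreal_numeral)
        also have "\<dots> = ennreal (A * (wt j * (2 * (\<omega> * (2 * rad j) ^ DIM('a))))) * osc_energy j"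
          using A \<omega> by (simp add: ennreal_mult mult.assoc del: ennreal_numeral)
        also have "\<dots> \<le> ennreal C * osc_energy j"
        proof (intro mult_right_mono ennreal_leI)
          have "A * (wt j * (2 * (\<omega> * (2 * rad j) ^ DIM('a)))) = C * rad j powr \<theta>"
            by (simp add: C_def wt_def power_mult_distrib)
          also have "\<dots> \<le> C * 1"
            using \<omega> A \<theta>_pos powr_mono2[of \<theta> "rad j" 1] by (intro mult_left_mono) (auto simp: C_def)
          finally show "A * (wt j * (2 * (\<omega> * (2 * rad j) ^ DIM('a)))) \<le> C" by simp
        qed simp
        finally show ?thesis using True by simp
      qed simp
    qed auto
    also have "\<dots> = ennreal C * tail N"
      unfolding tail_def by (rule ennreal_suminf_cmult)
    finally show "Lp_energy p (trunc_pot N) \<le> ennreal C * tail N" .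
  qed
qed

text \<open>The set lies in every open set \<open>{x. 1 < pot N x}\<close>, so its capacity is at
  most a fixed multiple of each \<open>tail N\<close>.\<close>

lemma capacity_pot_infinite: "besov_capacity \<theta> p {x. \<forall>N. pot N x = \<infinity>} = 0"
proof -
  obtain C where C: "0 \<le> C" "\<And>N. besov_energy \<theta> p (trunc_pot N) \<le> ennreal C * tail N"
    by (rule besov_energy_trunc_pot_le) (rule that)
  obtain C' where C': "0 \<le> C'" "\<And>N. Lp_energy p (trunc_pot N) \<le> ennreal C' * tail N"
    by (rule Lp_energy_trunc_pot_le) (rule that)
  have le: "besov_capacity \<theta> p {x. \<forall>N. pot N x = \<infinity>} \<le> ennreal (C + C') * tail N" for N
  proof -
    have "besov_capacity \<theta> p {x. \<forall>N. pot N x = \<infinity>} \<le> besov_energy \<theta> p (trunc_pot N) + Lp_energy p (trunc_pot N)"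
    proof (rule besov_capacity_le)
      show "open {x. 1 < pot N x}" by (rule open_pot_greater)
      show "{x. \<forall>N. pot N x = \<infinity>} \<subseteq> {x. 1 < pot N x}" by auto
      show "AE x in lebesgue. x \<in> {x. 1 < pot N x} \<longrightarrow> 1 \<le> trunc_pot N x"
        by (rule AE_I2) (auto simp: trunc_pot_def min_absorb1)
    qed measurable
    also have "\<dots> \<le> ennreal C * tail N + ennreal C' * tail N"
      by (intro add_mono C C')
    also have "\<dots> = ennreal (C + C') * tail N"
      using C C' by (simp add: ennreal_plus distrib_right)
    finally show ?thesis .
  qed
  have "(\<lambda>N. ennreal (C + C') * tail N) \<longlonglongrightarrow> ennreal (C + C') * 0"
    by (intro tendsto_mult_ennreal tendsto_const tail_tendsto_0) auto
  then have "besov_capacity \<theta> p {x. \<forall>N. pot N x = \<infinity>} \<le> 0"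
    using le by (intro LIMSEQ_le_const) auto
  then show ?thesis by simp
qed

section \<open>Density of the localised energy\<close>

text \<open>The radius is twice \<open>rad k\<close> so that a ball of radius \<open>rad j\<close>,
  with \<open>k <= j\<close>, about a point within \<open>rad k\<close> of \<open>z\<close> fits
  inside.\<close>

definition local_energy :: "nat \<Rightarrow> 'a \<Rightarrow> ennreal" where
  "local_energy k z = (\<Sum>j. if k \<le> j then osc_near (2 * rad k) j z else 0)"

definition energy_density :: "nat \<Rightarrow> 'a \<Rightarrow> ennreal" where
  "energy_density N y = (\<Sum>j. if N \<le> j then osc p j y else 0)"

lemma energy_density_measurable [measurable]: "energy_density N \<in> borel_measurable borel"
  unfolding energy_density_def by measurable

lemma nn_integral_energy_density: "(\<integral>\<^sup>+y. energy_density N y \<partial>lborel) = tail N"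
proof -
  have "(\<integral>\<^sup>+y. energy_density N y \<partial>lborel) = (\<Sum>j. \<integral>\<^sup>+y. (if N \<le> j then osc p j y else 0) \<partial>lborel)"
    unfolding energy_density_def by (rule nn_integral_suminf) measurable
  also have "\<dots> = tail N"
    unfolding tail_def osc_energy_def by (intro suminf_cong) auto
  finally show ?thesis .
qed

text \<open>One measure, of total mass \<open>tail N\<close>, dominates the local energies at all
  scales from \<open>N\<close> on; over disjoint balls they therefore add up to at most
  \<open>tail N\<close>.\<close>

lemma local_energy_le:
  assumes "N \<le> k"
  shows "local_energy k z \<le> emeasure (density lborel (energy_density N)) (ball z (2 * rad k))"
proof -
  have "local_energy k z \<le> (\<Sum>j. \<integral>\<^sup>+y. (if N \<le> j then osc p j y else 0) * near (2 * rad k) z y \<partial>lborel)"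
    unfolding local_energy_def osc_near_def using assms by (intro suminf_le) auto
  also have "\<dots> = (\<integral>\<^sup>+y. (\<Sum>j. (if N \<le> j then osc p j y else 0) * near (2 * rad k) z y) \<partial>lborel)"
    by (rule nn_integral_suminf [symmetric]) measurable
  also have "\<dots> = (\<integral>\<^sup>+y. energy_density N y * indicator (ball z (2 * rad k)) y \<partial>lborel)"
  proof (rule nn_integral_cong)
    fix y
    have "near (2 * rad k) z y = indicator (ball z (2 * rad k)) y"
      by (simp add: near_def indicator_def)
    then show "(\<Sum>j. (if N \<le> j then osc p j y else 0) * near (2 * rad k) z y) = energy_density N y * indicator (ball z (2 * rad k)) y"
      unfolding energy_density_def by (simp only: ennreal_suminf_multc)
  qed
  also have "\<dots> = emeasure (density lborel (energy_density N)) (ball z (2 * rad k))"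
    by (rule emeasure_density [symmetric]) auto
  finally show ?thesis .
qed

text \<open>The threshold has the order of the capacity bound for a ball of radius
  \<open>rad k\<close>, so on such a ball energy pays for capacity. Arbitrarily fine scales are
  demanded to allow coverings with any \<open>tail N\<close>.\<close>

definition dense_set :: "real \<Rightarrow> 'a set" where
  "dense_set c = {z. \<forall>N. \<exists>k\<ge>N. ennreal (c * rad k powr (real DIM('a) - p * \<theta>)) < local_energy k z}"

lemma capacity_dense_set_le:
  assumes "0 < c"
  obtains C where "\<And>N. 4 \<le> N \<Longrightarrow> besov_capacity \<theta> p (dense_set c) \<le> ennreal C * tail N"
proof -
  define s where "s = real DIM('a) - p * \<theta>"
  obtain C1 where C1: "0 < C1" "\<And>(z::'a) r. 0 < r \<Longrightarrow> r \<le> 1 \<Longrightarrow> besov_capacity \<theta> p (cball z r) \<le> ennreal (C1 * r powr s)"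
    unfolding s_def using besov_capacity_cball_le[OF p_ge_1 \<theta>_pos \<theta>_less_1, where 'a = 'a] by metis
  \<comment> \<open>10 is the Vitali factor 5 times the radius factor 2; dividing by
    \<open>c\<close> converts the threshold into energy.\<close>
  define C where "C = C1 * 10 powr s / c"
  have "besov_capacity \<theta> p (dense_set c) \<le> ennreal C * tail N" if N: "4 \<le> N" for N
  proof -
    define \<mu> where "\<mu> = density lborel (energy_density N)"
    have sets_\<mu>: "sets \<mu> = sets borel" by (simp add: \<mu>_def)
    have "\<forall>z\<in>dense_set c. \<exists>k\<ge>N. ennreal (c * rad k powr s) < local_energy k z"
      by (auto simp: dense_set_def s_def)
    then obtain k where k: "\<And>z. z \<in> dense_set c \<Longrightarrow> N \<le> k z"
      "\<And>z. z \<in> dense_set c \<Longrightarrow> ennreal (c * rad (k z) powr s) < local_energy (k z) z"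
      by metis
    obtain I where I: "countable I" "I \<subseteq> dense_set c"
      and disj: "pairwise (\<lambda>x y. disjnt (cball x (2 * rad (k x))) (cball y (2 * rad (k y)))) I"
      and cover: "dense_set c \<subseteq> (\<Union>x\<in>I. cball x (5 * (2 * rad (k x))))"
    proof (rule Vitali_covering_lemma_cballs[where S = "dense_set c" and K = "dense_set c"
          and a = "\<lambda>x. x" and r = "\<lambda>x. 2 * rad (k x)" and B = 2])
      show "dense_set c \<subseteq> (\<Union>x\<in>dense_set c. cball x (2 * rad (k x)))"
        using rad_nonneg by fastforce
    qed (auto intro: that)
    \<comment> \<open>The countable family is indexed by natural numbers; indices outside the image
      carry the empty set, of capacity 0.\<close>
    define e where "e = to_nat_on I"
    define g where "g = from_nat_into I"
    have ge: "g (e x) = x" if "x \<in> I" for x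
      using that I by (simp add: g_def e_def)
    define A where "A = (\<lambda>n. if n \<in> e ` I then cball (g n) (10 * rad (k (g n))) else {})"
    define B where "B = (\<lambda>n. if n \<in> e ` I then ball (g n) (2 * rad (k (g n))) else {})"
    have "dense_set c \<subseteq> (\<Union>n. A n)"
    proof
      fix z assume "z \<in> dense_set c"
      then obtain x where "x \<in> I" "z \<in> cball x (10 * rad (k x))" using cover by auto
      then have "z \<in> A (e x)" by (simp add: A_def ge)
      then show "z \<in> (\<Union>n. A n)" by blast
    qed
    then have "besov_capacity \<theta> p (dense_set c) \<le> besov_capacity \<theta> p (\<Union>n. A n)"
      by (rule besov_capacity_mono)
    also have "\<dots> \<le> (\<Sum>n. besov_capacity \<theta> p (A n))"
      using p_ge_1 by (intro besov_capacity_UN_le) auto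
    also have "\<dots> \<le> (\<Sum>n. ennreal C * emeasure \<mu> (B n))"
    proof (intro suminf_le)
      fix n
      show "besov_capacity \<theta> p (A n) \<le> ennreal C * emeasure \<mu> (B n)"
      proof (cases "n \<in> e ` I")
        case True
        then obtain x where x: "x \<in> I" "n = e x" "g n = x" by (auto simp: ge)
        then have mem: "x \<in> dense_set c" using I by auto
        \<comment> \<open>\<open>10 * rad 4 = 10 / 16\<close>, within the range of radii up to 1 in
          the capacity bound; hence \<open>4 <= N\<close>.\<close>
        have "rad (k x) \<le> rad 4"
          using N k(1)[OF mem] by (intro rad_mono) auto
        then have "10 * rad (k x) \<le> 1"
          by (simp add: rad_def power_divide)
        then have "besov_capacity \<theta> p (cball x (10 * rad (k x))) \<le> ennreal (C1 * (10 * rad (k x)) powr s)"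
          by (intro C1) auto
        also have "C1 * (10 * rad (k x)) powr s = C * (c * rad (k x) powr s)"
          using \<open>0 < c\<close> by (simp add: C_def powr_mult)
        also have "ennreal (C * (c * rad (k x) powr s)) = ennreal C * ennreal (c * rad (k x) powr s)"
          using \<open>0 < c\<close> C1 by (intro ennreal_mult) (auto simp: C_def)
        also have "\<dots> \<le> ennreal C * emeasure \<mu> (ball x (2 * rad (k x)))"
          using k[OF mem] local_energy_le[of N "k x" x]
          by (intro mult_left_mono) (auto simp: \<mu>_def)
        finally show ?thesis using True x by (simp add: A_def B_def)
      qed (use p_ge_1 in \<open>simp add: A_def B_def besov_capacity_empty\<close>)
    qed auto
    also have "\<dots> = ennreal C * (\<Sum>n. emeasure \<mu> (B n))"
      by (rule ennreal_suminf_cmult)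
    also have "(\<Sum>n. emeasure \<mu> (B n)) = emeasure \<mu> (\<Union>n. B n)"
    proof (rule suminf_emeasure)
      show "range B \<subseteq> sets \<mu>" by (auto simp: B_def sets_\<mu>)
      show "disjoint_family B"
        unfolding disjoint_family_on_def
      proof (intro ballI impI)
        fix m n :: nat assume "m \<noteq> n"
        show "B m \<inter> B n = {}"
        proof (cases "m \<in> e ` I \<and> n \<in> e ` I")
          case True
          then obtain x y where "x \<in> I" "y \<in> I" "m = e x" "n = e y" by auto
          moreover from this \<open>m \<noteq> n\<close> have "x \<noteq> y" by auto
          ultimately have "disjnt (cball x (2 * rad (k x))) (cball y (2 * rad (k y)))"
            using disj by (auto simp: pairwise_def)
          then have "ball x (2 * rad (k x)) \<inter> ball y (2 * rad (k y)) = {}"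
            using ball_subset_cball[of x "2 * rad (k x)"] ball_subset_cball[of y "2 * rad (k y)"]
            unfolding disjnt_def by blast
          then show ?thesis
            using \<open>x \<in> I\<close> \<open>y \<in> I\<close> \<open>m = e x\<close> \<open>n = e y\<close> by (simp add: B_def ge)
        qed (auto simp: B_def)
      qed
    qed
    also have "emeasure \<mu> (\<Union>n. B n) \<le> emeasure \<mu> UNIV"
      by (intro emeasure_mono) (auto simp: sets_\<mu>)
    also have "emeasure \<mu> UNIV = tail N"
      by (simp add: \<mu>_def emeasure_density nn_integral_energy_density)
    finally show ?thesis by (simp add: mult_left_mono)
  qed
  then show ?thesis by (rule that)
qed

lemma capacity_dense_set:
  assumes "0 < c"
  shows "besov_capacity \<theta> p (dense_set c) = 0"
proof -
  obtain C where C: "\<And>N. 4 \<le> N \<Longrightarrow> besov_capacity \<theta> p (dense_set c) \<le> ennreal C * tail N"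
    using capacity_dense_set_le[OF assms] by metis
  have "(\<lambda>N. ennreal C * tail N) \<longlonglongrightarrow> ennreal C * 0"
    by (intro tendsto_mult_ennreal tendsto_const tail_tendsto_0) auto
  then have "besov_capacity \<theta> p (dense_set c) \<le> 0"
    using C by (intro LIMSEQ_le_const) auto
  then show ?thesis by simp
qed

text \<open>If convergence to 0 fails, some threshold 1 / (m + 1) is exceeded at arbitrarily fine
  scales.\<close>

lemma capacity_local_energy:
  "besov_capacity \<theta> p {z. \<not> (\<lambda>k. ennreal (rad k powr (p * \<theta> - real DIM('a))) * local_energy k z) \<longlonglongrightarrow> 0} = 0"
  (is "besov_capacity \<theta> p ?A = 0")
proof -
  have "?A \<subseteq> (\<Union>m. dense_set (1 / real (Suc m)))"
  proof
    fix z assume z: "z \<in> ?A"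
    show "z \<in> (\<Union>m. dense_set (1 / real (Suc m)))"
    proof (rule ccontr)
      assume "z \<notin> (\<Union>m. dense_set (1 / real (Suc m)))"
      then have ev: "\<exists>N. \<forall>k\<ge>N. local_energy k z \<le> ennreal (1 / real (Suc m) * rad k powr (real DIM('a) - p * \<theta>))" for m
        by (fastforce simp: dense_set_def not_less)
      have "(\<lambda>k. ennreal (rad k powr (p * \<theta> - real DIM('a))) * local_energy k z) \<longlonglongrightarrow> 0"
      proof (rule order_tendstoI)
        fix a :: ennreal assume "0 < a"
        then obtain m where m: "ennreal (1 / real (Suc m)) < a"
        proof (cases a)
          case (real r)
          then have "0 < r" using \<open>0 < a\<close> by simp
          then obtain m where "1 / real (Suc m) < r"
            using reals_Archimedean by (auto simp: inverse_eq_divide)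
          then show ?thesis
            using real \<open>0 < r\<close> by (intro that[of m]) (auto intro!: ennreal_lessI)
        qed (use that[of 0] in auto)
        obtain N where N: "\<And>k. N \<le> k \<Longrightarrow> local_energy k z \<le> ennreal (1 / real (Suc m) * rad k powr (real DIM('a) - p * \<theta>))"
          using ev by blast
        have "ennreal (rad k powr (p * \<theta> - real DIM('a))) * local_energy k z < a" if "N \<le> k" for k
        proof -
          have "ennreal (rad k powr (p * \<theta> - real DIM('a))) * local_energy k z \<le>
            ennreal (rad k powr (p * \<theta> - real DIM('a))) * ennreal (1 / real (Suc m) * rad k powr (real DIM('a) - p * \<theta>))"
            by (intro mult_left_mono N that) auto
          also have "\<dots> = ennreal (rad k powr (p * \<theta> - real DIM('a)) * (1 / real (Suc m) * rad k powr (real DIM('a) - p * \<theta>)))"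
            by (intro ennreal_mult [symmetric]) auto
          also have "rad k powr (p * \<theta> - real DIM('a)) * (1 / real (Suc m) * rad k powr (real DIM('a) - p * \<theta>)) =
            1 / real (Suc m) * rad k powr ((p * \<theta> - real DIM('a)) + (real DIM('a) - p * \<theta>))"
            unfolding powr_add by simp
          also have "\<dots> = 1 / real (Suc m)" by simp
          finally show ?thesis using m by simp
        qed
        then show "eventually (\<lambda>k. ennreal (rad k powr (p * \<theta> - real DIM('a))) * local_energy k z < a) sequentially"
          by (auto simp: eventually_sequentially)
      qed auto
      then show False using z by simp
    qed
  qed
  then have "besov_capacity \<theta> p ?A \<le> besov_capacity \<theta> p (\<Union>m. dense_set (1 / real (Suc m)))"
    by (rule besov_capacity_mono)
  also have "\<dots> \<le> (\<Sum>m. besov_capacity \<theta> p (dense_set (1 / real (Suc m))))"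
    using p_ge_1 by (intro besov_capacity_UN_le) auto
  also have "\<dots> = 0"
    by (simp add: capacity_dense_set)
  finally show ?thesis by simp
qed

section \<open>Convergence of ball averages\<close>

lemma f_set_integrable: "set_integrable lborel (ball x r) f"
proof -
  have "(\<integral>\<^sup>+y. ennreal (norm (indicator (ball x r) y *\<^sub>R f y)) \<partial>lborel) \<le>
    (\<integral>\<^sup>+y. indicator (ball x r) y + ennreal (\<bar>f y\<bar> powr p) \<partial>lborel)"
  proof (rule nn_integral_mono)
    fix y
    have "\<bar>f y\<bar> \<le> 1 + \<bar>f y\<bar> powr p"
    proof (cases "\<bar>f y\<bar> \<le> 1")
      case False
      then have "\<bar>f y\<bar> powr 1 \<le> \<bar>f y\<bar> powr p" using p_ge_1 by (intro powr_mono) auto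
      then show ?thesis by simp
    qed (simp add: add_increasing2)
    then have "ennreal \<bar>f y\<bar> \<le> ennreal 1 + ennreal (\<bar>f y\<bar> powr p)"
      by (subst ennreal_plus [symmetric]) (auto intro!: ennreal_leI simp del: ennreal_plus)
    then show "ennreal (norm (indicator (ball x r) y *\<^sub>R f y)) \<le> indicator (ball x r) y + ennreal (\<bar>f y\<bar> powr p)"
      by (simp add: indicator_def)
  qed
  also have "\<dots> = emeasure lborel (ball x r) + Lp_energy p f"
    unfolding Lp_energy_lborel by (subst nn_integral_add) auto
  also have "\<dots> < \<infinity>"
    using Lp_energy_finite emeasure_lborel_ball_finite[of x r] by (simp add: less_top)
  finally show ?thesis
    unfolding set_integrable_def by (intro integrableI_bounded) auto
qed

lemma ball_average_diff_le:
  assumes "0 < r"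
  shows "ennreal \<bar>ball_average f x r - c\<bar> \<le> ennreal (1 / (unit_ball_vol DIM('a) * r ^ DIM('a))) *
    (\<integral>\<^sup>+z. ennreal \<bar>f z - c\<bar> * near r x z \<partial>lborel)"
proof -
  define V where "V = unit_ball_vol DIM('a) * r ^ DIM('a)"
  have V: "0 < V" using assms by (simp add: V_def)
  have vol: "measure lebesgue (ball x r) = V" "measure lborel (ball x r) = V"
    using assms by (simp_all add: V_def content_ball)
  have c_int: "set_integrable lborel (ball x r) (\<lambda>_. c)"
    using emeasure_lborel_ball_finite[of x r] by (auto simp: set_integrable_def)
  have "ball_average f x r = (LINT z:ball x r|lborel. f z) / V"
    unfolding ball_average_def vol set_lebesgue_integral_def
    by (subst integral_completion) auto
  moreover have "(LINT z:ball x r|lborel. c) = V * c"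
    unfolding set_lebesgue_integral_def using emeasure_lborel_ball_finite[of x r]
    by (subst integral_scaleR_left) (auto simp: vol)
  ultimately have "ball_average f x r - c = ((LINT z:ball x r|lborel. f z) - (LINT z:ball x r|lborel. c)) / V"
    using V by (simp add: diff_divide_distrib)
  also have "(LINT z:ball x r|lborel. f z) - (LINT z:ball x r|lborel. c) = (LINT z:ball x r|lborel. f z - c)"
    using f_set_integrable c_int by (rule set_integral_diff(2) [symmetric])
  finally have "\<bar>ball_average f x r - c\<bar> = 1 / V * norm (LINT z:ball x r|lborel. f z - c)"
    using V by simp
  then have "ennreal \<bar>ball_average f x r - c\<bar> = ennreal (1 / V) * ennreal (norm (LINT z:ball x r|lborel. f z - c))"
    using V by (simp only:) (intro ennreal_mult, auto)
  also have "\<dots> \<le> ennreal (1 / V) * (\<integral>\<^sup>+z. ennreal (norm (indicator (ball x r) z *\<^sub>R (f z - c))) \<partial>lborel)"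
    unfolding set_lebesgue_integral_def
    using set_integral_diff(1)[OF f_set_integrable c_int]
    by (intro mult_left_mono integral_norm_bound_ennreal) (auto simp: set_integrable_def)
  also have "(\<integral>\<^sup>+z. ennreal (norm (indicator (ball x r) z *\<^sub>R (f z - c))) \<partial>lborel) =
    (\<integral>\<^sup>+z. ennreal \<bar>f z - c\<bar> * near r x z \<partial>lborel)"
    by (intro nn_integral_cong) (simp add: near_def indicator_def)
  finally show ?thesis by (simp add: V_def)
qed

text \<open>Up to a constant, the mean over y in the ball of radius \<open>rad j\<close> about x of
  the mean of |f y - f z| over z within \<open>2 * rad j\<close> of y.\<close>

definition scale_osc :: "nat \<Rightarrow> 'a \<Rightarrow> ennreal" where
  "scale_osc j x = (\<integral>\<^sup>+y. ennreal (wt j) * (osc 1 j y * near (rad j) x y) \<partial>lborel)"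

text \<open>One factor for each of two averages over balls of radius at least
  \<open>rad j / 2\<close>.\<close>

definition avg_const :: real where
  "avg_const = (2 ^ DIM('a) / unit_ball_vol DIM('a)) ^ 2"

lemma avg_const_pos: "0 < avg_const"
  unfolding avg_const_def by (intro zero_less_power divide_pos_pos) auto

lemma nn_integral_abs_diff_near:
  "(\<integral>\<^sup>+z. ennreal \<bar>f y - f z\<bar> * near (2 * rad j) y z \<partial>lborel) = ennreal (rad j powr \<theta> * rad j ^ DIM('a)) * osc 1 j y"
proof -
  have "ennreal (rad j powr \<theta> * rad j ^ DIM('a)) * osc 1 j y =
    (\<integral>\<^sup>+z. ennreal (rad j powr \<theta> * rad j ^ DIM('a)) *
       (ennreal ((\<bar>f y - f z\<bar> / rad j powr \<theta>) powr 1 / rad j ^ DIM('a)) * near (2 * rad j) y z) \<partial>lborel)"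
    unfolding osc_def by (rule nn_integral_cmult [symmetric]) measurable
  also have "\<dots> = (\<integral>\<^sup>+z. ennreal \<bar>f y - f z\<bar> * near (2 * rad j) y z \<partial>lborel)"
  proof (rule nn_integral_cong)
    fix z
    have "ennreal (rad j powr \<theta> * rad j ^ DIM('a)) * ennreal ((\<bar>f y - f z\<bar> / rad j powr \<theta>) powr 1 / rad j ^ DIM('a))
      = ennreal \<bar>f y - f z\<bar>"
      by (subst ennreal_mult [symmetric]) auto
    then show "ennreal (rad j powr \<theta> * rad j ^ DIM('a)) *
       (ennreal ((\<bar>f y - f z\<bar> / rad j powr \<theta>) powr 1 / rad j ^ DIM('a)) * near (2 * rad j) y z) =
       ennreal \<bar>f y - f z\<bar> * near (2 * rad j) y z"
      by (simp only: mult.assoc [symmetric])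
  qed
  finally show ?thesis by simp
qed

text \<open>Points of the two balls are within \<open>2 * rad j\<close> of each other, so the double
  average of |f y - f u| is dominated by \<open>scale_osc\<close>. Different centres are allowed
  because \<open>lebesgue_point\<close> compares averages about x and about z.\<close>

lemma ball_average_ball_average_le:
  assumes sub: "ball x s \<subseteq> ball z (rad j)" "ball x' s' \<subseteq> ball z (rad j)"
    and s: "rad j / 2 \<le> s" "rad j / 2 \<le> s'"
  shows "ennreal \<bar>ball_average f x s - ball_average f x' s'\<bar> \<le> ennreal avg_const * scale_osc j z"
proof -
  define \<omega> where "\<omega> = unit_ball_vol (real DIM('a))"
  have \<omega>: "0 < \<omega>" by (simp add: \<omega>_def)
  have pos: "0 < s" "0 < s'" using s rad_pos[of j] by linarith+
  define v where "v = 1 / (\<omega> * s ^ DIM('a))"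
  define v' where "v' = 1 / (\<omega> * s' ^ DIM('a))"
  define w where "w = rad j powr \<theta> * rad j ^ DIM('a)"
  have v: "0 \<le> v" "0 \<le> v'" "0 \<le> w" using \<omega> pos by (auto simp: v_def v'_def w_def)
  have near_le: "near s' x' u * near s x y \<le> near (2 * rad j) y u * near (rad j) z y" for u y
  proof (cases "dist x y < s \<and> dist x' u < s'")
    case True
    then have "y \<in> ball z (rad j)" "u \<in> ball z (rad j)"
      using sub by (auto simp: subset_eq)
    then have "dist z y < rad j" "dist y u < 2 * rad j"
      using dist_triangle_less_add[of y z "rad j" u "rad j"] by (auto simp: dist_commute)
    then show ?thesis by (simp add: near_def)
  qed (auto simp: near_def)
  have "ennreal \<bar>ball_average f x s - ball_average f x' s'\<bar> \<le>
    ennreal v * (\<integral>\<^sup>+y. ennreal \<bar>f y - ball_average f x' s'\<bar> * near s x y \<partial>lborel)"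
    unfolding v_def \<omega>_def using pos(1) by (rule ball_average_diff_le)
  also have "\<dots> \<le> ennreal v * (\<integral>\<^sup>+y. ennreal (v' * w) * (osc 1 j y * near (rad j) z y) \<partial>lborel)"
  proof (intro mult_left_mono nn_integral_mono)
    fix y
    have "ennreal \<bar>f y - ball_average f x' s'\<bar> * near s x y \<le>
      (ennreal v' * (\<integral>\<^sup>+u. ennreal \<bar>f u - f y\<bar> * near s' x' u \<partial>lborel)) * near s x y"
      using ball_average_diff_le[OF pos(2), of x' "f y"]
      by (intro mult_right_mono) (auto simp: v'_def \<omega>_def abs_minus_commute)
    also have "\<dots> = ennreal v' * (\<integral>\<^sup>+u. ennreal \<bar>f u - f y\<bar> * near s' x' u * near s x y \<partial>lborel)"
      by (subst nn_integral_multc) (auto simp: mult.assoc)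
    also have "\<dots> \<le> ennreal v' * (\<integral>\<^sup>+u. ennreal \<bar>f y - f u\<bar> * near (2 * rad j) y u * near (rad j) z y \<partial>lborel)"
      using near_le unfolding mult.assoc
      by (intro mult_left_mono nn_integral_mono) (auto simp: abs_minus_commute intro!: mult_left_mono)
    also have "\<dots> = ennreal v' * (ennreal w * osc 1 j y * near (rad j) z y)"
      by (simp add: nn_integral_multc nn_integral_abs_diff_near w_def)
    also have "\<dots> = ennreal (v' * w) * (osc 1 j y * near (rad j) z y)"
      using v by (simp add: ennreal_mult mult.assoc)
    finally show "ennreal \<bar>f y - ball_average f x' s'\<bar> * near s x y \<le> ennreal (v' * w) * (osc 1 j y * near (rad j) z y)" .
  qed simp
  also have "\<dots> = ennreal (v * (v' * w)) * (\<integral>\<^sup>+y. osc 1 j y * near (rad j) z y \<partial>lborel)"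
    using v by (simp add: nn_integral_cmult ennreal_mult mult.assoc)
  also have "\<dots> \<le> ennreal (avg_const * wt j) * (\<integral>\<^sup>+y. osc 1 j y * near (rad j) z y \<partial>lborel)"
  proof (intro mult_right_mono ennreal_leI)
    have le: "1 / (\<omega> * t ^ DIM('a)) \<le> 2 ^ DIM('a) / (\<omega> * rad j ^ DIM('a))" if "rad j / 2 \<le> t" for t
    proof -
      have "1 / (\<omega> * t ^ DIM('a)) \<le> 1 / (\<omega> * (rad j / 2) ^ DIM('a))"
        using that \<omega> by (intro divide_left_mono mult_left_mono power_mono mult_pos_pos zero_less_power)
          (auto intro: less_le_trans[OF _ that])
      then show ?thesis by (simp add: power_divide)
    qed
    have "v * (v' * w) \<le> 2 ^ DIM('a) / (\<omega> * rad j ^ DIM('a)) * (2 ^ DIM('a) / (\<omega> * rad j ^ DIM('a)) * w)"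
      unfolding v_def v'_def using s \<omega> pos v(3) by (intro mult_mono le) auto
    also have "\<dots> = avg_const * wt j"
      by (simp add: avg_const_def wt_def w_def \<omega>_def power2_eq_square mult_ac)
    finally show "v * (v' * w) \<le> avg_const * wt j" .
  qed simp
  also have "\<dots> = ennreal avg_const * scale_osc j z"
    unfolding scale_osc_def using avg_const_pos
    by (simp add: nn_integral_cmult ennreal_mult mult.assoc)
  finally show ?thesis .
qed

text \<open>\<open>hat\<close> is at least 1 on the unit ball, so a finite potential means summable
  oscillation at \<open>z\<close>.\<close>

lemma suminf_scale_osc_le_pot: "(\<Sum>j. if N \<le> j then scale_osc j z else 0) \<le> pot N z"
  unfolding pot_def
proof (intro suminf_le)
  fix j
  have "near (rad j) z y \<le> ennreal (hat ((z - y) /\<^sub>R rad j))" for y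
    using hat_ge_1[of "rad j" z y] by (auto simp: near_def dist_commute ennreal_leI simp flip: ennreal_1)
  then show "(if N \<le> j then scale_osc j z else 0) \<le> (\<integral>\<^sup>+y. ennreal (wt j) *
     (osc 1 j y * (if N \<le> j then ennreal (hat ((z - y) /\<^sub>R rad j)) else 0)) \<partial>lborel)"
    unfolding scale_osc_def by (auto intro!: nn_integral_mono mult_left_mono)
qed auto

lemma suminf_scale_osc_finite:
  assumes "pot N z < \<infinity>"
  obtains a where "summable a" "\<And>j. 0 \<le> a j" "\<And>j. scale_osc (j + N) z = ennreal (a j)"
proof -
  have "(\<Sum>j. scale_osc (j + N) z) \<le> (\<Sum>j. if N \<le> j then scale_osc j z else 0)"
  proof (rule suminf_le_const)
    fix n
    have "(\<Sum>j<n. scale_osc (j + N) z) = (\<Sum>j\<in>{N..<N+n}. if N \<le> j then scale_osc j z else 0)"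
      by (rule sum.reindex_bij_witness[of _ "\<lambda>j. j - N" "\<lambda>j. j + N"]) auto
    also have "\<dots> \<le> (\<Sum>j. if N \<le> j then scale_osc j z else 0)"
      by (intro sum_le_suminf) auto
    finally show "(\<Sum>j<n. scale_osc (j + N) z) \<le> (\<Sum>j. if N \<le> j then scale_osc j z else 0)" .
  qed auto
  also have "\<dots> < \<infinity>"
    using suminf_scale_osc_le_pot assms by (rule le_less_trans)
  finally have fin: "(\<Sum>j. scale_osc (j + N) z) < \<infinity>" .
  define a where "a = (\<lambda>j. enn2real (scale_osc (j + N) z))"
  have lt: "scale_osc (j + N) z < \<infinity>" for j
    using ennreal_suminf_lessD[OF fin] .
  then have eq: "scale_osc (j + N) z = ennreal (a j)" for j
    by (simp add: a_def)
  have "summable a"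
    using fin unfolding eq by (intro summable_suminf_not_top) (auto simp: a_def)
  moreover have "0 \<le> a j" for j
    by (simp add: a_def)
  ultimately show ?thesis using eq by (rule that)
qed

text \<open>The averages at the scales \<open>rad j\<close> form a sequence of bounded variation.\<close>

lemma ball_average_tendsto:
  assumes "pot N z < \<infinity>"
  obtains L where "((\<lambda>r. ball_average f z r) \<longlongrightarrow> L) (at_right 0)"
proof -
  obtain a where a: "summable a" "\<And>j. 0 \<le> a j" "\<And>j. scale_osc (j + N) z = ennreal (a j)"
    using suminf_scale_osc_finite[OF assms] by metis
  \<comment> \<open>Every radius between two consecutive dyadic ones is compared with the larger, so
    that convergence along \<open>rad\<close> extends to all r tending to 0.\<close>
  have step: "\<bar>ball_average f z r - ball_average f z (rad (j + N))\<bar> \<le> avg_const * a j"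
    if "rad (Suc (j + N)) \<le> r" "r \<le> rad (j + N)" for r j
  proof -
    have "ennreal \<bar>ball_average f z r - ball_average f z (rad (j + N))\<bar> \<le> ennreal avg_const * scale_osc (j + N) z"
      using that by (intro ball_average_ball_average_le subset_ball) (auto simp: rad_Suc)
    also have "\<dots> = ennreal (avg_const * a j)"
      using a avg_const_pos by (simp add: ennreal_mult)
    finally show ?thesis
      using a avg_const_pos by (subst (asm) ennreal_le_iff) auto
  qed
  define b where "b = (\<lambda>j. ball_average f z (rad (j + N)))"
  have "summable (\<lambda>j. b (Suc j) - b j)"
  proof (rule summable_comparison_test')
    show "summable (\<lambda>j. avg_const * a j)" using a by (intro summable_mult)
    show "norm (b (Suc j) - b j) \<le> avg_const * a j" for j
      using step[of j "rad (Suc j + N)"] by (simp add: b_def rad_Suc)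
  qed
  then have "convergent (\<lambda>m. \<Sum>j<m. b (Suc j) - b j)"
    by (simp add: summable_iff_convergent)
  then have "convergent (\<lambda>m. (b m - b 0) + b 0)"
    unfolding sum_lessThan_telescope by (intro convergent_add convergent_const)
  then obtain L where L: "b \<longlonglongrightarrow> L" by (auto simp: convergent_def)
  have a0: "(\<lambda>j. avg_const * a j) \<longlonglongrightarrow> avg_const * 0"
    by (intro tendsto_intros summable_LIMSEQ_zero a)
  have "((\<lambda>r. ball_average f z r) \<longlongrightarrow> L) (at_right 0)"
  proof (rule tendstoI)
    fix e :: real assume e: "0 < e"
    have "eventually (\<lambda>j. dist (b j) L < e / 2 \<and> avg_const * a j < e / 2) sequentially"
      using tendstoD[OF L, of "e / 2"] order_tendstoD(2)[OF a0, of "e / 2"] e by (auto simp: eventually_conj_iff)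
    then obtain J where J: "\<And>j. J \<le> j \<Longrightarrow> dist (b j) L < e / 2" "\<And>j. J \<le> j \<Longrightarrow> avg_const * a j < e / 2"
      by (auto simp: eventually_sequentially)
    show "eventually (\<lambda>r. dist (ball_average f z r) L < e) (at_right 0)"
      unfolding eventually_at_right_field
    proof (intro exI conjI allI impI)
      show "0 < rad (J + N)" by simp
      fix r assume r: "0 < r" "r < rad (J + N)"
      have "r \<le> 1" using r rad_le_1[of "J + N"] by linarith
      then obtain i where i: "rad (Suc i) < r" "r \<le> rad i" using r rad_bracket by blast
      have "J + N \<le> i"
      proof (rule ccontr)
        assume "\<not> J + N \<le> i"
        then have "rad (J + N) \<le> rad (Suc i)" by (intro rad_mono) auto
        then show False using i r by linarith
      qed
      then obtain j where j: "i = j + N" "J \<le> j" by (metis le_add_diff_inverse2 add_leD2 add_le_imp_le_right)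
      then have "\<bar>ball_average f z r - b j\<bar> \<le> avg_const * a j"
        using step[of j r] i by (simp add: b_def)
      then show "dist (ball_average f z r) L < e"
        using J[OF j(2)] unfolding dist_real_def by linarith
    qed
  qed
  then show ?thesis by (rule that)
qed

text \<open>Bounded normalised oscillation is an averaged Hoelder condition at a single point. It
  holds almost everywhere and forces the averages to converge to f x at the rate r^\<theta>.\<close>

definition good_points :: "'a set" where
  "good_points = {x. \<exists>\<Gamma>. \<forall>j. osc 1 j x \<le> ennreal \<Gamma>}"

lemma AE_good_points: "AE x in lborel. x \<in> good_points"
proof -
  have "(\<integral>\<^sup>+x. (\<Sum>j. osc p j x) \<partial>lborel) = (\<Sum>j. osc_energy j)"
    unfolding osc_energy_def by (simp add: nn_integral_suminf)
  then have "AE x in lborel. (\<Sum>j. osc p j x) \<noteq> \<infinity>"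
    using suminf_osc_energy_finite by (intro nn_integral_PInf_AE) auto
  then show ?thesis
  proof eventually_elim
    case (elim x)
    then obtain S where S: "(\<Sum>j. osc p j x) = ennreal S" "0 \<le> S"
      by (cases "\<Sum>j. osc p j x") auto
    have "osc 1 j x \<le> ennreal (S + (p - 1) * (2 ^ DIM('a) * unit_ball_vol DIM('a)))" for j
    proof -
      have "osc p j x \<le> ennreal S"
        using sum_le_suminf[of "\<lambda>j. osc p j x" "{j}"] S by simp
      \<comment> \<open>The tangent inequality at s = 1 passes from exponent \<open>p\<close> to
        exponent 1.\<close>
      have "ennreal 1 * osc 1 j x \<le> ennreal (p * 1 powr (p - 1)) * osc 1 j x"
        using p_ge_1 by (intro mult_right_mono ennreal_leI) auto
      also have "\<dots> \<le> osc p j x + ennreal ((p - 1) * 1 powr p * (2 ^ DIM('a) * unit_ball_vol DIM('a)))"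
        by (rule osc_young) simp
      also have "\<dots> \<le> ennreal S + ennreal ((p - 1) * 1 powr p * (2 ^ DIM('a) * unit_ball_vol DIM('a)))"
        using \<open>osc p j x \<le> ennreal S\<close> by (rule add_right_mono)
      also have "\<dots> = ennreal (S + (p - 1) * (2 ^ DIM('a) * unit_ball_vol DIM('a)))"
        using S p_ge_1 by (subst ennreal_plus [symmetric]) auto
      finally show ?thesis by simp
    qed
    then show ?case by (auto simp: good_points_def)
  qed
qed

lemma ball_average_tendsto_good:
  assumes "x \<in> good_points"
  shows "((\<lambda>r. ball_average f x r) \<longlongrightarrow> f x) (at_right 0)"
proof -
  obtain \<Gamma>0 where "\<And>j. osc 1 j x \<le> ennreal \<Gamma>0"
    using assms by (auto simp: good_points_def)
  then obtain \<Gamma> where \<Gamma>: "\<And>j. osc 1 j x \<le> ennreal \<Gamma>" "0 \<le> \<Gamma>"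
    by (metis ennreal_eq_0_iff le_cases order_trans ennreal_leI ennreal_0)
  define \<omega> where "\<omega> = unit_ball_vol (real DIM('a))"
  have \<omega>: "0 < \<omega>" by (simp add: \<omega>_def)
  define C where "C = 2 ^ DIM('a) / \<omega> * \<Gamma>"
  have C: "0 \<le> C" using \<omega> \<Gamma> by (simp add: C_def)
  have bound: "\<bar>ball_average f x r - f x\<bar> \<le> C * (2 * r) powr \<theta>" if r: "0 < r" "r < 1" for r
  proof -
    obtain j where j: "rad (Suc j) < r" "r \<le> rad j"
      using rad_bracket[of r] r by auto
    have "ennreal \<bar>ball_average f x r - f x\<bar> \<le> ennreal (1 / (\<omega> * r ^ DIM('a))) *
      (\<integral>\<^sup>+z. ennreal \<bar>f z - f x\<bar> * near r x z \<partial>lborel)"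
      unfolding \<omega>_def using r by (intro ball_average_diff_le) auto
    also have "\<dots> \<le> ennreal (1 / (\<omega> * r ^ DIM('a))) * (\<integral>\<^sup>+z. ennreal \<bar>f x - f z\<bar> * near (2 * rad j) x z \<partial>lborel)"
      using j r by (intro mult_left_mono nn_integral_mono mult_mono) (auto simp: abs_minus_commute near_def)
    also have "\<dots> = ennreal (1 / (\<omega> * r ^ DIM('a))) * (ennreal (rad j powr \<theta> * rad j ^ DIM('a)) * osc 1 j x)"
      by (simp only: nn_integral_abs_diff_near)
    also have "\<dots> \<le> ennreal (1 / (\<omega> * r ^ DIM('a))) * (ennreal (rad j powr \<theta> * rad j ^ DIM('a)) * ennreal \<Gamma>)"
      by (intro mult_left_mono \<Gamma>) auto
    also have "\<dots> = ennreal (1 / (\<omega> * r ^ DIM('a)) * (rad j powr \<theta> * rad j ^ DIM('a) * \<Gamma>))"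
      using \<omega> \<Gamma> r by (intro ennreal_mult3) auto
    finally have "\<bar>ball_average f x r - f x\<bar> \<le> 1 / (\<omega> * r ^ DIM('a)) * (rad j powr \<theta> * rad j ^ DIM('a) * \<Gamma>)"
      using \<omega> \<Gamma> r by (subst (asm) ennreal_le_iff) auto
    also have "\<dots> \<le> 1 / (\<omega> * r ^ DIM('a)) * ((2 * r) powr \<theta> * (2 * r) ^ DIM('a) * \<Gamma>)"
      using j r \<omega> \<Gamma> \<theta>_pos
      by (intro mult_left_mono mult_right_mono mult_mono powr_mono2 power_mono) (auto simp: rad_Suc)
    also have "\<dots> = C * (2 * r) powr \<theta>"
      using r by (simp add: C_def power_mult_distrib)
    finally show ?thesis .
  qed
  have lim: "((\<lambda>r::real. C * (2 * r) powr \<theta>) \<longlongrightarrow> 0) (at_right 0)"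
  proof -
    have "((\<lambda>r::real. C * (2 * r) powr \<theta>) \<longlongrightarrow> C * (2 * 0) powr \<theta>) (at_right 0)"
      using \<theta>_pos by (intro tendsto_intros tendsto_powr') (auto simp: eventually_at_right_field intro!: exI[of _ 1])
    then show ?thesis by simp
  qed
  have "((\<lambda>r. ball_average f x r - f x) \<longlongrightarrow> 0) (at_right 0)"
  proof (rule Lim_null_comparison[OF _ lim])
    show "eventually (\<lambda>r. norm (ball_average f x r - f x) \<le> C * (2 * r) powr \<theta>) (at_right 0)"
      unfolding eventually_at_right_field using bound by (intro exI[of _ 1]) auto
  qed
  then show ?thesis by (simp add: LIM_zero_iff)
qed

section \<open>Hedberg's inequality and Lebesgue points\<close>

text \<open>\<open>jensen_scales\<close> for a kernel living on the single scale
  \<open>j\<close>.\<close>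

lemma scale_osc_powr_le:
  assumes "0 \<le> T" "ennreal T \<le> scale_osc j x"
  shows "ennreal (T powr p) \<le> ennreal ((2 ^ DIM('a) * unit_ball_vol DIM('a) ^ 2) powr (p - 1) *
     rad j powr (\<theta> * p) / rad j ^ DIM('a)) * osc_near (rad j) j x"
proof -
  define \<omega> where "\<omega> = unit_ball_vol (real DIM('a))"
  have \<omega>: "0 < \<omega>" by (simp add: \<omega>_def)
  define K where "K = (\<lambda>i y. if i = j then near (rad j) x y else 0)"
  have [measurable]: "K i \<in> borel_measurable borel" for i
    unfolding K_def by measurable
  have single: "(\<Sum>i. \<integral>\<^sup>+y. g i y * K i y \<partial>lborel) = (\<integral>\<^sup>+y. g j y * near (rad j) x y \<partial>lborel)" for g :: "nat \<Rightarrow> 'a \<Rightarrow> ennreal"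
    by (subst suminf_finite[of "{j}"]) (auto simp: K_def)
  let ?m = "\<omega> * rad j powr \<theta>"
  have "ennreal (T powr p) \<le> ennreal ((2 ^ DIM('a) * \<omega> * ?m) powr (p - 1)) *
    (\<Sum>i. \<integral>\<^sup>+y. ennreal (wt i) * (osc p i y * K i y) \<partial>lborel)"
    unfolding \<omega>_def
  proof (rule jensen_scales)
    show "ennreal T \<le> (\<Sum>i. \<integral>\<^sup>+y. ennreal (wt i) * (osc 1 i y * K i y) \<partial>lborel)"
      using assms(2) unfolding mult.assoc [symmetric] single by (simp add: scale_osc_def mult.assoc)
    have "(\<Sum>i. \<integral>\<^sup>+y. ennreal (wt i) * K i y \<partial>lborel) = ennreal (wt j) * ennreal (\<omega> * rad j ^ DIM('a))"
      unfolding single by (simp add: nn_integral_cmult nn_integral_near \<omega>_def)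
    also have "\<dots> = ennreal ?m"
      using \<omega> by (subst ennreal_mult [symmetric]) (auto simp: wt_def)
    finally show "(\<Sum>i. \<integral>\<^sup>+y. ennreal (wt i) * K i y \<partial>lborel) \<le> ennreal (unit_ball_vol DIM('a) * rad j powr \<theta>)"
      by (simp add: \<omega>_def)
  qed (use assms(1) in auto)
  also have "(\<Sum>i. \<integral>\<^sup>+y. ennreal (wt i) * (osc p i y * K i y) \<partial>lborel) = ennreal (wt j) * osc_near (rad j) j x"
    unfolding mult.assoc [symmetric] single osc_near_def by (simp add: nn_integral_cmult mult.assoc)
  also have "ennreal ((2 ^ DIM('a) * \<omega> * ?m) powr (p - 1)) * (ennreal (wt j) * osc_near (rad j) j x) =
    ennreal ((2 ^ DIM('a) * \<omega> * ?m) powr (p - 1) * wt j) * osc_near (rad j) j x"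
    by (simp add: ennreal_mult mult.assoc)
  also have "(2 ^ DIM('a) * \<omega> * ?m) powr (p - 1) * wt j =
     (2 ^ DIM('a) * \<omega> ^ 2) powr (p - 1) * rad j powr (\<theta> * p) / rad j ^ DIM('a)"
  proof -
    have "2 ^ DIM('a) * \<omega> * ?m = (2 ^ DIM('a) * \<omega> ^ 2) * rad j powr \<theta>"
      by (simp add: power2_eq_square)
    then have "(2 ^ DIM('a) * \<omega> * ?m) powr (p - 1) = (2 ^ DIM('a) * \<omega> ^ 2) powr (p - 1) * rad j powr (\<theta> * (p - 1))"
      using \<omega> by (simp only: powr_mult powr_powr)
    moreover have "rad j powr (\<theta> * p) = rad j powr (\<theta> * (p - 1)) * rad j powr \<theta>"
      by (simp add: powr_add [symmetric] algebra_simps)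
    ultimately show ?thesis by (simp add: wt_def)
  qed
  finally show ?thesis by (simp add: \<omega>_def)
qed

definition hedberg_const :: real where
  "hedberg_const = ((2 ^ DIM('a) * unit_ball_vol DIM('a) ^ 2) powr (p - 1)) powr (1 / p)"

text \<open>The p-th root of the preceding bound. Since \<open>scale_osc j x\<close> may be
  infinite, the contradiction uses a real \<open>T\<close> above the claimed bound and at most
  \<open>scale_osc j x\<close>.\<close>

lemma scale_osc_le:
  assumes b: "ennreal (1 / rad j ^ DIM('a)) * osc_near (rad j) j x \<le> ennreal b" and "0 \<le> b"
  shows "scale_osc j x \<le> ennreal (hedberg_const * rad j powr \<theta> * b powr (1 / p))"
proof (rule ccontr)
  define A where "A = (2 ^ DIM('a) * unit_ball_vol (real DIM('a)) ^ 2) powr (p - 1)"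
  have A: "0 \<le> A" by (simp add: A_def)
  define c where "c = hedberg_const * rad j powr \<theta> * b powr (1 / p)"
  have c: "0 \<le> c" by (simp add: c_def hedberg_const_def)
  assume "\<not> scale_osc j x \<le> ennreal (hedberg_const * rad j powr \<theta> * b powr (1 / p))"
  then have gr: "ennreal c < scale_osc j x" by (simp add: c_def)
  obtain T where T: "c < T" "ennreal T \<le> scale_osc j x"
  proof (cases "scale_osc j x")
    case (real t)
    then show ?thesis using gr c by (intro that[of t]) (auto simp: ennreal_less_iff)
  next
    case top
    then show ?thesis by (intro that[of "c + 1"]) auto
  qed
  have "ennreal (T powr p) \<le> ennreal (A * rad j powr (\<theta> * p) / rad j ^ DIM('a)) * osc_near (rad j) j x"
    using scale_osc_powr_le[of T j x] T c by (simp add: A_def)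
  also have "\<dots> = ennreal (A * rad j powr (\<theta> * p)) * (ennreal (1 / rad j ^ DIM('a)) * osc_near (rad j) j x)"
  proof -
    have "ennreal (A * rad j powr (\<theta> * p) / rad j ^ DIM('a)) = ennreal (A * rad j powr (\<theta> * p)) * ennreal (1 / rad j ^ DIM('a))"
      using A by (subst ennreal_mult [symmetric]) auto
    then show ?thesis by (simp only: mult.assoc)
  qed
  also have "\<dots> \<le> ennreal (A * rad j powr (\<theta> * p)) * ennreal b"
    by (intro mult_left_mono b) auto
  also have "\<dots> = ennreal (A * rad j powr (\<theta> * p) * b)"
    using A \<open>0 \<le> b\<close> by (intro ennreal_mult [symmetric]) auto
  also have "A * rad j powr (\<theta> * p) * b = c powr p"
  proof -
    have "hedberg_const = A powr (1 / p)"
      by (simp only: hedberg_const_def A_def)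
    then show ?thesis
      using p_ge_1 \<open>0 \<le> b\<close> A by (simp add: c_def powr_mult powr_powr)
  qed
  finally have "T powr p \<le> c powr p"
    by (subst (asm) ennreal_le_iff) auto
  moreover have "c powr p < T powr p"
    using T c p_ge_1 by (intro powr_less_mono2) auto
  ultimately show False by simp
qed

text \<open>Takes the place of the Hardy-Littlewood maximal function in Hedberg's argument: a sum
  over scales instead of a supremum, so that Tonelli controls its integral directly.\<close>

definition maximal_energy :: "nat \<Rightarrow> 'a \<Rightarrow> ennreal" where
  "maximal_energy k x = (\<Sum>j. if k \<le> j then ennreal (1 / rad j ^ DIM('a)) * osc_near (rad j) j x else 0)"

lemma maximal_energy_measurable [measurable]: "maximal_energy k \<in> borel_measurable borel"
  unfolding maximal_energy_def by measurable

text \<open>Integrating over x first gives the volume of a ball of radius \<open>rad j\<close>,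
  which cancels the denominator, and y stays within \<open>rad j + rad k\<close>, at most
  \<open>2 * rad k\<close>, of z.\<close>

lemma nn_integral_maximal_energy_le:
  "(\<integral>\<^sup>+x. maximal_energy k x * near (rad k) z x \<partial>lborel) \<le> ennreal (unit_ball_vol DIM('a)) * local_energy k z"
proof -
  have "(\<integral>\<^sup>+x. maximal_energy k x * near (rad k) z x \<partial>lborel) =
    (\<integral>\<^sup>+x. (\<Sum>j. (if k \<le> j then ennreal (1 / rad j ^ DIM('a)) * osc_near (rad j) j x else 0) * near (rad k) z x) \<partial>lborel)"
    unfolding maximal_energy_def ennreal_suminf_multc by (rule refl)
  also have "\<dots> = (\<Sum>j. \<integral>\<^sup>+x. (if k \<le> j then ennreal (1 / rad j ^ DIM('a)) * osc_near (rad j) j x else 0) * near (rad k) z x \<partial>lborel)"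
    by (rule nn_integral_suminf) measurable
  also have "\<dots> \<le> (\<Sum>j. ennreal (unit_ball_vol DIM('a)) * (if k \<le> j then osc_near (2 * rad k) j z else 0))"
  proof (intro suminf_le)
    fix j
    show "(\<integral>\<^sup>+x. (if k \<le> j then ennreal (1 / rad j ^ DIM('a)) * osc_near (rad j) j x else 0) * near (rad k) z x \<partial>lborel)
      \<le> ennreal (unit_ball_vol DIM('a)) * (if k \<le> j then osc_near (2 * rad k) j z else 0)"
    proof (cases "k \<le> j")
      case True
      have near_le: "near (rad j) x y * near (rad k) z x \<le> near (2 * rad k) z y * near (rad j) y x" for x y
      proof (cases "dist x y < rad j \<and> dist z x < rad k")
        case True
        then have "dist z y < rad k + rad k"
          using rad_mono[OF \<open>k \<le> j\<close>] by (intro dist_triangle_less_add[of z x]) (auto simp: dist_commute)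
        then show ?thesis using True by (simp add: near_def dist_commute)
      qed (auto simp: near_def)
      have "(\<integral>\<^sup>+x. (ennreal (1 / rad j ^ DIM('a)) * osc_near (rad j) j x) * near (rad k) z x \<partial>lborel) =
        ennreal (1 / rad j ^ DIM('a)) * (\<integral>\<^sup>+x. osc_near (rad j) j x * near (rad k) z x \<partial>lborel)"
        unfolding mult.assoc by (rule nn_integral_cmult) measurable
      also have "(\<integral>\<^sup>+x. osc_near (rad j) j x * near (rad k) z x \<partial>lborel) =
        (\<integral>\<^sup>+x. \<integral>\<^sup>+y. osc p j y * near (rad j) x y * near (rad k) z x \<partial>lborel \<partial>lborel)"
        unfolding osc_near_def by (intro nn_integral_cong nn_integral_multc [symmetric]) measurable
      also have "\<dots> = (\<integral>\<^sup>+y. \<integral>\<^sup>+x. osc p j y * near (rad j) x y * near (rad k) z x \<partial>lborel \<partial>lborel)"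
        by (rule lborel_pair.Fubini') measurable
      also have "\<dots> \<le> (\<integral>\<^sup>+y. \<integral>\<^sup>+x. osc p j y * near (2 * rad k) z y * near (rad j) y x \<partial>lborel \<partial>lborel)"
        unfolding mult.assoc by (intro nn_integral_mono mult_left_mono near_le) auto
      also have "\<dots> = (\<integral>\<^sup>+y. osc p j y * near (2 * rad k) z y * ennreal (unit_ball_vol DIM('a) * rad j ^ DIM('a)) \<partial>lborel)"
        by (intro nn_integral_cong) (simp add: nn_integral_cmult nn_integral_near)
      also have "\<dots> = osc_near (2 * rad k) j z * ennreal (unit_ball_vol DIM('a) * rad j ^ DIM('a))"
        unfolding osc_near_def by (rule nn_integral_multc) measurable
      finally have "(\<integral>\<^sup>+x. (ennreal (1 / rad j ^ DIM('a)) * osc_near (rad j) j x) * near (rad k) z x \<partial>lborel)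
        \<le> ennreal (1 / rad j ^ DIM('a)) * (osc_near (2 * rad k) j z * ennreal (unit_ball_vol DIM('a) * rad j ^ DIM('a)))"
        by (simp add: mult_left_mono)
      also have "\<dots> = (ennreal (1 / rad j ^ DIM('a)) * ennreal (unit_ball_vol DIM('a) * rad j ^ DIM('a))) * osc_near (2 * rad k) j z"
        by (simp only: mult_ac)
      also have "ennreal (1 / rad j ^ DIM('a)) * ennreal (unit_ball_vol DIM('a) * rad j ^ DIM('a)) = ennreal (unit_ball_vol DIM('a))"
        by (subst ennreal_mult [symmetric]) auto
      finally show ?thesis using True by simp
    qed simp
  qed auto
  also have "\<dots> = ennreal (unit_ball_vol DIM('a)) * local_energy k z"
    unfolding local_energy_def by (rule ennreal_suminf_cmult)
  finally show ?thesis .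
qed

section \<open>The fractional Sobolev-Poincare inequality\<close>

definition sobolev_exponent :: real where
  "sobolev_exponent = real DIM('a) * p / (real DIM('a) - p * \<theta>)"

lemma sobolev_exponent_pos: "0 < sobolev_exponent"
  using p_ge_1 p\<theta>_less by (auto simp: sobolev_exponent_def intro!: divide_pos_pos mult_pos_pos)

text \<open>At a good point f x is the limit of the averages, so telescoping from scale
  \<open>k\<close> on bounds its distance to the average at scale \<open>k\<close>.\<close>

lemma good_ball_average_le:
  assumes "x \<in> good_points"
  shows "ennreal \<bar>f x - ball_average f x (rad k)\<bar> \<le> ennreal avg_const * (\<Sum>j. if k \<le> j then scale_osc j x else 0)"
    (is "_ \<le> ?S")
proof -
  have partial: "ennreal \<bar>ball_average f x (rad (k + m)) - ball_average f x (rad k)\<bar> \<le>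
    ennreal avg_const * (\<Sum>j\<in>{k..<k+m}. if k \<le> j then scale_osc j x else 0)" for m
  proof (induction m)
    case (Suc m)
    have "ennreal \<bar>ball_average f x (rad (k + Suc m)) - ball_average f x (rad k)\<bar> \<le>
      ennreal (\<bar>ball_average f x (rad (k + Suc m)) - ball_average f x (rad (k + m))\<bar> +
       \<bar>ball_average f x (rad (k + m)) - ball_average f x (rad k)\<bar>)"
      by (intro ennreal_leI) linarith
    also have "\<dots> = ennreal \<bar>ball_average f x (rad (k + Suc m)) - ball_average f x (rad (k + m))\<bar> +
       ennreal \<bar>ball_average f x (rad (k + m)) - ball_average f x (rad k)\<bar>"
      by (intro ennreal_plus) auto
    also have "\<dots> \<le> ennreal avg_const * scale_osc (k + m) x +
        ennreal avg_const * (\<Sum>j\<in>{k..<k+m}. if k \<le> j then scale_osc j x else 0)"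
      by (intro add_mono Suc.IH ball_average_ball_average_le subset_ball) (auto simp: rad_Suc)
    also have "\<dots> = ennreal avg_const * (\<Sum>j\<in>{k..<k+Suc m}. if k \<le> j then scale_osc j x else 0)"
      by (simp add: distrib_left [symmetric] add.commute)
    finally show ?case .
  qed simp
  have "(\<lambda>m. ball_average f x (rad (m + k))) \<longlonglongrightarrow> f x"
  proof (rule LIMSEQ_ignore_initial_segment)
    show "(\<lambda>m. ball_average f x (rad m)) \<longlonglongrightarrow> f x"
      using ball_average_tendsto_good[OF assms]
      by (rule filterlim_compose) (auto simp: filterlim_at rad_tendsto_0)
  qed
  then have lim: "(\<lambda>m. ennreal \<bar>ball_average f x (rad (m + k)) - ball_average f x (rad k)\<bar>)
      \<longlonglongrightarrow> ennreal \<bar>f x - ball_average f x (rad k)\<bar>"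
    by (intro tendsto_ennrealI tendsto_intros)
  show ?thesis
  proof (rule LIMSEQ_le_const2[OF lim], intro exI allI impI)
    fix m
    have "ennreal \<bar>ball_average f x (rad (m + k)) - ball_average f x (rad k)\<bar> \<le>
      ennreal avg_const * (\<Sum>j\<in>{k..<k+m}. if k \<le> j then scale_osc j x else 0)"
      using partial[of m] by (simp add: add.commute)
    also have "\<dots> \<le> ?S"
      by (intro mult_left_mono sum_le_suminf) auto
    finally show "ennreal \<bar>ball_average f x (rad (m + k)) - ball_average f x (rad k)\<bar> \<le> ?S" .
  qed
qed

text \<open>Hedberg's trick: the oscillations at small scales are controlled by \<open>maximal_energy\<close>, those at
  large scales by \<open>local_energy\<close>; the two geometric series balance at an intermediate scale.\<close>

lemma hedberg:
  obtains C where "0 \<le> C" "\<And>x z k \<Lambda>. x \<in> good_points \<Longrightarrow> dist z x < rad k \<Longrightarrow> 0 \<le> \<Lambda> \<Longrightarrow> local_energy k z = ennreal \<Lambda> \<Longrightarrow>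
    ennreal (\<bar>f x - ball_average f x (rad k)\<bar> powr sobolev_exponent) \<le>
      ennreal (C * \<Lambda> powr (\<theta> * sobolev_exponent / real DIM('a))) * maximal_energy k x"
proof -
  define n where "n = real DIM('a)"
  define q where "q = sobolev_exponent"
  \<comment> \<open>The bound by \<open>\<Lambda>\<close> makes \<open>scale_osc j\<close> at most
    of order \<open>rad j powr (\<theta> - n / p)\<close>; this improves towards large scales
    because p\<theta> < n.\<close>
  define \<beta> where "\<beta> = n / p - \<theta>"
  have n: "0 < n" by (simp add: n_def)
  have q: "0 < q" unfolding q_def by (rule sobolev_exponent_pos)
  have p: "0 < p" using p_ge_1 by simp
  have \<beta>: "0 < \<beta>"
    using p p\<theta>_less by (simp add: \<beta>_def n_def field_simps)
  have q\<beta>: "q * \<beta> = n"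
  proof -
    have "\<beta> = (n - p * \<theta>) / p" using p by (simp add: \<beta>_def diff_divide_distrib)
    then show ?thesis using p p\<theta>_less by (simp add: q_def sobolev_exponent_def n_def)
  qed
  have sum: "\<theta> + \<beta> = n / p" by (simp add: \<beta>_def)
  define G where "G = 1 / (1 - 2 powr -\<theta>) + 1 / (1 - 2 powr -\<beta>)"
  have G: "0 < G"
    using \<theta>_pos \<beta> powr_less_one[of 2 "-\<theta>"] powr_less_one[of 2 "-\<beta>"]
    by (auto simp: G_def intro!: add_pos_pos)
  have h: "0 \<le> hedberg_const" by (simp add: hedberg_const_def)
  define C0 where "C0 = avg_const * hedberg_const * G"
  have C0: "0 \<le> C0" using G h avg_const_pos by (simp add: C0_def)
  show ?thesis
  proof
    show "0 \<le> C0 powr q" by simp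
    fix x z k \<Lambda>
    assume good: "x \<in> good_points" and dist: "dist z x < rad k" and \<Lambda>: "0 \<le> \<Lambda>" "local_energy k z = ennreal \<Lambda>"
    have b_le_\<Lambda>: "osc_near (rad j) j x \<le> ennreal \<Lambda>" if "k \<le> j" for j
    proof -
      have "osc_near (rad j) j x \<le> osc_near (2 * rad k) j z"
        unfolding osc_near_def
      proof (intro nn_integral_mono mult_left_mono)
        fix y
        have "dist z y < rad k + rad k" if "dist x y < rad j"
          using that dist rad_mono[OF \<open>k \<le> j\<close>] by (intro dist_triangle_less_add[of z x]) (auto simp: dist_commute)
        then show "near (rad j) x y \<le> near (2 * rad k) z y"
          by (auto simp: near_def)
      qed simp
      also have "\<dots> = (\<Sum>i\<in>{j}. if k \<le> i then osc_near (2 * rad k) i z else 0)"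
        using that by simp
      also have "\<dots> \<le> local_energy k z"
        unfolding local_energy_def by (intro sum_le_suminf) auto
      finally show ?thesis by (simp add: \<Lambda>)
    qed
    show "ennreal (\<bar>f x - ball_average f x (rad k)\<bar> powr sobolev_exponent) \<le>
      ennreal (C0 powr q * \<Lambda> powr (\<theta> * sobolev_exponent / real DIM('a))) * maximal_energy k x"
    proof (cases "maximal_energy k x")
      \<comment> \<open>An infinite \<open>maximal_energy\<close> makes the right-hand side infinite
        unless \<open>\<Lambda> = 0\<close>; but then every \<open>osc_near\<close> term vanishes,
        and \<open>maximal_energy\<close> with it.\<close>
      case top
      show ?thesis
      proof (cases "\<Lambda> = 0 \<or> C0 = 0")
        case False
        then have "0 < C0 powr q * \<Lambda> powr (\<theta> * sobolev_exponent / real DIM('a))"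
          using \<Lambda> C0 by simp
        then show ?thesis by (simp only: top ennreal_mult_top ennreal_eq_0_iff not_le [symmetric] top_greatest) simp
      next
        case True
        have "maximal_energy k x = 0" if "\<Lambda> = 0"
        proof -
          have "(if k \<le> j then ennreal (1 / rad j ^ DIM('a)) * osc_near (rad j) j x else 0) = 0" for j
            using b_le_\<Lambda>[of j] that by auto
          then show ?thesis unfolding maximal_energy_def by (simp only: suminf_zero)
        qed
        then have "C0 = 0" using True top by auto
        then have False using G avg_const_pos unit_ball_vol_pos[of "real DIM('a)"]
          by (simp add: C0_def hedberg_const_def)
        then show ?thesis ..
      qed
    next
      case (real M)
      have b_le_M: "ennreal (1 / rad j ^ DIM('a)) * osc_near (rad j) j x \<le> ennreal M" if "k \<le> j" for j
      proof -
        have "ennreal (1 / rad j ^ DIM('a)) * osc_near (rad j) j x =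
          (\<Sum>i\<in>{j}. if k \<le> i then ennreal (1 / rad i ^ DIM('a)) * osc_near (rad i) i x else 0)"
          using that by simp
        also have "\<dots> \<le> maximal_energy k x"
          unfolding maximal_energy_def by (intro sum_le_suminf) auto
        finally show ?thesis by (simp add: real)
      qed
      have term_le: "scale_osc j x \<le> ennreal hedberg_const * ennreal (min (M powr (1 / p) * rad j powr \<theta>) (\<Lambda> powr (1 / p) * rad j powr - \<beta>))"
        if "k \<le> j" for j
      proof -
        let ?b = "min M (\<Lambda> / rad j ^ DIM('a))"
        have b: "0 \<le> ?b" using real \<Lambda> by simp
        have "ennreal (1 / rad j ^ DIM('a)) * osc_near (rad j) j x \<le> ennreal (1 / rad j ^ DIM('a)) * ennreal \<Lambda>"
          by (intro mult_left_mono b_le_\<Lambda> that) auto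
        also have "\<dots> = ennreal (\<Lambda> / rad j ^ DIM('a))"
          using \<Lambda> by (subst ennreal_mult [symmetric]) auto
        finally have "ennreal (1 / rad j ^ DIM('a)) * osc_near (rad j) j x \<le> ennreal ?b"
          using b_le_M[OF that] by (simp add: min_def)
        then have "scale_osc j x \<le> ennreal (hedberg_const * rad j powr \<theta> * ?b powr (1 / p))"
          using b by (rule scale_osc_le)
        also have "?b powr (1 / p) = min (M powr (1 / p)) ((\<Lambda> / rad j ^ DIM('a)) powr (1 / p))"
          using real \<Lambda> p powr_mono2[of "1 / p" M "\<Lambda> / rad j ^ DIM('a)"] powr_mono2[of "1 / p" "\<Lambda> / rad j ^ DIM('a)" M]
          by (auto simp: min_def)
        also have "(\<Lambda> / rad j ^ DIM('a)) powr (1 / p) = \<Lambda> powr (1 / p) * rad j powr - (n / p)"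
          using \<Lambda> by (simp add: powr_divide n_def powr_realpow [symmetric] powr_powr powr_minus_divide)
        also have "hedberg_const * rad j powr \<theta> * min (M powr (1 / p)) (\<Lambda> powr (1 / p) * rad j powr - (n / p)) =
          hedberg_const * min (M powr (1 / p) * rad j powr \<theta>) (\<Lambda> powr (1 / p) * rad j powr - \<beta>)"
        proof -
          have "rad j powr - \<beta> = rad j powr \<theta> * rad j powr - (n / p)"
            by (simp add: \<beta>_def powr_add [symmetric])
          then have "rad j powr \<theta> * min (M powr (1 / p)) (\<Lambda> powr (1 / p) * rad j powr - (n / p)) =
            min (M powr (1 / p) * rad j powr \<theta>) (\<Lambda> powr (1 / p) * rad j powr - \<beta>)"
            by (simp add: min_mult_distrib_left mult_ac)
          then show ?thesis by simp
        qed
        also have "ennreal (hedberg_const * min (M powr (1 / p) * rad j powr \<theta>) (\<Lambda> powr (1 / p) * rad j powr - \<beta>)) =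
          ennreal hedberg_const * ennreal (min (M powr (1 / p) * rad j powr \<theta>) (\<Lambda> powr (1 / p) * rad j powr - \<beta>))"
          using h by (intro ennreal_mult) auto
        finally show ?thesis .
      qed
      define V where "V = (M powr (1 / p)) powr (\<beta> / (\<theta> + \<beta>)) * (\<Lambda> powr (1 / p)) powr (\<theta> / (\<theta> + \<beta>))"
      have V: "0 \<le> V" by (simp add: V_def)
      have "(\<Sum>j. if k \<le> j then scale_osc j x else 0) \<le>
        (\<Sum>j. ennreal hedberg_const * ennreal (min (M powr (1 / p) * rad j powr \<theta>) (\<Lambda> powr (1 / p) * rad j powr - \<beta>)))"
        using term_le by (intro suminf_le) auto
      also have "\<dots> = ennreal hedberg_const * (\<Sum>j. ennreal (min (M powr (1 / p) * rad j powr \<theta>) (\<Lambda> powr (1 / p) * rad j powr - \<beta>)))"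
        by (rule ennreal_suminf_cmult)
      also have "\<dots> \<le> ennreal hedberg_const * ennreal (G * V)"
        unfolding G_def V_def using \<theta>_pos \<beta> by (intro mult_left_mono suminf_min_geometric) auto
      finally have S_le: "(\<Sum>j. if k \<le> j then scale_osc j x else 0) \<le> ennreal hedberg_const * ennreal (G * V)" .
      have "ennreal \<bar>f x - ball_average f x (rad k)\<bar> \<le> ennreal avg_const * (\<Sum>j. if k \<le> j then scale_osc j x else 0)"
        by (rule good_ball_average_le[OF good])
      also have "\<dots> \<le> ennreal avg_const * (ennreal hedberg_const * ennreal (G * V))"
        by (intro mult_left_mono S_le) auto
      also have "\<dots> = ennreal (avg_const * (hedberg_const * (G * V)))"
        using avg_const_pos h G V by (intro ennreal_mult3) auto
      also have "avg_const * (hedberg_const * (G * V)) = C0 * V"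
        by (simp add: C0_def)
      finally have "\<bar>f x - ball_average f x (rad k)\<bar> \<le> C0 * V"
        using C0 V by (subst (asm) ennreal_le_iff) auto
      then have "\<bar>f x - ball_average f x (rad k)\<bar> powr q \<le> (C0 * V) powr q"
        using q by (intro powr_mono2) auto
      also have "\<dots> = C0 powr q * \<Lambda> powr (\<theta> * q / n) * M"
      proof -
        \<comment> \<open>The value of \<open>q\<close> makes \<open>maximal_energy\<close> enter to
          the power 1, so that its integral is all that is needed later.\<close>
        have e1: "1 / p * (\<beta> / (\<theta> + \<beta>)) * q = 1"
          unfolding sum using p n q\<beta> by (simp add: field_simps)
        have e2: "1 / p * (\<theta> / (\<theta> + \<beta>)) * q = \<theta> * q / n"
          unfolding sum using p n by (simp add: field_simps)
        have "V powr q = M powr (1 / p * (\<beta> / (\<theta> + \<beta>)) * q) * \<Lambda> powr (1 / p * (\<theta> / (\<theta> + \<beta>)) * q)"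
          by (simp only: V_def powr_mult powr_powr powr_ge_zero)
        also have "\<dots> = M * \<Lambda> powr (\<theta> * q / n)"
          unfolding e1 e2 using real by simp
        finally show ?thesis using C0 V by (simp add: powr_mult)
      qed
      finally have "ennreal (\<bar>f x - ball_average f x (rad k)\<bar> powr q) \<le> ennreal (C0 powr q * \<Lambda> powr (\<theta> * q / n) * M)"
        by (rule ennreal_leI)
      also have "\<dots> = ennreal (C0 powr q * \<Lambda> powr (\<theta> * q / n)) * ennreal M"
        using real by (intro ennreal_mult) auto
      finally show ?thesis by (simp only: real q_def n_def)
    qed
  qed
qed

text \<open>The average is centred at the moving point x, as Hedberg's inequality provides it;
  comparison with averages about z is left to \<open>lebesgue_point\<close>. Integration adds one
  power of \<open>\<Lambda>\<close>, and \<theta>q/n + 1 = q/p.\<close>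

lemma sobolev_poincare:
  obtains C where "0 \<le> C" "\<And>z k \<Lambda>. 0 \<le> \<Lambda> \<Longrightarrow> local_energy k z = ennreal \<Lambda> \<Longrightarrow>
    (\<integral>\<^sup>+x. ennreal (\<bar>f x - ball_average f x (rad k)\<bar> powr sobolev_exponent) * near (rad k) z x \<partial>lborel)
      \<le> ennreal (C * \<Lambda> powr (sobolev_exponent / p))"
proof -
  obtain C where C: "0 \<le> C" "\<And>x z k \<Lambda>. x \<in> good_points \<Longrightarrow> dist z x < rad k \<Longrightarrow> 0 \<le> \<Lambda> \<Longrightarrow> local_energy k z = ennreal \<Lambda> \<Longrightarrow>
    ennreal (\<bar>f x - ball_average f x (rad k)\<bar> powr sobolev_exponent) \<le>
      ennreal (C * \<Lambda> powr (\<theta> * sobolev_exponent / real DIM('a))) * maximal_energy k x"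
    by (rule hedberg) (rule that)
  show ?thesis
  proof
    show "0 \<le> C * unit_ball_vol DIM('a)" using C by simp
    fix z k \<Lambda> assume \<Lambda>: "0 \<le> \<Lambda>" "local_energy k z = ennreal \<Lambda>"
    let ?c = "C * \<Lambda> powr (\<theta> * sobolev_exponent / real DIM('a))"
    have "(\<integral>\<^sup>+x. ennreal (\<bar>f x - ball_average f x (rad k)\<bar> powr sobolev_exponent) * near (rad k) z x \<partial>lborel) \<le>
      (\<integral>\<^sup>+x. ennreal ?c * (maximal_energy k x * near (rad k) z x) \<partial>lborel)"
    proof (rule nn_integral_mono_AE)
      show "AE x in lborel. ennreal (\<bar>f x - ball_average f x (rad k)\<bar> powr sobolev_exponent) * near (rad k) z x
        \<le> ennreal ?c * (maximal_energy k x * near (rad k) z x)"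
        using AE_good_points
      proof eventually_elim
        case (elim x)
        then show ?case
          using C(2)[OF elim _ \<Lambda>] by (auto simp: near_def)
      qed
    qed
    also have "\<dots> = ennreal ?c * (\<integral>\<^sup>+x. maximal_energy k x * near (rad k) z x \<partial>lborel)"
      by (rule nn_integral_cmult) measurable
    also have "\<dots> \<le> ennreal ?c * (ennreal (unit_ball_vol DIM('a)) * local_energy k z)"
      by (intro mult_left_mono nn_integral_maximal_energy_le) auto
    also have "\<dots> = ennreal (?c * (unit_ball_vol DIM('a) * \<Lambda>))"
      unfolding \<Lambda>(2) using C \<Lambda> by (intro ennreal_mult3) auto
    also have "?c * (unit_ball_vol DIM('a) * \<Lambda>) = C * unit_ball_vol DIM('a) * \<Lambda> powr (sobolev_exponent / p)"
    proof (cases "\<Lambda> = 0")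
      case False
      have "\<theta> * sobolev_exponent / real DIM('a) + 1 = sobolev_exponent / p"
        using p_ge_1 p\<theta>_less by (simp add: sobolev_exponent_def field_simps)
      then have "\<Lambda> powr (sobolev_exponent / p) = \<Lambda> powr (\<theta> * sobolev_exponent / real DIM('a)) * \<Lambda> powr 1"
        by (simp only: powr_add [symmetric])
      then show ?thesis using \<Lambda> by simp
    qed (use sobolev_exponent_pos p_ge_1 in simp)
    finally show "(\<integral>\<^sup>+x. ennreal (\<bar>f x - ball_average f x (rad k)\<bar> powr sobolev_exponent) * near (rad k) z x \<partial>lborel)
      \<le> ennreal (C * unit_ball_vol DIM('a) * \<Lambda> powr (sobolev_exponent / p))" .
  qed
qed

lemma local_energy_finite: "local_energy k z < \<infinity>"
proof -
  have "local_energy k z \<le> emeasure (density lborel (energy_density k)) (ball z (2 * rad k))"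
    by (rule local_energy_le) simp
  also have "\<dots> \<le> emeasure (density lborel (energy_density k)) UNIV"
    by (intro emeasure_mono) auto
  also have "\<dots> = tail k"
    by (simp add: emeasure_density nn_integral_energy_density)
  also have "\<dots> \<le> (\<Sum>j. osc_energy j)"
    unfolding tail_def by (intro suminf_le) auto
  also have "\<dots> < \<infinity>" by (rule suminf_osc_energy_finite)
  finally show ?thesis .
qed

text \<open>|f x - L| is split at the average of f over B(x, rad k) and at its average over the ball
  about z one scale coarser. The first piece is controlled by \<open>sobolev_poincare\<close>, the
  second by \<open>scale_osc\<close> at z, the third by the convergence to \<open>L\<close>.\<close>

lemma lebesgue_point:
  assumes pot: "pot N z < \<infinity>"
    and energy: "(\<lambda>k. ennreal (rad k powr (p * \<theta> - real DIM('a))) * local_energy k z) \<longlonglongrightarrow> 0"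
    and L: "((\<lambda>r. ball_average f z r) \<longlongrightarrow> L) (at_right 0)"
  shows "((\<lambda>r. (\<integral>\<^sup>+x. ennreal (\<bar>f x - L\<bar> powr sobolev_exponent) * near r z x \<partial>lborel) /
    ennreal (unit_ball_vol DIM('a) * r ^ DIM('a))) \<longlongrightarrow> 0) (at_right 0)"
proof -
  define q where "q = sobolev_exponent"
  have q: "0 < q" unfolding q_def by (rule sobolev_exponent_pos)
  have p: "0 < p" using p_ge_1 by simp
  define n where "n = DIM('a)"
  define \<omega> where "\<omega> = unit_ball_vol (real n)"
  have \<omega>: "0 < \<omega>" by (simp add: \<omega>_def)
  obtain a where a: "summable a" "\<And>j. 0 \<le> a j" "\<And>j. scale_osc (j + N) z = ennreal (a j)"
    using suminf_scale_osc_finite[OF pot] by metis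
  obtain C where "0 \<le> C" and "\<And>z k \<Lambda>. 0 \<le> \<Lambda> \<Longrightarrow> local_energy k z = ennreal \<Lambda> \<Longrightarrow>
    (\<integral>\<^sup>+x. ennreal (\<bar>f x - ball_average f x (rad k)\<bar> powr sobolev_exponent) * near (rad k) z x \<partial>lborel)
      \<le> ennreal (C * \<Lambda> powr (sobolev_exponent / p))"
    by (rule sobolev_poincare) (rule that)
  note C = this [folded q_def]
  define \<Lambda> where "\<Lambda> = (\<lambda>k. enn2real (local_energy k z))"
  have \<Lambda>: "0 \<le> \<Lambda> k" "local_energy k z = ennreal (\<Lambda> k)" for k
    using local_energy_finite[of k z] by (simp_all add: \<Lambda>_def)
  \<comment> \<open>Since (p\<theta> - n) q / p = -n, \<open>rad k ^ n * t k powr (q / p)\<close>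
    equals \<open>\<Lambda> k powr (q / p)\<close>: the density scales as the mean over the ball
    requires.\<close>
  define t where "t = (\<lambda>k. rad k powr (p * \<theta> - real n) * \<Lambda> k)"
  have t_nonneg: "0 \<le> t k" for k using \<Lambda> by (simp add: t_def)
  have t: "t \<longlonglongrightarrow> 0"
  proof -
    have "(\<lambda>k. ennreal (t k)) \<longlonglongrightarrow> ennreal 0"
      using energy by (simp add: t_def n_def \<Lambda> ennreal_mult)
    then show ?thesis
      by (subst (asm) tendsto_ennreal_iff) (auto simp: t_nonneg)
  qed
  define b where "b = (\<lambda>j. avg_const * a j + \<bar>ball_average f z (rad (j + N)) - L\<bar>)"
  have b_nonneg: "0 \<le> b j" for j
    using a avg_const_pos by (simp add: b_def)
  have b: "b \<longlonglongrightarrow> 0"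
  proof -
    have "(\<lambda>j. ball_average f z (rad (j + N))) \<longlonglongrightarrow> L"
      by (rule filterlim_compose[OF L])
        (use rad_tendsto_0 in \<open>auto simp: filterlim_at intro!: LIMSEQ_ignore_initial_segment\<close>)
    then have "b \<longlonglongrightarrow> avg_const * 0 + \<bar>L - L\<bar>"
      unfolding b_def by (intro tendsto_intros summable_LIMSEQ_zero a)
    then show ?thesis by simp
  qed
  \<comment> \<open>\<open>2 ^ n\<close> pays for passing from a radius r to the next dyadic radius,
    which is below 2r; \<open>2 powr q\<close> is the constant of
    \<open>powr_sum_le\<close>.\<close>
  define D where "D = (\<lambda>j. 2 ^ n * 2 powr q / \<omega> * (C * t (Suc (j + N)) powr (q / p) + \<omega> * b j powr q))"
  have D_nonneg: "0 \<le> D j" for j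
    using \<omega> C by (simp add: D_def)
  have "(\<lambda>j. t (j + Suc N)) \<longlonglongrightarrow> 0"
    using t by (rule LIMSEQ_ignore_initial_segment)
  then have "D \<longlonglongrightarrow> 2 ^ n * 2 powr q / \<omega> * (C * 0 powr (q / p) + \<omega> * 0 powr q)"
    unfolding D_def using q p b t_nonneg b_nonneg
    by (intro tendsto_intros tendsto_powr') auto
  then have D: "D \<longlonglongrightarrow> 0" by simp
  let ?I = "\<lambda>r. \<integral>\<^sup>+x. ennreal (\<bar>f x - L\<bar> powr q) * near r z x \<partial>lborel"
  \<comment> \<open>\<open>k\<close> is one step finer than \<open>j + N\<close> because B(x, rad
    k), for x in B(z, rad k), fits into the ball about z of radius
    \<open>2 * rad k = rad (j + N)\<close>.\<close>
  have scale: "?I (rad k) \<le> ennreal (\<omega> * rad k ^ n / 2 ^ n) * ennreal (D j)" if k: "k = Suc (j + N)" for k j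
  proof -
    have pt: "ennreal (\<bar>f x - L\<bar> powr q) * near (rad k) z x \<le>
      ennreal (2 powr q) * (ennreal (\<bar>f x - ball_average f x (rad k)\<bar> powr q) * near (rad k) z x) +
      ennreal (2 powr q * b j powr q) * near (rad k) z x" for x
    proof (cases "dist z x < rad k")
      case True
      have "ennreal \<bar>ball_average f x (rad k) - ball_average f z (rad (j + N))\<bar> \<le> ennreal avg_const * scale_osc (j + N) z"
      proof (rule ball_average_ball_average_le)
        show "ball x (rad k) \<subseteq> ball z (rad (j + N))"
        proof
          fix y assume "y \<in> ball x (rad k)"
          then have "dist z y < rad k + rad k"
            using True by (intro dist_triangle_less_add[of z x]) (auto simp: dist_commute)
          then show "y \<in> ball z (rad (j + N))" by (simp add: k rad_Suc)
        qed
      qed (auto simp: k rad_Suc)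
      also have "\<dots> = ennreal (avg_const * a j)"
        using a avg_const_pos by (simp add: ennreal_mult)
      finally have "\<bar>ball_average f x (rad k) - ball_average f z (rad (j + N))\<bar> \<le> avg_const * a j"
        using a avg_const_pos by (subst (asm) ennreal_le_iff) auto
      then have "\<bar>f x - L\<bar> \<le> \<bar>f x - ball_average f x (rad k)\<bar> + b j"
        unfolding b_def by linarith
      then have "\<bar>f x - L\<bar> powr q \<le> (\<bar>f x - ball_average f x (rad k)\<bar> + b j) powr q"
        using q by (intro powr_mono2) auto
      also have "\<dots> \<le> 2 powr q * (\<bar>f x - ball_average f x (rad k)\<bar> powr q + b j powr q)"
        using q b_nonneg by (intro powr_sum_le) auto
      finally have "ennreal (\<bar>f x - L\<bar> powr q) \<le>
          ennreal (2 powr q * \<bar>f x - ball_average f x (rad k)\<bar> powr q + 2 powr q * b j powr q)"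
        by (intro ennreal_leI) (simp add: distrib_left)
      also have "\<dots> = ennreal (2 powr q * \<bar>f x - ball_average f x (rad k)\<bar> powr q) + ennreal (2 powr q * b j powr q)"
        by (intro ennreal_plus) auto
      also have "ennreal (2 powr q * \<bar>f x - ball_average f x (rad k)\<bar> powr q) =
          ennreal (2 powr q) * ennreal (\<bar>f x - ball_average f x (rad k)\<bar> powr q)"
        by (intro ennreal_mult) auto
      finally show ?thesis using True by (simp add: near_def)
    qed (simp add: near_def)
    \<comment> \<open>Measurability in the centre: the average is rewritten as a parameter integral
      with jointly measurable integrand.\<close>
    have meas: "(\<lambda>x. ball_average f x (rad k)) \<in> borel_measurable borel"
    proof -
      have "(\<lambda>x. LINT y|lborel. (if dist x y < rad k then 1 else 0) *\<^sub>R f y) \<in> borel_measurable borel"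
        by measurable
      moreover have "ball_average f x (rad k) = (LINT y|lborel. (if dist x y < rad k then 1 else 0) *\<^sub>R f y) / (\<omega> * rad k ^ n)" for x
      proof -
        have "ball_average f x (rad k) = (LINT y|lborel. indicator (ball x (rad k)) y *\<^sub>R f y) / (\<omega> * rad k ^ n)"
          unfolding ball_average_def set_lebesgue_integral_def
          by (subst integral_completion) (auto simp: content_ball \<omega>_def n_def)
        also have "(LINT y|lborel. indicator (ball x (rad k)) y *\<^sub>R f y) = (LINT y|lborel. (if dist x y < rad k then 1 else 0) *\<^sub>R f y)"
          by (intro Bochner_Integration.integral_cong) (auto simp: indicator_def)
        finally show ?thesis .
      qed
      ultimately show ?thesis by simp
    qed
    note [measurable] = meas
    have "?I (rad k) \<le> (\<integral>\<^sup>+x. ennreal (2 powr q) * (ennreal (\<bar>f x - ball_average f x (rad k)\<bar> powr q) * near (rad k) z x) +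
      ennreal (2 powr q * b j powr q) * near (rad k) z x \<partial>lborel)"
      by (intro nn_integral_mono pt)
    also have "\<dots> = ennreal (2 powr q) * (\<integral>\<^sup>+x. ennreal (\<bar>f x - ball_average f x (rad k)\<bar> powr q) * near (rad k) z x \<partial>lborel) +
      ennreal (2 powr q * b j powr q) * ennreal (\<omega> * rad k ^ n)"
      by (simp add: nn_integral_add nn_integral_cmult nn_integral_near \<omega>_def n_def)
    also have "\<dots> \<le> ennreal (2 powr q) * ennreal (C * \<Lambda> k powr (q / p)) + ennreal (2 powr q * b j powr q) * ennreal (\<omega> * rad k ^ n)"
      by (intro add_right_mono mult_left_mono C \<Lambda>) auto
    also have "\<dots> = ennreal (2 powr q * (C * \<Lambda> k powr (q / p)) + 2 powr q * b j powr q * (\<omega> * rad k ^ n))"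
      using C \<omega> by (simp add: ennreal_mult [symmetric] ennreal_plus [symmetric] del: ennreal_plus)
    also have "2 powr q * (C * \<Lambda> k powr (q / p)) + 2 powr q * b j powr q * (\<omega> * rad k ^ n) = \<omega> * rad k ^ n / 2 ^ n * D j"
    proof -
      have "(p * \<theta> - real n) * (q / p) = - real n"
        using p p\<theta>_less by (simp add: q_def sobolev_exponent_def n_def field_simps)
      then have "t k powr (q / p) = rad k powr - real n * \<Lambda> k powr (q / p)"
        using \<Lambda> by (simp add: t_def powr_mult powr_powr)
      then have "rad k ^ n * t k powr (q / p) = \<Lambda> k powr (q / p)"
        by (simp add: powr_minus powr_realpow)
      moreover have "\<omega> * rad k ^ n / 2 ^ n * D j = 2 powr q * (C * (rad k ^ n * t k powr (q / p))) + 2 powr q * b j powr q * (\<omega> * rad k ^ n)"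
        using \<omega> by (simp add: D_def k algebra_simps)
      ultimately show ?thesis by simp
    qed
    also have "ennreal (\<omega> * rad k ^ n / 2 ^ n * D j) = ennreal (\<omega> * rad k ^ n / 2 ^ n) * ennreal (D j)"
      using \<omega> D_nonneg by (intro ennreal_mult) auto
    finally show ?thesis .
  qed
  have bound: "?I r / ennreal (\<omega> * r ^ n) \<le> ennreal (D j)"
    if r: "rad (Suc (Suc (j + N))) < r" "r \<le> rad (Suc (j + N))" for r j
  proof -
    have r0: "0 < r" using r rad_pos by (meson less_trans)
    have "?I r \<le> ?I (rad (Suc (j + N)))"
      using r by (intro nn_integral_mono mult_left_mono) (auto simp: near_def)
    also have "\<dots> \<le> ennreal (\<omega> * rad (Suc (j + N)) ^ n / 2 ^ n) * ennreal (D j)"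
      by (rule scale) simp
    also have "\<dots> \<le> ennreal (\<omega> * r ^ n) * ennreal (D j)"
    proof (intro mult_right_mono ennreal_leI)
      have "(rad (Suc (j + N)) / 2) ^ n \<le> r ^ n"
        using r by (intro power_mono) (auto simp: rad_Suc)
      then have "\<omega> * (rad (Suc (j + N)) / 2) ^ n \<le> \<omega> * r ^ n"
        using \<omega> by (intro mult_left_mono) auto
      then show "\<omega> * rad (Suc (j + N)) ^ n / 2 ^ n \<le> \<omega> * r ^ n"
        by (simp add: power_divide)
    qed simp
    finally have "?I r / ennreal (\<omega> * r ^ n) \<le> ennreal (\<omega> * r ^ n) * ennreal (D j) / ennreal (\<omega> * r ^ n)"
      by (rule divide_right_mono_ennreal)
    also have "\<dots> = ennreal (D j)"
      using \<omega> r0 D_nonneg by (subst ennreal_mult [symmetric]) (auto simp: divide_ennreal)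
    finally show ?thesis .
  qed
  have "((\<lambda>r. ?I r / ennreal (\<omega> * r ^ n)) \<longlongrightarrow> 0) (at_right 0)"
  proof (rule order_tendstoI)
    fix e :: ennreal assume e: "0 < e"
    have "(\<lambda>j. ennreal (D j)) \<longlonglongrightarrow> ennreal 0"
      by (intro tendsto_ennrealI D)
    then have "eventually (\<lambda>j. ennreal (D j) < e) sequentially"
      using e by (intro order_tendstoD) auto
    then obtain J where J: "\<And>j. J \<le> j \<Longrightarrow> ennreal (D j) < e"
      by (auto simp: eventually_sequentially)
    show "eventually (\<lambda>r. ?I r / ennreal (\<omega> * r ^ n) < e) (at_right 0)"
      unfolding eventually_at_right_field
    proof (intro exI conjI allI impI)
      show "0 < rad (Suc (J + N))" by simp
      fix r assume r: "0 < r" "r < rad (Suc (J + N))"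
      have "r \<le> 1" using r rad_le_1[of "Suc (J + N)"] by linarith
      then obtain i where i: "rad (Suc i) < r" "r \<le> rad i" using r rad_bracket by blast
      have "Suc (J + N) \<le> i"
      proof (rule ccontr)
        assume "\<not> Suc (J + N) \<le> i"
        then have "rad (Suc (J + N)) \<le> rad (Suc i)" by (intro rad_mono) auto
        then show False using i r by linarith
      qed
      then have "i = Suc ((i - Suc N) + N)" "J \<le> i - Suc N" by auto
      then obtain j where "i = Suc (j + N)" "J \<le> j" by blast
      then show "?I r / ennreal (\<omega> * r ^ n) < e"
        using bound[of j r] J[of j] i by (auto intro: le_less_trans)
    qed
  qed auto
  then show ?thesis by (simp only: q_def \<omega>_def n_def)
qed

section \<open>Capacity of the set of non-Lebesgue points\<close>

lemma limsup_ball_average_good: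
  "x \<in> good_points \<Longrightarrow> Limsup (at_right 0) (\<lambda>r. ereal (ball_average f x r)) = ereal (f x)"
  by (intro lim_imp_Limsup) (auto intro!: tendsto_ereal ball_average_tendsto_good)

text \<open>\<open>u\<close> is real almost everywhere, where it equals \<open>f\<close>, and real
  at \<open>z\<close>, so infinite values contribute nothing to the integral.\<close>

lemma nn_ball_average_ereal:
  fixes u :: "'a \<Rightarrow> ereal"
  assumes u: "AE x in lborel. u x = ereal (f x)" and L: "u z = ereal L" and "0 < r"
  shows "nn_ball_average (\<lambda>x. ennreal_powr (e2ennreal \<bar>u x - u z\<bar>) q) z r =
    (\<integral>\<^sup>+x. ennreal (\<bar>f x - L\<bar> powr q) * near r z x \<partial>lborel) / ennreal (unit_ball_vol DIM('a) * r ^ DIM('a))"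
proof -
  have "(\<integral>\<^sup>+x\<in>ball z r. ennreal_powr (e2ennreal \<bar>u x - u z\<bar>) q \<partial>lebesgue) =
    (\<integral>\<^sup>+x. ennreal (\<bar>f x - L\<bar> powr q) * near r z x \<partial>lborel)"
    unfolding nn_integral_completion
  proof (rule nn_integral_cong_AE, use u in eventually_elim)
    case (elim x)
    have "near r z x = indicator (ball z r) x"
      by (simp add: near_def indicator_def)
    moreover have "\<bar>u x - u z\<bar> = ereal \<bar>f x - L\<bar>"
      by (simp add: elim L)
    ultimately show ?case
      by (simp add: ennreal_powr_def e2ennreal_ereal)
  qed
  moreover have "emeasure lebesgue (ball z r) = ennreal (unit_ball_vol DIM('a) * r ^ DIM('a))"
    using \<open>0 < r\<close> by (simp add: emeasure_ball)
  ultimately show ?thesis by (simp add: nn_ball_average_def)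
qed

theorem capacity_non_Lebesgue_points:
  "besov_capacity \<theta> p (non_Lebesgue_points sobolev_exponent
     (\<lambda>z. Limsup (at_right 0) (\<lambda>r. ereal (ball_average f z r)))) = 0"
  (is "besov_capacity \<theta> p (non_Lebesgue_points _ ?u) = 0")
proof -
  define A where "A = {x. \<forall>N. pot N x = \<infinity>}"
  define B where "B = {z. \<not> (\<lambda>k. ennreal (rad k powr (p * \<theta> - real DIM('a))) * local_energy k z) \<longlonglongrightarrow> 0}"
  have u_ae: "AE x in lborel. ?u x = ereal (f x)"
    using AE_good_points by eventually_elim (rule limsup_ball_average_good)
  have "non_Lebesgue_points sobolev_exponent ?u \<subseteq> A \<union> B"
  proof
    fix z assume z: "z \<in> non_Lebesgue_points sobolev_exponent ?u"
    show "z \<in> A \<union> B"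
    proof (rule ccontr)
      assume "z \<notin> A \<union> B"
      then obtain N where N: "pot N z < \<infinity>"
        and energy: "(\<lambda>k. ennreal (rad k powr (p * \<theta> - real DIM('a))) * local_energy k z) \<longlonglongrightarrow> 0"
        by (auto simp: A_def B_def less_top)
      obtain L where L: "((\<lambda>r. ball_average f z r) \<longlongrightarrow> L) (at_right 0)"
        using ball_average_tendsto[OF N] by metis
      then have uz: "?u z = ereal L"
        by (intro lim_imp_Limsup) auto
      let ?g = "nn_ball_average (\<lambda>x. ennreal_powr (e2ennreal \<bar>?u x - ?u z\<bar>) sobolev_exponent) z"
      have "(?g \<longlongrightarrow> 0) (at_right 0)"
      proof (rule Lim_transform_eventually[OF lebesgue_point[OF N energy L]])
        show "eventually (\<lambda>r. (\<integral>\<^sup>+x. ennreal (\<bar>f x - L\<bar> powr sobolev_exponent) * near r z x \<partial>lborel) /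
          ennreal (unit_ball_vol DIM('a) * r ^ DIM('a)) = ?g r) (at_right 0)"
          using eventually_at_right_less[of 0]
          by eventually_elim (rule nn_ball_average_ereal[OF u_ae uz, symmetric])
      qed
      then have "Limsup (at_right 0) ?g = 0"
        by (intro lim_imp_Limsup) auto
      then show False using z by (simp add: non_Lebesgue_points_def)
    qed
  qed
  \<comment> \<open>Countable subadditivity for two null sets: repeating \<open>B\<close> costs
    nothing, as every term is 0.\<close>
  also have "A \<union> B = (\<Union>i::nat. if i = 0 then A else B)"
    by (auto split: if_splits)
  finally have "besov_capacity \<theta> p (non_Lebesgue_points sobolev_exponent ?u) \<le> besov_capacity \<theta> p (\<Union>i::nat. if i = 0 then A else B)"
    by (rule besov_capacity_mono)
  also have "\<dots> \<le> (\<Sum>i::nat. besov_capacity \<theta> p (if i = 0 then A else B))"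
    using p_ge_1 by (intro besov_capacity_UN_le) auto
  also have "\<dots> = (\<Sum>i::nat. 0)"
    using capacity_pot_infinite capacity_local_energy by (intro suminf_cong) (simp add: A_def B_def)
  finally show ?thesis by simp
qed

end

theorem proposition13p6:
  fixes p \<theta> q :: real
    and ut :: "real ^ 'n \<Rightarrow> real"
    and u :: "real ^ 'n \<Rightarrow> ereal"
    and E :: "(real ^ 'n) set"
  assumes "1 \<le> p" and "0 < \<theta>" and "\<theta> < 1"
    and "p * \<theta> < real CARD('n)"
    and "q = real CARD('n) * p / (real CARD('n) - p * \<theta>)"
    and "ut \<in> besov_space \<theta> p"
    and "\<And>\<zeta>. u \<zeta> = Limsup (at_right 0) (\<lambda>r. ereal (ball_average ut \<zeta> r))"
    and "E = non_Lebesgue_points q u"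
  shows "besov_capacity \<theta> p E = 0"
proof -
  have ut: "ut \<in> borel_measurable lebesgue" "Lp_energy p ut < \<infinity>" "besov_energy \<theta> p ut < \<infinity>"
    using assms(6) by (auto simp: besov_space_def)
  \<comment> \<open>Changing \<open>ut\<close> on a null set leaves every ball average, hence
    \<open>u\<close> at every point, unchanged; so the locale can be entered with a Borel
    representative.\<close>
  obtain f where f: "f \<in> borel_measurable borel" "AE x in lebesgue. ut x = f x"
    using borel_representative[OF ut(1)] by metis
  interpret besov_function p \<theta> f
    using assms(1-4) f ut Lp_energy_cong_AE[OF f(2), of p] besov_energy_cong_AE[OF f(2), of \<theta> p]
    by unfold_locales auto
  have "(LINT x:ball \<zeta> r|lebesgue. ut x) = (LINT x:ball \<zeta> r|lebesgue. f x)" for \<zeta> r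
    unfolding set_lebesgue_integral_def
  proof (rule integral_cong_AE)
    show "AE x in lebesgue. indicator (ball \<zeta> r) x *\<^sub>R ut x = indicator (ball \<zeta> r) x *\<^sub>R f x"
      using f(2) by eventually_elim simp
    have "f \<in> borel_measurable lebesgue"
      using f(1) by (auto intro: measurable_completion)
    then show "(\<lambda>x. indicator (ball \<zeta> r) x *\<^sub>R f x) \<in> borel_measurable lebesgue"
      by (intro borel_measurable_scaleR borel_measurable_indicator) auto
    show "(\<lambda>x. indicator (ball \<zeta> r) x *\<^sub>R ut x) \<in> borel_measurable lebesgue"
      using ut(1) by (intro borel_measurable_scaleR borel_measurable_indicator) auto
  qed
  then have "ball_average ut = ball_average f"
    by (auto simp: ball_average_def fun_eq_iff)
  then have "u = (\<lambda>z. Limsup (at_right 0) (\<lambda>r. ereal (ball_average f z r)))"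
    using assms(7) by (auto simp: fun_eq_iff)
  moreover have "q = sobolev_exponent"
    using assms(5) by (simp add: sobolev_exponent_def)
  ultimately show ?thesis
    using capacity_non_Lebesgue_points assms(8) by simp
qed

end
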